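(* Let $k$ be a field of characteristic $0$, let $X=\{X_1,\dots,X_g\}$ and let $\mathcal I\subset k\langle X\rangle$ be a formally rationally resolvable ideal. If $k\langle X\rangle/\mathcal I$ is a Sylvester domain (e.g., a free ideal ring), then $\mathcal I$ satisfies the Nullstellensatz property.
   Context: $k\langle X\rangle$ is the free associative unital algebra over $k$ in the freely noncommuting variables $X_1,\dots,X_g$; "ideal" means two-sided ideal. For an ideal $\mathcal I\subset k\langle X\rangle$ put $Z(\mathcal I)=\bigcup_{n\in\mathbb N}\{A\in M_n(k)^g : h(A)=0\ \text{for all } h\in\mathcal I\}$. The ideal $\mathcal I$ has the Nullstellensatz property if for each $f\in k\langle X\rangle$: $f\in\mathcal I$ if and only if $f|_{Z(\mathcal I)}=0$. Free skew field. An nc rational expression in $X$ is a formal expression built from elements of $k\langle X\rangle$ using addition, multiplication and inversion; its domain $\operatorname{dom} r$ is the set of all $g$-tuples of square matrices over $k$ (of all sizes $n$) at which all the inverses occurring in $r$ exist. Only expressions with nonempty domain are considered. Expressions $r_1,r_2$ are equivalent if $r_1(A)=r_2(A)$ for all $A\in\operatorname{dom} r_1\cap\operatorname{dom} r_2$; equivalence classes are called (nc) rational functions, and they form a skew field $k(\!\langle X\rangle\!)$, the free skew field, which is the universal skew field of fractions of $k\langle X\rangle$. The height of an expression is the maximal number of nested inverses in it; the height of a rational function is the minimum of heights of the expressions representing it. $k(\!\langle X\rangle\!)_h$ is the subring of rational functions of height at most $h$; for a tuple $r$ of rational functions, $h(r)$ is the maximum of the heights of its components. Formal rational resolvability. Fix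 a partition $X=X'\cup X''=\{X'_1,\dots,X'_{g'}\}\cup\{X''_1,\dots,X''_{g''}\}$ (a decomposition of $X$) and a tuple $r=(r_1,\dots,r_{g''})$ with $r_j\in k(\!\langle X'\rangle\!)$. Let $R_r$ be the subring of $k(\!\langle X\rangle\!)$ generated by $k(\!\langle X'\rangle\!)_{h(r)}$ and $k\langle X\rangle$, and let $\mathcal I_r$ be the ideal of $R_r$ generated by $\{X''_j-r_j(X')\}_j$. The ideal $\mathcal I\subset k\langle X\rangle$ is formally rationally resolvable (frr) with respect to this decomposition and $r$ if (a) $\mathcal I\cap k\langle X'\rangle=0$, and (b) $\mathcal I$ generates $\mathcal I_r$ as an ideal in $R_r$. It is called formally rationally resolvable if this holds for some decomposition and some $r$. Rings. The inner rank $\rho(A)$ of an $m\times n$ matrix $A$ over a ring $R$ is the least $t$ such that $A=BC$ with $B$ of size $m\times t$ and $C$ of size $t\times n$ over $R$. A nonzero ring $R$ is a Sylvester domain if for all matrices $A$ ($m\times n$) and $B$ ($n\times p$) over $R$ with $AB=0$ one has $\rho(A)+\rho(B)\le n$. A ring is a free ideal ring (fir) if every left (right) ideal is a free left (right) module of unique rank. *)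

theory Defs
  imports
    "HOL-Library.Poly_Mapping"
    "HOL-Algebra.QuotRing"
    "HOL-Algebra.Generated_Rings"
    "HOL-Algebra.Algebraic_Closure_Type"
    "Jordan_Normal_Form.Determinant"
    "Jordan_Normal_Form.Gauss_Jordan_Elimination"
    "Jordan_Normal_Form.Char_Poly"
begin

section \<open>The free algebra\<close>

text \<open>
  Monomials are words in the variables \<open>'x\<close>; they form the free monoid under concatenation, written
  additively so that the convolution product of \<^theory>\<open>HOL-Library.Poly_Mapping\<close> makes
  the finitely supported functions on words into the free algebra.
\<close>

datatype 'x ncmono = NCMono (letters: "'x list")

instantiation ncmono :: (type) monoid_add
begin
definition zero_ncmono :: "'a ncmono" where
  "0 = NCMono []"
definition plus_ncmono :: "'a ncmono \<Rightarrow> 'a ncmono \<Rightarrow> 'a ncmono" where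
  "u + v = NCMono (letters u @ letters v)"
instance
  by standard (simp_all add: zero_ncmono_def plus_ncmono_def)
end

type_synonym ('x, 'k) ncpoly = "'x ncmono \<Rightarrow>\<^sub>0 'k"

definition ncvar :: "'x \<Rightarrow> ('x, 'k::zero_neq_one) ncpoly" where
  "ncvar x = Poly_Mapping.single (NCMono [x]) 1"

definition ncpolys_over :: "'x set \<Rightarrow> ('x, 'k::zero) ncpoly set" where
  "ncpolys_over V = {f. \<forall>w\<in>Poly_Mapping.keys f. set (letters w) \<subseteq> V}"

text \<open>
  Size 0 is excluded: every inverse would exist there, so every rational expression would have
  nonempty domain.
\<close>

definition mat_tuple :: "nat \<Rightarrow> ('x \<Rightarrow> 'k mat) \<Rightarrow> bool" where
  "mat_tuple n A \<longleftrightarrow> n \<ge> 1 \<and> (\<forall>x. A x \<in> carrier_mat n n)"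

definition ncmono_eval :: "nat \<Rightarrow> ('x \<Rightarrow> 'k::semiring_1 mat) \<Rightarrow> 'x ncmono \<Rightarrow> 'k mat" where
  "ncmono_eval n A w = foldr (\<lambda>x M. A x * M) (letters w) (1\<^sub>m n)"

definition ncpoly_eval :: "nat \<Rightarrow> ('x \<Rightarrow> 'k::semiring_1 mat) \<Rightarrow> ('x, 'k) ncpoly \<Rightarrow> 'k mat" where
  "ncpoly_eval n A f =
     mat n n (\<lambda>(i, j). \<Sum>w\<in>Poly_Mapping.keys f. Poly_Mapping.lookup f w * ncmono_eval n A w $$ (i, j))"

definition vanishing_set :: "('x, 'k::semiring_1) ncpoly set \<Rightarrow> (nat \<times> ('x \<Rightarrow> 'k mat)) set" where
  "vanishing_set I = {(n, A). mat_tuple n A \<and> (\<forall>h\<in>I. ncpoly_eval n A h = 0\<^sub>m n n)}"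

definition nullstellensatz_property :: "('x, 'k::semiring_1) ncpoly set \<Rightarrow> bool" where
  "nullstellensatz_property I \<longleftrightarrow>
     (\<forall>f. f \<in> I \<longleftrightarrow> (\<forall>(n, A)\<in>vanishing_set I. ncpoly_eval n A f = 0\<^sub>m n n))"


section \<open>Rational expressions\<close>

datatype 'p ncexp =
    Pol 'p
  | Add "'p ncexp" "'p ncexp"
  | Mul "'p ncexp" "'p ncexp"
  | Inv "'p ncexp"

type_synonym ('x, 'k) ratexp = "('x, 'k) ncpoly ncexp"

primrec ratexp_height :: "('x, 'k::zero) ratexp \<Rightarrow> nat" where
  "ratexp_height (Pol f) = 0"
| "ratexp_height (Add a b) = max (ratexp_height a) (ratexp_height b)"
| "ratexp_height (Mul a b) = max (ratexp_height a) (ratexp_height b)"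
| "ratexp_height (Inv a) = Suc (ratexp_height a)"

primrec ratexp_over :: "'x set \<Rightarrow> ('x, 'k::zero) ratexp \<Rightarrow> bool" where
  "ratexp_over V (Pol f) \<longleftrightarrow> f \<in> ncpolys_over V"
| "ratexp_over V (Add a b) \<longleftrightarrow> ratexp_over V a \<and> ratexp_over V b"
| "ratexp_over V (Mul a b) \<longleftrightarrow> ratexp_over V a \<and> ratexp_over V b"
| "ratexp_over V (Inv a) \<longleftrightarrow> ratexp_over V a"

text \<open>The value is \<^const>\<open>None\<close> exactly when some inverse occurring in the expression fails to exist.\<close>

primrec ratexp_eval :: "nat \<Rightarrow> ('x \<Rightarrow> 'k::field mat) \<Rightarrow> ('x, 'k) ratexp \<Rightarrow> 'k mat option" where
  "ratexp_eval n A (Pol f) = Some (ncpoly_eval n A f)"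
| "ratexp_eval n A (Add a b) =
     (case (ratexp_eval n A a, ratexp_eval n A b) of (Some M, Some N) \<Rightarrow> Some (M + N) | _ \<Rightarrow> None)"
| "ratexp_eval n A (Mul a b) =
     (case (ratexp_eval n A a, ratexp_eval n A b) of (Some M, Some N) \<Rightarrow> Some (M * N) | _ \<Rightarrow> None)"
| "ratexp_eval n A (Inv a) = (case ratexp_eval n A a of Some M \<Rightarrow> mat_inverse M | None \<Rightarrow> None)"

definition ratexp_dom :: "('x, 'k::field) ratexp \<Rightarrow> (nat \<times> ('x \<Rightarrow> 'k mat)) set" where
  "ratexp_dom e = {(n, A). mat_tuple n A \<and> ratexp_eval n A e \<noteq> None}"

definition ratexp_equiv :: "('x, 'k::field) ratexp \<Rightarrow> ('x, 'k) ratexp \<Rightarrow> bool" where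
  "ratexp_equiv a b \<longleftrightarrow> ratexp_dom a \<noteq> {} \<and> ratexp_dom b \<noteq> {} \<and>
     (\<forall>n A. (n, A) \<in> ratexp_dom a \<inter> ratexp_dom b \<longrightarrow> ratexp_eval n A a = ratexp_eval n A b)"


subsection \<open>Equivalence of rational expressions is transitive\<close>

text \<open>
  On a line \<open>A + t (B - A)\<close> in the space of \<open>n \<times> n\<close> tuples, a rational expression is a matrix of
  rational functions of \<open>t\<close> whose poles are exactly the points outside the domain.
\<close>

lemma smult_smult_times: "a \<cdot>\<^sub>m (b \<cdot>\<^sub>m M) = (a * b :: 'k::semigroup_mult) \<cdot>\<^sub>m M"
  by (rule eq_matI) (auto simp: mult.assoc)

lemma mat_inverse_eqI:
  fixes M :: "'k::field mat"
  assumes M: "M \<in> carrier_mat n n" and B: "B \<in> carrier_mat n n"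
    and MB: "M * B = 1\<^sub>m n" and BM: "B * M = 1\<^sub>m n"
  shows "mat_inverse M = Some B"
proof (cases "mat_inverse M")
  case None
  from mat_inverse(1)[OF M None, of undefined] M B MB BM show ?thesis
    by (auto simp: Units_def ring_mat_def)
next
  case (Some C)
  from mat_inverse(2)[OF M Some] have C: "C \<in> carrier_mat n n" "M * C = 1\<^sub>m n" by auto
  have "C = (B * M) * C" using BM C by simp
  also have "\<dots> = B * (M * C)" using M B C by (simp add: assoc_mult_mat[of _ n n _ n _ n])
  also have "\<dots> = B" using B C by simp
  finally show ?thesis using Some by simp
qed

lemma mat_inverse_None_det:
  fixes M :: "'k::field mat"
  assumes M: "M \<in> carrier_mat n n" and d: "det M = 0"
  shows "mat_inverse M = None"
proof (cases "mat_inverse M")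
  case (Some C)
  from mat_inverse(2)[OF M Some] have C: "C \<in> carrier_mat n n" "M * C = 1\<^sub>m n" by auto
  have "det M * det C = det (1\<^sub>m n :: 'k mat)" using det_mult[OF M C(1)] C(2) by simp
  then show ?thesis using d by simp
qed simp

lemma ncmono_eval_carrier [simp]:
  assumes "\<And>x. A x \<in> carrier_mat n n"
  shows "ncmono_eval n A w \<in> carrier_mat n n"
proof -
  have "foldr (\<lambda>x M. A x * M) xs (1\<^sub>m n) \<in> carrier_mat n n" for xs
    by (induction xs) (auto intro: mult_carrier_mat[OF assms])
  then show ?thesis by (simp add: ncmono_eval_def)
qed

lemma ncpoly_eval_carrier [simp]: "ncpoly_eval n A f \<in> carrier_mat n n"
  by (simp add: ncpoly_eval_def)

lemma ratexp_eval_carrier: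
  "ratexp_eval n A e = Some M \<Longrightarrow> M \<in> carrier_mat n n"
proof (induction e arbitrary: M)
  case (Inv e)
  then show ?case by (auto split: option.splits dest: mat_inverse(2))
qed (auto split: option.splits)

definition line :: "('x \<Rightarrow> 'k::field mat) \<Rightarrow> ('x \<Rightarrow> 'k mat) \<Rightarrow> 'k \<Rightarrow> 'x \<Rightarrow> 'k mat" where
  "line A B t x = A x + t \<cdot>\<^sub>m (B x - A x)"

lemma mat_tupleD:
  assumes "mat_tuple n A"
  shows "A x \<in> carrier_mat n n" "dim_row (A x) = n" "dim_col (A x) = n" "n > 0"
  using assms unfolding mat_tuple_def by (auto dest!: spec[of _ x])

lemma mat_tuple_line: "mat_tuple n A \<Longrightarrow> mat_tuple n B \<Longrightarrow> mat_tuple n (line A B t)"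
  unfolding line_def by (subst mat_tuple_def) (auto simp: mat_tupleD Suc_le_eq)

lemma line_0: "mat_tuple n A \<Longrightarrow> mat_tuple n B \<Longrightarrow> line A B 0 = A"
  by (rule ext, rule eq_matI) (auto simp: mat_tupleD line_def)

lemma line_1: "mat_tuple n A \<Longrightarrow> mat_tuple n B \<Longrightarrow> line A B 1 = B"
  by (rule ext, rule eq_matI) (auto simp: mat_tupleD line_def)

lemma map_poly_one: "map_mat (\<lambda>p. poly p t) (1\<^sub>m n) = (1\<^sub>m n :: 'k::comm_ring_1 mat)"
  by (rule eq_matI) auto

lemma map_poly_mult:
  assumes "P \<in> carrier_mat n n" "Q \<in> carrier_mat n n"
  shows "map_mat (\<lambda>p. poly p (t::'k::comm_ring_1)) (P * Q)
    = map_mat (\<lambda>p. poly p t) P * map_mat (\<lambda>p. poly p t) Q"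
  by (rule eq_matI) (use assms in \<open>auto simp: scalar_prod_def poly_sum\<close>)

lemma det_map_poly: "det (map_mat (\<lambda>p. poly p (t::'k::comm_ring_1)) P) = poly (det P) t"
proof -
  have "comm_ring_hom (\<lambda>p. poly p t)" by unfold_locales auto
  then show ?thesis by (rule comm_ring_hom.hom_det)
qed

lemma ncmono_eval_poly:
  assumes L: "\<And>x. L x \<in> carrier_mat n n"
  shows "ncmono_eval n (\<lambda>x. map_mat (\<lambda>p. poly p t) (L x)) w
    = map_mat (\<lambda>p. poly p (t::'k::field)) (ncmono_eval n L w)"
proof -
  have "foldr (\<lambda>x M. map_mat (\<lambda>p. poly p t) (L x) * M) xs (1\<^sub>m n)
      = map_mat (\<lambda>p. poly p t) (foldr (\<lambda>x M. L x * M) xs (1\<^sub>m n))" for xs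
  proof (induction xs)
    case Nil
    then show ?case by (simp add: map_poly_one)
  next
    case (Cons x xs)
    have "foldr (\<lambda>x M. L x * M) xs (1\<^sub>m n) \<in> carrier_mat n n"
      using ncmono_eval_carrier[of L n "NCMono xs"] L by (simp add: ncmono_eval_def)
    then show ?case using Cons L by (simp add: map_poly_mult[of _ n])
  qed
  then show ?thesis by (simp add: ncmono_eval_def)
qed

lemma ratexp_eval_line:
  fixes e :: "('x, 'k::field) ratexp"
  assumes A: "mat_tuple n A" and B: "mat_tuple n B"
  obtains d :: "'k poly" and P :: "'k poly mat" where
    "P \<in> carrier_mat n n"
    "\<And>t. ratexp_eval n (line A B t) e =
       (if poly d t \<noteq> 0 then Some (inverse (poly d t) \<cdot>\<^sub>m map_mat (\<lambda>p. poly p t) P) else None)"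
proof -
  let ?E = "\<lambda>t. map_mat (\<lambda>p. poly p (t::'k))"
  have "\<exists>d P. P \<in> carrier_mat n n \<and> (\<forall>t. ratexp_eval n (line A B t) e =
       (if poly d t \<noteq> 0 then Some (inverse (poly d t) \<cdot>\<^sub>m ?E t P) else None))"
  proof (induction e)
    case (Pol f)
    define L where "L x = mat n n (\<lambda>ij. [:A x $$ ij, B x $$ ij - A x $$ ij:])" for x
    have L: "L x \<in> carrier_mat n n" for x by (simp add: L_def)
    have line: "line A B t = (\<lambda>x. ?E t (L x))" for t
      by (rule ext, rule eq_matI) (auto simp: line_def L_def mat_tupleD[OF A] mat_tupleD[OF B])
    define P where "P = mat n n (\<lambda>ij. \<Sum>w\<in>Poly_Mapping.keys f. [:Poly_Mapping.lookup f w:] * ncmono_eval n L w $$ ij)"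
    have "ratexp_eval n (line A B t) (Pol f) = Some (?E t P)" for t
    proof -
      have *: "dim_row (ncmono_eval n L w) = n" "dim_col (ncmono_eval n L w) = n" for w
        using ncmono_eval_carrier[of L n w, OF L] by auto
      have "ncpoly_eval n (line A B t) f = ?E t P"
        by (rule eq_matI)
          (auto simp: ncpoly_eval_def P_def line ncmono_eval_poly[OF L] poly_sum * intro!: sum.cong)
      then show ?thesis by simp
    qed
    moreover have "1 \<cdot>\<^sub>m M = M" for M :: "'k mat" by (rule eq_matI) auto
    ultimately show ?case by (intro exI[of _ 1] exI[of _ P]) (auto simp: P_def)
  next
    case (Add a b)
    then obtain d P d' P' where P: "P \<in> carrier_mat n n" "P' \<in> carrier_mat n n" and
      e: "\<And>t. ratexp_eval n (line A B t) a =
            (if poly d t \<noteq> 0 then Some (inverse (poly d t) \<cdot>\<^sub>m ?E t P) else None)"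
         "\<And>t. ratexp_eval n (line A B t) b =
            (if poly d' t \<noteq> 0 then Some (inverse (poly d' t) \<cdot>\<^sub>m ?E t P') else None)"
      by blast
    have "inverse (poly d t) \<cdot>\<^sub>m ?E t P + inverse (poly d' t) \<cdot>\<^sub>m ?E t P'
        = inverse (poly (d * d') t) \<cdot>\<^sub>m ?E t (d' \<cdot>\<^sub>m P + d \<cdot>\<^sub>m P')"
      if "poly d t \<noteq> 0" "poly d' t \<noteq> 0" for t
      by (rule eq_matI) (use P that in \<open>auto simp: field_simps\<close>)
    then show ?case
      by (intro exI[of _ "d * d'"] exI[of _ "d' \<cdot>\<^sub>m P + d \<cdot>\<^sub>m P'"]) (use P e in auto)
  next
    case (Mul a b)
    then obtain d P d' P' where P: "P \<in> carrier_mat n n" "P' \<in> carrier_mat n n" and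
      e: "\<And>t. ratexp_eval n (line A B t) a =
            (if poly d t \<noteq> 0 then Some (inverse (poly d t) \<cdot>\<^sub>m ?E t P) else None)"
         "\<And>t. ratexp_eval n (line A B t) b =
            (if poly d' t \<noteq> 0 then Some (inverse (poly d' t) \<cdot>\<^sub>m ?E t P') else None)"
      by blast
    have "(inverse (poly d t) \<cdot>\<^sub>m ?E t P) * (inverse (poly d' t) \<cdot>\<^sub>m ?E t P')
        = inverse (poly (d * d') t) \<cdot>\<^sub>m ?E t (P * P')" for t
    proof -
      have "(inverse (poly d t) \<cdot>\<^sub>m ?E t P) * (inverse (poly d' t) \<cdot>\<^sub>m ?E t P')
        = inverse (poly d t) \<cdot>\<^sub>m (inverse (poly d' t) \<cdot>\<^sub>m (?E t P * ?E t P'))"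
        using P by (simp add: mult_smult_assoc_mat[of _ n n _ n] mult_smult_distrib[of _ n n _ n]
          smult_smult_times mult.commute)
      also have "?E t P * ?E t P' = ?E t (P * P')"
        using P by (simp add: map_poly_mult[of _ n])
      finally show ?thesis by (simp add: smult_smult_times mult.commute)
    qed
    then show ?case
      by (intro exI[of _ "d * d'"] exI[of _ "P * P'"]) (use P e in auto)
  next
    case (Inv a)
    then obtain d P where P: "P \<in> carrier_mat n n" and
      e: "\<And>t. ratexp_eval n (line A B t) a =
            (if poly d t \<noteq> 0 then Some (inverse (poly d t) \<cdot>\<^sub>m ?E t P) else None)"
      by blast
    let ?d = "d * det P" and ?P = "(d * d) \<cdot>\<^sub>m adj_mat P"
    note adj = adj_mat[OF P]
    have det: "det (?E t P) = poly (det P) t" for t by (rule det_map_poly)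
    have E: "?E t P \<in> carrier_mat n n" "?E t (adj_mat P) \<in> carrier_mat n n" for t
      using P adj(1) by auto
    have EE: "?E t (c \<cdot>\<^sub>m M) = poly c t \<cdot>\<^sub>m ?E t M" for c M t
      by (rule eq_matI) auto
    have prod: "?E t P * ?E t (adj_mat P) = poly (det P) t \<cdot>\<^sub>m 1\<^sub>m n"
      "?E t (adj_mat P) * ?E t P = poly (det P) t \<cdot>\<^sub>m 1\<^sub>m n" for t
      using arg_cong[OF adj(2), of "?E t"] arg_cong[OF adj(3), of "?E t"] P adj(1)
      by (simp_all add: map_poly_mult[of _ n] EE map_poly_one)
    have "mat_inverse (inverse (poly d t) \<cdot>\<^sub>m ?E t P) =
        (if poly ?d t \<noteq> 0 then Some (inverse (poly ?d t) \<cdot>\<^sub>m ?E t ?P) else None)"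
      if d: "poly d t \<noteq> 0" for t
    proof (cases "poly (det P) t = 0")
      case True
      have "det (inverse (poly d t) \<cdot>\<^sub>m ?E t P) = 0" using True P det[of t] by simp
      then show ?thesis using True E by (simp add: mat_inverse_None_det[of _ n])
    next
      case False
      let ?c = "inverse (poly ?d t) * (poly d t * poly d t)"
      have c: "inverse (poly d t) * (?c * poly (det P) t) = 1" using False d by (simp add: field_simps)
      have c': "?c * (inverse (poly d t) * poly (det P) t) = 1" using c by (simp add: ac_simps)
      have one: "1 \<cdot>\<^sub>m M = M" for M :: "'k mat" by (rule eq_matI) auto
      have "mat_inverse (inverse (poly d t) \<cdot>\<^sub>m ?E t P) = Some (?c \<cdot>\<^sub>m ?E t (adj_mat P))"
      proof (rule mat_inverse_eqI[of _ n])
        show "(inverse (poly d t) \<cdot>\<^sub>m ?E t P) * (?c \<cdot>\<^sub>m ?E t (adj_mat P)) = 1\<^sub>m n"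
          using E c c' by (simp only: mult_smult_assoc_mat[of _ n n _ n] mult_smult_distrib[of _ n n _ n]
            prod smult_smult_times smult_carrier_mat one)
        show "(?c \<cdot>\<^sub>m ?E t (adj_mat P)) * (inverse (poly d t) \<cdot>\<^sub>m ?E t P) = 1\<^sub>m n"
          using E c c' by (simp only: mult_smult_assoc_mat[of _ n n _ n] mult_smult_distrib[of _ n n _ n]
            prod smult_smult_times smult_carrier_mat one)
      qed (use E in auto)
      also have "?c \<cdot>\<^sub>m ?E t (adj_mat P) = inverse (poly ?d t) \<cdot>\<^sub>m ?E t ?P"
        by (simp add: EE smult_smult_times)
      finally show ?thesis using False d by simp
    qed
    then show ?case
      by (intro exI[of _ ?d] exI[of _ ?P]) (use adj(1) e in auto)
  qed
  then show thesis using that by blast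
qed

text \<open>\<open>amp m M\<close> is \<open>M \<otimes> I\<^sub>m\<close>; it moves points of the domain to multiples of their size.\<close>

definition amp :: "nat \<Rightarrow> 'k::semiring_1 mat \<Rightarrow> 'k mat" where
  "amp m M = mat (dim_row M * m) (dim_col M * m)
     (\<lambda>(i, j). if i mod m = j mod m then M $$ (i div m, j div m) else 0)"

lemma amp_carrier [simp]: "M \<in> carrier_mat n n \<Longrightarrow> amp m M \<in> carrier_mat (n * m) (n * m)"
  by (auto simp: amp_def)

lemma sum_amp:
  fixes f :: "nat \<Rightarrow> nat \<Rightarrow> 'a::comm_monoid_add"
  assumes "m > 0"
  shows "(\<Sum>l<n * m. f (l div m) (l mod m)) = (\<Sum>a<n. \<Sum>b<m. f a b)"
proof -
  have "(\<Sum>l<n * m. f (l div m) (l mod m)) = (\<Sum>(a, b)\<in>{..<n} \<times> {..<m}. f a b)"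
  proof (rule sum.reindex_bij_witness[where j = "\<lambda>l. (l div m, l mod m)" and i = "\<lambda>(a, b). a * m + b"])
    fix p assume "p \<in> {..<n} \<times> {..<m}"
    then obtain a b where p: "p = (a, b)" "a < n" "b < m" by auto
    then have "a * m + b < Suc a * m" by simp
    also have "\<dots> \<le> n * m" using p by (intro mult_le_mono1) simp
    finally show "(case p of (a, b) \<Rightarrow> a * m + b) \<in> {..<n * m}" using p by simp
  qed (use assms in \<open>auto simp: less_mult_imp_div_less\<close>)
  then show ?thesis by (simp add: sum.cartesian_product)
qed

lemma amp_mult:
  assumes M: "M \<in> carrier_mat n n" and N: "N \<in> carrier_mat n n" and m: "m > 0"
  shows "amp m (M * N) = amp m M * amp m N"
proof (rule eq_matI)
  fix i j assume "i < dim_row (amp m M * amp m N)" "j < dim_col (amp m M * amp m N)"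
  then have ij: "i < n * m" "j < n * m" using M N by (auto simp: amp_def)
  then have ij': "i div m < n" "j div m < n" by (auto simp: less_mult_imp_div_less)
  have "(amp m M * amp m N) $$ (i, j) = (\<Sum>l<n * m. amp m M $$ (i, l) * amp m N $$ (l, j))"
    using ij M N by (simp add: amp_def scalar_prod_def lessThan_atLeast0)
  also have "\<dots> = (\<Sum>l<n * m. (\<lambda>a b. (if i mod m = b then M $$ (i div m, a) else 0)
      * (if b = j mod m then N $$ (a, j div m) else 0)) (l div m) (l mod m))"
    using ij M N by (intro sum.cong) (auto simp: amp_def)
  also have "\<dots> = (\<Sum>a<n. \<Sum>b<m. (if i mod m = b then M $$ (i div m, a) else 0)
      * (if b = j mod m then N $$ (a, j div m) else 0))"
    by (rule sum_amp[OF m])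
  also have "\<dots> = (\<Sum>a<n. \<Sum>b<m. if i mod m = b then (if i mod m = j mod m then
      M $$ (i div m, a) * N $$ (a, j div m) else 0) else 0)"
    by (intro sum.cong refl) auto
  also have "\<dots> = (\<Sum>a<n. if i mod m = j mod m then M $$ (i div m, a) * N $$ (a, j div m) else 0)"
    using m by (simp add: sum.delta)
  also have "\<dots> = amp m (M * N) $$ (i, j)"
    using ij ij' M N by (simp add: amp_def scalar_prod_def lessThan_atLeast0)
  finally show "amp m (M * N) $$ (i, j) = (amp m M * amp m N) $$ (i, j)" by simp
qed (use M N in \<open>auto simp: amp_def\<close>)

lemma amp_add:
  assumes M: "M \<in> carrier_mat n n" and N: "N \<in> carrier_mat n n"
  shows "amp m (M + N) = amp m M + amp m N"
  by (rule eq_matI) (use M N in \<open>auto simp: amp_def less_mult_imp_div_less\<close>)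

lemma amp_one: "m > 0 \<Longrightarrow> amp m (1\<^sub>m n) = 1\<^sub>m (n * m)"
proof (rule eq_matI)
  fix i j assume "m > 0" "i < dim_row (1\<^sub>m (n * m) :: 'a mat)" "j < dim_col (1\<^sub>m (n * m) :: 'a mat)"
  moreover have "i div m = j div m \<and> i mod m = j mod m \<longleftrightarrow> i = j"
    by (metis div_mult_mod_eq)
  ultimately show "amp m (1\<^sub>m n) $$ (i, j) = (1\<^sub>m (n * m) :: 'a mat) $$ (i, j)"
    by (auto simp: amp_def less_mult_imp_div_less)
qed (auto simp: amp_def)

lemma amp_inj:
  assumes M: "M \<in> carrier_mat n n" and N: "N \<in> carrier_mat n n" and m: "m > 0"
    and eq: "amp m M = amp m N"
  shows "M = N"
proof (rule eq_matI)
  fix i j assume "i < dim_row N" "j < dim_col N"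
  then have ij: "i < n" "j < n" using N by auto
  then have "i * m < n * m" "j * m < n * m" using m by auto
  moreover have "amp m M $$ (i * m, j * m) = amp m N $$ (i * m, j * m)" using eq by simp
  ultimately show "M $$ (i, j) = N $$ (i, j)" using M N m by (simp add: amp_def)
qed (use M N in auto)

lemma ncmono_eval_amp:
  assumes A: "\<And>x. A x \<in> carrier_mat n n" and m: "m > 0"
  shows "ncmono_eval (n * m) (\<lambda>x. amp m (A x)) w = amp m (ncmono_eval n A w)"
proof -
  have "foldr (\<lambda>x M. amp m (A x) * M) xs (1\<^sub>m (n * m)) = amp m (foldr (\<lambda>x M. A x * M) xs (1\<^sub>m n))" for xs
  proof (induction xs)
    case Nil
    then show ?case by (simp add: amp_one m)
  next
    case (Cons x xs)
    have "foldr (\<lambda>x M. A x * M) xs (1\<^sub>m n) \<in> carrier_mat n n"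
      using ncmono_eval_carrier[of A n "NCMono xs"] A by (simp add: ncmono_eval_def)
    then show ?case using Cons A m by (simp add: amp_mult[of _ n])
  qed
  then show ?thesis by (simp add: ncmono_eval_def)
qed

lemma ratexp_eval_amp:
  assumes A: "mat_tuple n A" and m: "m > 0" and e: "ratexp_eval n A e = Some M"
  shows "ratexp_eval (n * m) (\<lambda>x. amp m (A x)) e = Some (amp m M)"
  using e
proof (induction e arbitrary: M)
  case (Pol f)
  have A': "A x \<in> carrier_mat n n" for x using A by (auto simp: mat_tuple_def)
  have w: "ncmono_eval n A w \<in> carrier_mat n n" for w by (simp add: A')
  have w': "ncmono_eval (n * m) (\<lambda>x. amp m (A x)) w $$ (i, j)
      = (if i mod m = j mod m then ncmono_eval n A w $$ (i div m, j div m) else 0)"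
    if "i < n * m" "j < n * m" for i j w
    using that w[of w] unfolding ncmono_eval_amp[OF A' m] by (simp add: amp_def)
  have "ncpoly_eval (n * m) (\<lambda>x. amp m (A x)) f = amp m (ncpoly_eval n A f)" (is "?L = ?R")
  proof (rule eq_matI)
    fix i j assume "i < dim_row ?R" "j < dim_col ?R"
    then have ij: "i < n * m" "j < n * m" by (auto simp: amp_def ncpoly_eval_def)
    then have ij': "i div m < n" "j div m < n" by (auto simp: less_mult_imp_div_less)
    have "?L $$ (i, j) = (\<Sum>w\<in>Poly_Mapping.keys f. Poly_Mapping.lookup f w *
        (if i mod m = j mod m then ncmono_eval n A w $$ (i div m, j div m) else 0))"
      using ij by (simp add: ncpoly_eval_def w')
    also have "\<dots> = ?R $$ (i, j)"
      using ij ij' by (simp add: amp_def ncpoly_eval_def)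
    finally show "?L $$ (i, j) = ?R $$ (i, j)" .
  qed (auto simp: amp_def ncpoly_eval_def)
  then show ?case using Pol by simp
next
  case (Add a b)
  then show ?case by (auto split: option.splits simp: amp_add[OF ratexp_eval_carrier ratexp_eval_carrier])
next
  case (Mul a b)
  then show ?case by (auto split: option.splits simp: amp_mult[OF ratexp_eval_carrier ratexp_eval_carrier m])
next
  case (Inv a)
  then obtain N where N: "ratexp_eval n A a = Some N" "mat_inverse N = Some M"
    by (auto split: option.splits)
  have Nc: "N \<in> carrier_mat n n" using N(1) by (rule ratexp_eval_carrier)
  from mat_inverse(2)[OF Nc N(2)] have M: "N * M = 1\<^sub>m n" "M * N = 1\<^sub>m n" "M \<in> carrier_mat n n" by auto
  have "mat_inverse (amp m N) = Some (amp m M)"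
    by (rule mat_inverse_eqI[of _ "n * m"])
      (use Nc M m in \<open>simp_all add: amp_mult[of _ n, symmetric] amp_one\<close>)
  then show ?case using Inv.IH[OF N(1)] by simp
qed

lemma mat_tuple_amp: "mat_tuple n A \<Longrightarrow> m \<ge> 1 \<Longrightarrow> mat_tuple (n * m) (\<lambda>x. amp m (A x))"
  by (auto simp: mat_tuple_def Suc_le_eq)

lemma poly_nonzero_point:
  fixes p :: "'k::field_char_0 poly"
  assumes "p \<noteq> 0"
  obtains t where "poly p t \<noteq> 0"
  using poly_all_0_iff_0[of p] assms by blast

lemma ratexp_common_point:
  fixes a b :: "('x, 'k::field_char_0) ratexp"
  assumes "ratexp_dom a \<noteq> {}" "ratexp_dom b \<noteq> {}"
  shows "ratexp_dom a \<inter> ratexp_dom b \<noteq> {}"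
proof -
  from assms obtain n A m B M N where
    A: "mat_tuple n A" "ratexp_eval n A a = Some M" and B: "mat_tuple m B" "ratexp_eval m B b = Some N"
    by (auto simp: ratexp_dom_def)
  define A' where "A' = (\<lambda>x. amp m (A x))"
  define B' where "B' = (\<lambda>x. amp n (B x))"
  have nm: "n > 0" "m > 0" using A B by (auto simp: mat_tuple_def)
  have A': "mat_tuple (n * m) A'" "ratexp_eval (n * m) A' a \<noteq> None"
    using mat_tuple_amp[OF A(1), of m] ratexp_eval_amp[OF A(1) nm(2) A(2)] nm by (auto simp: A'_def)
  have B': "mat_tuple (n * m) B'" "ratexp_eval (n * m) B' b \<noteq> None"
    using mat_tuple_amp[OF B(1), of n] ratexp_eval_amp[OF B(1) nm(1) B(2)] nm
    by (auto simp: B'_def mult.commute)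
  obtain d P where d: "\<And>t. ratexp_eval (n * m) (line A' B' t) a =
       (if poly d t \<noteq> 0 then Some (inverse (poly d t) \<cdot>\<^sub>m map_mat (\<lambda>p. poly p t) P) else None)"
    by (rule ratexp_eval_line[OF A'(1) B'(1), of a]) blast
  obtain d' P' where d': "\<And>t. ratexp_eval (n * m) (line A' B' t) b =
       (if poly d' t \<noteq> 0 then Some (inverse (poly d' t) \<cdot>\<^sub>m map_mat (\<lambda>p. poly p t) P') else None)"
    by (rule ratexp_eval_line[OF A'(1) B'(1), of b]) blast
  have "poly d 0 \<noteq> 0" using d[of 0] A' by (auto simp: line_0[OF A'(1) B'(1)] split: if_splits)
  moreover have "poly d' 1 \<noteq> 0" using d'[of 1] B' by (auto simp: line_1[OF A'(1) B'(1)] split: if_splits)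
  ultimately have "d * d' \<noteq> 0" by auto
  then obtain t where "poly (d * d') t \<noteq> 0" by (rule poly_nonzero_point)
  then have "(n * m, line A' B' t) \<in> ratexp_dom a \<inter> ratexp_dom b"
    using d[of t] d'[of t] mat_tuple_line[OF A'(1) B'(1), of t] by (auto simp: ratexp_dom_def)
  then show ?thesis by blast
qed

lemma ratexp_equiv_trans:
  fixes a b c :: "('x, 'k::field_char_0) ratexp"
  assumes ab: "ratexp_equiv a b" and bc: "ratexp_equiv b c"
  shows "ratexp_equiv a c"
proof -
  have "ratexp_eval n A a = ratexp_eval n A c" if A: "(n, A) \<in> ratexp_dom a" "(n, A) \<in> ratexp_dom c" for n A
  proof -
    from A obtain M N where M: "ratexp_eval n A a = Some M" and N: "ratexp_eval n A c = Some N"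
      and A1: "mat_tuple n A" by (auto simp: ratexp_dom_def)
    from bc obtain m B where B1: "mat_tuple m B" and B2: "ratexp_eval m B b \<noteq> None"
      by (auto simp: ratexp_equiv_def ratexp_dom_def)
    define A' where "A' = (\<lambda>x. amp m (A x))"
    define B' where "B' = (\<lambda>x. amp n (B x))"
    have nm: "n > 0" "m > 0" using A1 B1 by (auto simp: mat_tuple_def)
    have A': "mat_tuple (n * m) A'"
      using mat_tuple_amp[OF A1, of m] nm by (auto simp: A'_def)
    have eA: "ratexp_eval (n * m) A' a = Some (amp m M)" "ratexp_eval (n * m) A' c = Some (amp m N)"
      using ratexp_eval_amp[OF A1 nm(2)] M N by (auto simp: A'_def)
    have B': "mat_tuple (n * m) B'" "ratexp_eval (n * m) B' b \<noteq> None"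
      using mat_tuple_amp[OF B1, of n] ratexp_eval_amp[OF B1 nm(1)] B2 nm
      by (auto simp: B'_def mult.commute)
    let ?E = "\<lambda>t. map_mat (\<lambda>p. poly p (t::'k))"
    obtain d1 P1 where P1: "P1 \<in> carrier_mat (n * m) (n * m)" and
      d1: "\<And>t. ratexp_eval (n * m) (line A' B' t) a =
         (if poly d1 t \<noteq> 0 then Some (inverse (poly d1 t) \<cdot>\<^sub>m ?E t P1) else None)"
      using ratexp_eval_line[OF A' B'(1), of a] by metis
    obtain d2 P2 where
      d2: "\<And>t. ratexp_eval (n * m) (line A' B' t) b =
         (if poly d2 t \<noteq> 0 then Some (inverse (poly d2 t) \<cdot>\<^sub>m ?E t P2) else None)"
      using ratexp_eval_line[OF A' B'(1), of b] by metis
    obtain d3 P3 where P3: "P3 \<in> carrier_mat (n * m) (n * m)" and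
      d3: "\<And>t. ratexp_eval (n * m) (line A' B' t) c =
         (if poly d3 t \<noteq> 0 then Some (inverse (poly d3 t) \<cdot>\<^sub>m ?E t P3) else None)"
      using ratexp_eval_line[OF A' B'(1), of c] by metis
    have d10: "poly d1 0 \<noteq> 0" using d1[of 0] eA by (auto simp: line_0[OF A' B'(1)] split: if_splits)
    have d30: "poly d3 0 \<noteq> 0" using d3[of 0] eA by (auto simp: line_0[OF A' B'(1)] split: if_splits)
    have d21: "poly d2 1 \<noteq> 0" using d2[of 1] B' by (auto simp: line_1[OF A' B'(1)] split: if_splits)
    have nz: "d1 \<noteq> 0" "d2 \<noteq> 0" "d3 \<noteq> 0" using d10 d30 d21 by auto
    have cross: "d3 * P1 $$ (i, j) = d1 * P3 $$ (i, j)" if ij: "i < n * m" "j < n * m" for i j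
    proof -
      have "poly (d1 * d2 * d3 * (d3 * P1 $$ (i, j) - d1 * P3 $$ (i, j))) t = 0" for t
      proof (cases "poly (d1 * d2 * d3) t = 0")
        case False
        have T: "mat_tuple (n * m) (line A' B' t)" by (rule mat_tuple_line[OF A' B'(1)])
        have "(n * m, line A' B' t) \<in> ratexp_dom a \<inter> ratexp_dom b"
          "(n * m, line A' B' t) \<in> ratexp_dom b \<inter> ratexp_dom c"
          using False T d1[of t] d2[of t] d3[of t] by (auto simp: ratexp_dom_def)
        then have "ratexp_eval (n * m) (line A' B' t) a = ratexp_eval (n * m) (line A' B' t) c"
          using ab bc by (simp add: ratexp_equiv_def)
        then have "inverse (poly d1 t) \<cdot>\<^sub>m ?E t P1 = inverse (poly d3 t) \<cdot>\<^sub>m ?E t P3"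
          using d1[of t] d3[of t] False by simp
        then have "(inverse (poly d1 t) \<cdot>\<^sub>m ?E t P1) $$ (i, j) = (inverse (poly d3 t) \<cdot>\<^sub>m ?E t P3) $$ (i, j)"
          by simp
        then show ?thesis using P1 P3 ij False by (simp add: field_simps)
      qed simp
      then have "d1 * d2 * d3 * (d3 * P1 $$ (i, j) - d1 * P3 $$ (i, j)) = 0"
        using poly_all_0_iff_0 by blast
      then show ?thesis using nz by simp
    qed
    have "amp m M = inverse (poly d1 0) \<cdot>\<^sub>m ?E 0 P1"
      using d1[of 0] d10 eA by (simp add: line_0[OF A' B'(1)])
    also have "\<dots> = inverse (poly d3 0) \<cdot>\<^sub>m ?E 0 P3"
    proof (rule eq_matI)
      fix i j assume "i < dim_row (inverse (poly d3 0) \<cdot>\<^sub>m ?E 0 P3)"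
        "j < dim_col (inverse (poly d3 0) \<cdot>\<^sub>m ?E 0 P3)"
      then have ij: "i < n * m" "j < n * m" using P3 by auto
      have "poly (d3 * P1 $$ (i, j)) 0 = poly (d1 * P3 $$ (i, j)) 0" using cross[OF ij] by simp
      then show "(inverse (poly d1 0) \<cdot>\<^sub>m ?E 0 P1) $$ (i, j) = (inverse (poly d3 0) \<cdot>\<^sub>m ?E 0 P3) $$ (i, j)"
        using ij P1 P3 d10 d30 by (simp add: field_simps)
    qed (use P1 P3 in auto)
    also have "\<dots> = amp m N"
      using d3[of 0] d30 eA by (simp add: line_0[OF A' B'(1)])
    finally have "M = N"
      using amp_inj[OF ratexp_eval_carrier[OF M] ratexp_eval_carrier[OF N] nm(2)] by blast
    then show ?thesis using M N by simp
  qed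
  then show ?thesis using ab bc by (auto simp: ratexp_equiv_def)
qed


section \<open>The free skew field\<close>

lemma ratexp_dom_Pol: "ratexp_dom (Pol f) \<noteq> {}"
proof -
  have "(1, \<lambda>_. 0\<^sub>m 1 1) \<in> ratexp_dom (Pol f)" by (simp add: ratexp_dom_def mat_tuple_def)
  then show ?thesis by blast
qed

lemma ratexp_dom_Add: "ratexp_dom (Add a b) = ratexp_dom a \<inter> ratexp_dom b"
  by (auto simp: ratexp_dom_def split: option.splits)

lemma ratexp_dom_Mul: "ratexp_dom (Mul a b) = ratexp_dom a \<inter> ratexp_dom b"
  by (auto simp: ratexp_dom_def split: option.splits)

lemma ratexp_equiv_refl: "ratexp_equiv a a \<longleftrightarrow> ratexp_dom a \<noteq> {}"
  by (auto simp: ratexp_equiv_def)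

lemma part_equivp_ratexp_equiv: "part_equivp (ratexp_equiv :: ('x, 'k::field_char_0) ratexp \<Rightarrow> _)"
proof (rule part_equivpI)
  show "\<exists>a :: ('x, 'k) ratexp. ratexp_equiv a a"
    using ratexp_dom_Pol ratexp_equiv_refl by blast
  show "symp (ratexp_equiv :: ('x, 'k) ratexp \<Rightarrow> _)"
    by (rule sympI) (simp add: ratexp_equiv_def)
  show "transp (ratexp_equiv :: ('x, 'k) ratexp \<Rightarrow> _)"
    by (rule transpI) (rule ratexp_equiv_trans)
qed

quotient_type (overloaded) ('x, 'k) ratfun = "('x, 'k::field_char_0) ratexp" / partial: ratexp_equiv
  morphisms rep_ratfun ratfun_of
  by (rule part_equivp_ratexp_equiv)

lemma ratexp_equiv_Add:
  fixes a b :: "('x, 'k::field_char_0) ratexp"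
  assumes "ratexp_equiv a a'" "ratexp_equiv b b'"
  shows "ratexp_equiv (Add a b) (Add a' b')"
proof -
  have "ratexp_dom (Add a b) \<noteq> {}" "ratexp_dom (Add a' b') \<noteq> {}"
    using assms by (simp_all add: ratexp_dom_Add ratexp_common_point ratexp_equiv_def)
  then show ?thesis using assms by (simp add: ratexp_equiv_def ratexp_dom_Add)
qed

lemma ratexp_equiv_Mul:
  fixes a b :: "('x, 'k::field_char_0) ratexp"
  assumes "ratexp_equiv a a'" "ratexp_equiv b b'"
  shows "ratexp_equiv (Mul a b) (Mul a' b')"
proof -
  have "ratexp_dom (Mul a b) \<noteq> {}" "ratexp_dom (Mul a' b') \<noteq> {}"
    using assms by (simp_all add: ratexp_dom_Mul ratexp_common_point ratexp_equiv_def)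
  then show ?thesis using assms by (simp add: ratexp_equiv_def ratexp_dom_Mul)
qed

lemma ratexp_equivI:
  fixes a b :: "('x, 'k::field_char_0) ratexp"
  assumes "ratexp_dom a \<noteq> {}" "ratexp_dom b \<noteq> {}"
    and "\<And>n A. mat_tuple n A \<Longrightarrow> ratexp_eval n A a \<noteq> None \<Longrightarrow> ratexp_eval n A b \<noteq> None \<Longrightarrow>
      ratexp_eval n A a = ratexp_eval n A b"
  shows "ratexp_equiv a b"
  using assms by (auto simp: ratexp_equiv_def ratexp_dom_def)

lemma ncmono_eval_0: "ncmono_eval n A 0 = 1\<^sub>m n"
  by (simp add: ncmono_eval_def zero_ncmono_def)

lemma ncpoly_eval_0: "ncpoly_eval n A 0 = 0\<^sub>m n n"
  by (rule eq_matI) (auto simp: ncpoly_eval_def)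

lemma ncpoly_eval_const:
  "ncpoly_eval n A (Poly_Mapping.single 0 c) = c \<cdot>\<^sub>m 1\<^sub>m n"
  by (rule eq_matI) (auto simp: ncpoly_eval_def ncmono_eval_0)

lemma ncpoly_eval_1: "ncpoly_eval n A 1 = 1\<^sub>m n"
  unfolding single_one[symmetric] ncpoly_eval_const by (rule eq_matI) auto

instantiation ratfun :: (type, field_char_0) ring_1
begin

lift_definition zero_ratfun :: "('a, 'b) ratfun" is "Pol 0"
  by (simp add: ratexp_equiv_refl ratexp_dom_Pol)

lift_definition one_ratfun :: "('a, 'b) ratfun" is "Pol 1"
  by (simp add: ratexp_equiv_refl ratexp_dom_Pol)

lift_definition plus_ratfun :: "('a, 'b) ratfun \<Rightarrow> ('a, 'b) ratfun \<Rightarrow> ('a, 'b) ratfun" is Add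
  by (rule ratexp_equiv_Add)

lift_definition times_ratfun :: "('a, 'b) ratfun \<Rightarrow> ('a, 'b) ratfun \<Rightarrow> ('a, 'b) ratfun" is Mul
  by (rule ratexp_equiv_Mul)

lift_definition uminus_ratfun :: "('a, 'b) ratfun \<Rightarrow> ('a, 'b) ratfun"
  is "Mul (Pol (Poly_Mapping.single 0 (-1)))"
  by (intro ratexp_equiv_Mul) (simp_all add: ratexp_equiv_refl ratexp_dom_Pol)

definition minus_ratfun :: "('a, 'b) ratfun \<Rightarrow> ('a, 'b) ratfun \<Rightarrow> ('a, 'b) ratfun" where
  "a - b = a + - (b :: ('a, 'b) ratfun)"

instance
proof
  note dom = ratexp_common_point ratexp_dom_Add ratexp_dom_Mul ratexp_dom_Pol ratexp_equiv_refl
  have dom3: "ratexp_dom a \<inter> (ratexp_dom b \<inter> ratexp_dom c) \<noteq> {}"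
    if "ratexp_dom a \<noteq> {}" "ratexp_dom b \<noteq> {}" "ratexp_dom c \<noteq> {}"
    for a b c :: "('a, 'b) ratexp"
    using ratexp_common_point[of a "Add b c"] that by (simp add: dom)
  have domP: "ratexp_dom (Pol f) \<inter> ratexp_dom a \<noteq> {}" "ratexp_dom a \<inter> ratexp_dom (Pol f) \<noteq> {}"
    if "ratexp_dom a \<noteq> {}" for a :: "('a, 'b) ratexp" and f
    using that by (simp_all add: dom)
  note carr = ratexp_eval_carrier
  fix a b c :: "('a, 'b) ratfun"
  show "a + b + c = a + (b + c)"
    by transfer (rule ratexp_equivI,
      auto simp: dom dom3 Int_assoc split: option.splits intro!: assoc_add_mat dest!: carr)
  show "a + b = b + a"
    by transfer (rule ratexp_equivI,
      auto simp: dom split: option.splits intro!: comm_add_mat dest!: carr)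
  show "0 + a = a"
    by transfer (rule ratexp_equivI,
      auto simp: dom domP ncpoly_eval_0 split: option.splits dest!: carr)
  show "- a + a = 0"
  proof transfer
    fix a :: "('a, 'b) ratexp" assume "ratexp_equiv a a"
    then have a: "ratexp_dom a \<noteq> {}" by (simp add: dom)
    have "(- 1 \<cdot>\<^sub>m 1\<^sub>m n) * M + M = 0\<^sub>m n n" if "M \<in> carrier_mat n n" for n and M :: "'b mat"
      using that by (simp add: mult_smult_assoc_mat[of _ n n _ n]) (rule eq_matI, auto)
    then show "ratexp_equiv (Add (Mul (Pol (Poly_Mapping.single 0 (- 1))) a) a) (Pol 0)"
      using ratexp_common_point[of "Mul (Pol (Poly_Mapping.single 0 (- 1))) a" a] a
      by (intro ratexp_equivI)
        (auto simp: dom ncpoly_eval_0 ncpoly_eval_const split: option.splits dest!: carr)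
  qed
  show "a - b = a + - b" by (rule minus_ratfun_def)
  show "a * b * c = a * (b * c)"
    by transfer (rule ratexp_equivI,
      auto simp: dom dom3 Int_assoc split: option.splits intro!: assoc_mult_mat dest!: carr)
  show "1 * a = a"
    by transfer (rule ratexp_equivI,
      auto simp: dom domP ncpoly_eval_1 split: option.splits dest!: carr)
  show "a * 1 = a"
    by transfer (rule ratexp_equivI,
      auto simp: dom domP ncpoly_eval_1 split: option.splits dest!: carr)
  have Int3: "S \<inter> (T \<inter> S) = T \<inter> S" "S \<inter> (T \<inter> (S \<inter> U)) = S \<inter> (T \<inter> U)"
    for S T U :: "(nat \<times> ('a \<Rightarrow> 'b mat)) set" by auto
  show "(a + b) * c = a * c + b * c"
    by transfer (rule ratexp_equivI,
      auto simp: dom(2-) dom3 Int_assoc Int3 split: option.splits intro!: add_mult_distrib_mat dest!: carr)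
  show "a * (b + c) = a * b + a * c"
    by transfer (rule ratexp_equivI,
      auto simp: dom(2-) dom3 Int_assoc Int3 split: option.splits intro!: mult_add_distrib_mat dest!: carr)
  show "(0 :: ('a, 'b) ratfun) \<noteq> 1"
  proof transfer
    have "(1, \<lambda>_. 0\<^sub>m 1 1) \<in> ratexp_dom (Pol (0::('a, 'b) ncpoly)) \<inter> ratexp_dom (Pol 1)"
      by (simp add: ratexp_dom_def mat_tuple_def)
    moreover have "ratexp_eval 1 (\<lambda>_. 0\<^sub>m 1 1) (Pol (0::('a, 'b) ncpoly)) \<noteq> ratexp_eval 1 (\<lambda>_. 0\<^sub>m 1 1) (Pol 1)"
    proof
      assume "ratexp_eval 1 (\<lambda>_. 0\<^sub>m 1 1) (Pol (0::('a, 'b) ncpoly)) = ratexp_eval 1 (\<lambda>_. 0\<^sub>m 1 1) (Pol 1)"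
      then have "(0\<^sub>m 1 1 :: 'b mat) = 1\<^sub>m 1" by (simp add: ncpoly_eval_0 ncpoly_eval_1)
      then have "(0\<^sub>m 1 1 :: 'b mat) $$ (0, 0) = 1\<^sub>m 1 $$ (0, 0)" by (rule arg_cong)
      then show False by simp
    qed
    ultimately show "\<not> ratexp_equiv (Pol (0::('a, 'b) ncpoly)) (Pol 1)"
      unfolding ratexp_equiv_def by blast
  qed
qed

end

definition ratfun_of_ncpoly :: "('x, 'k::field_char_0) ncpoly \<Rightarrow> ('x, 'k) ratfun" where
  "ratfun_of_ncpoly f = ratfun_of (Pol f)"

text \<open>
  For a set \<open>V\<close> of variables, the free skew field on \<open>V\<close> is realised inside the one on all
  variables, as the classes of the expressions in which only variables from \<open>V\<close> occur. The value of
  such an expression does not depend on the remaining matrices, so this is the same as evaluating it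
  on tuples indexed by \<open>V\<close>.
\<close>

definition ratfuns_over :: "'x set \<Rightarrow> ('x, 'k::field_char_0) ratfun set" where
  "ratfuns_over V = {ratfun_of e | e. ratexp_dom e \<noteq> {} \<and> ratexp_over V e}"

definition ratfun_height :: "'x set \<Rightarrow> ('x, 'k::field_char_0) ratfun \<Rightarrow> nat" where
  "ratfun_height V s =
     (LEAST h. \<exists>e. ratexp_dom e \<noteq> {} \<and> ratexp_over V e \<and> ratfun_of e = s \<and> ratexp_height e = h)"

definition ratfuns_height_le :: "'x set \<Rightarrow> nat \<Rightarrow> ('x, 'k::field_char_0) ratfun set" where
  "ratfuns_height_le V h = {s \<in> ratfuns_over V. ratfun_height V s \<le> h}"


section \<open>Formal rational resolvability\<close>

abbreviation ncpoly_ring :: "('x, 'k::field_char_0) ncpoly ring" where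
  "ncpoly_ring \<equiv> ring_of_type_algebra"

abbreviation ratfun_ring :: "('x, 'k::field_char_0) ratfun ring" where
  "ratfun_ring \<equiv> ring_of_type_algebra"

text \<open>
  A decomposition of the variables is given by the set \<open>V\<close> of those in the first part; \<open>r\<close> is
  only relevant on its complement. The height of the empty tuple is 0.
\<close>

definition resolution_height :: "'x::finite set \<Rightarrow> ('x \<Rightarrow> ('x, 'k::field_char_0) ratfun) \<Rightarrow> nat" where
  "resolution_height V r = Max (insert 0 ((\<lambda>j. ratfun_height V (r j)) ` (- V)))"

definition resolution_ring ::
    "'x::finite set \<Rightarrow> ('x \<Rightarrow> ('x, 'k::field_char_0) ratfun) \<Rightarrow> ('x, 'k) ratfun ring" where
  "resolution_ring V r = ratfun_ring
     \<lparr>carrier := generate_ring ratfun_ring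
       (ratfuns_height_le V (resolution_height V r) \<union> range ratfun_of_ncpoly)\<rparr>"

definition resolution_ideal ::
    "'x::finite set \<Rightarrow> ('x \<Rightarrow> ('x, 'k::field_char_0) ratfun) \<Rightarrow> ('x, 'k) ratfun set" where
  "resolution_ideal V r =
     genideal (resolution_ring V r) {ratfun_of_ncpoly (ncvar j) - r j | j. j \<in> - V}"

definition formally_rationally_resolvable_wrt ::
    "'x::finite set \<Rightarrow> ('x \<Rightarrow> ('x, 'k::field_char_0) ratfun) \<Rightarrow> ('x, 'k) ncpoly set \<Rightarrow> bool" where
  "formally_rationally_resolvable_wrt V r I \<longleftrightarrow>
     (\<forall>j\<in>- V. r j \<in> ratfuns_over V) \<and>
     I \<inter> ncpolys_over V = {0} \<and>
     genideal (resolution_ring V r) (ratfun_of_ncpoly ` I) = resolution_ideal V r"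

definition formally_rationally_resolvable :: "('x::finite, 'k::field_char_0) ncpoly set \<Rightarrow> bool" where
  "formally_rationally_resolvable I \<longleftrightarrow> (\<exists>V r. formally_rationally_resolvable_wrt V r I)"


section \<open>Sylvester domains\<close>

definition ring_mats :: "('a, 'b) ring_scheme \<Rightarrow> nat \<Rightarrow> nat \<Rightarrow> 'a mat set" where
  "ring_mats R m n = {A \<in> carrier_mat m n. elements_mat A \<subseteq> carrier R}"

definition ring_mat_mult :: "('a, 'b) ring_scheme \<Rightarrow> 'a mat \<Rightarrow> 'a mat \<Rightarrow> 'a mat" where
  "ring_mat_mult R A B = mat (dim_row A) (dim_col B)
     (\<lambda>(i, j). \<Oplus>\<^bsub>R\<^esub>l\<in>{..<dim_col A}. A $$ (i, l) \<otimes>\<^bsub>R\<^esub> B $$ (l, j))"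

definition inner_rank :: "('a, 'b) ring_scheme \<Rightarrow> 'a mat \<Rightarrow> nat" where
  "inner_rank R A = (LEAST t. \<exists>B\<in>ring_mats R (dim_row A) t. \<exists>C\<in>ring_mats R t (dim_col A).
     A = ring_mat_mult R B C)"

definition sylvester_domain :: "('a, 'b) ring_scheme \<Rightarrow> bool" where
  "sylvester_domain R \<longleftrightarrow> ring R \<and> \<one>\<^bsub>R\<^esub> \<noteq> \<zero>\<^bsub>R\<^esub> \<and>
     (\<forall>m n p. \<forall>A\<in>ring_mats R m n. \<forall>B\<in>ring_mats R n p.
        ring_mat_mult R A B = mat m p (\<lambda>_. \<zero>\<^bsub>R\<^esub>) \<longrightarrow> inner_rank R A + inner_rank R B \<le> n)"

end

theory Submission
  imports Defs
begin

text \<open>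
  Write \<open>A\<close> for the quotient of the free algebra by \<open>I\<close>. Suppose that \<open>f\<close> vanishes on the zero set of \<open>I\<close>.

  \<^item> The points \<open>(X', r(X'))\<close> of the graph of \<open>r\<close> are zeros of \<open>I\<close>, so \<open>f(X', r(X')) = 0\<close> as a
    rational function. Modulo the resolution ideal \<open>f\<close> is congruent to \<open>f(X', r(X'))\<close>; hence \<open>f\<close> lies in
    that ideal, which by resolvability is generated by \<open>I\<close>: in the free skew field
    \<open>f = \<Sum> a\<^sub>i h\<^sub>i b\<^sub>i\<close> with \<open>h\<^sub>i \<in> I\<close> and \<open>a\<^sub>i\<close>, \<open>b\<^sub>i\<close> in the resolution ring
    (\<open>graph_point_vanishing\<close>, \<open>vanishing_imp_resolution_ideal\<close>).

  \<^item> This identity has to be brought down to the free algebra. Every rational expression is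
    \<open>c L\<^sup>-\<^sup>1 d\<close> for a matrix \<open>L\<close> over the free algebra that is invertible at each point of the domain
    (\<open>represents_exists\<close>). For an expression of the form \<open>\<Sum> a\<^sub>i h\<^sub>i b\<^sub>i\<close> the system can be chosen such that modulo
    \<open>I\<close> it falls apart into two blocks \<open>L\<^sub>1\<close> and \<open>L\<^sub>2\<close>, with \<open>d\<close> supported on the second and \<open>c\<close> on the
    first (\<open>null_represented\<close>). Both blocks are invertible at some point of the graph, which is a
    zero of \<open>I\<close>, and therefore full over \<open>A\<close> (\<open>card_le_rank_mod\<close>).

  \<^item> The identity \<open>f = c L\<^sup>-\<^sup>1 d\<close> makes the bordered matrix with rows \<open>(L, d)\<close> and \<open>(c, f)\<close> singular at
    every point of the domain. A matrix over the free algebra with this property is not full over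
    \<open>A\<close> (\<open>corank_one_rank\<close>). For linear matrices the reason is a subspace of \<open>k\<^sup>p\<close> that all
    coefficients map into a common space of smaller dimension; it is read off from a single point
    of the domain and its nilpotent perturbations (\<open>corank_one_shrunk_subspace\<close>).

  \<^item> Modulo \<open>I\<close> the bordered matrix is, after reordering, block triangular with diagonal blocks
    \<open>L\<^sub>1\<close>, \<open>L\<^sub>2\<close> and \<open>f\<close>. Over a Sylvester domain such a matrix can fail to be full only if one of the diagonal
    blocks does (\<open>zero_block_rank\<close>). The first two are full, so \<open>f\<close> has rank \<open>0\<close>, that is,
    \<open>f \<in> I\<close> (\<open>null_represented_polynomial_mem\<close>).
\<close>

section \<open>Matrix points as modules over the free algebra\<close>

lemma ncpoly_sum_single:
  "f = (\<Sum>w\<in>Poly_Mapping.keys f. Poly_Mapping.single w (Poly_Mapping.lookup f w))"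
  for f :: "'a \<Rightarrow>\<^sub>0 'b::comm_monoid_add"
proof (rule poly_mapping_eqI)
  fix v
  have sw: "Poly_Mapping.lookup (\<Sum>w\<in>S. Poly_Mapping.single w (Poly_Mapping.lookup f w)) v
      = (\<Sum>w\<in>S. Poly_Mapping.lookup f w when w = v)" for S
    by (induction S rule: infinite_finite_induct) (auto simp: lookup_add lookup_single)
  show "Poly_Mapping.lookup f v = Poly_Mapping.lookup (\<Sum>w\<in>Poly_Mapping.keys f.
      Poly_Mapping.single w (Poly_Mapping.lookup f w)) v"
    unfolding sw by (auto simp: when_def in_keys_iff)
qed

lemma ncpoly_induct [case_names zero single add]:
  fixes f :: "'a \<Rightarrow>\<^sub>0 'b::comm_monoid_add"
  assumes "P 0" "\<And>w c. P (Poly_Mapping.single w c)" "\<And>f g. P f \<Longrightarrow> P g \<Longrightarrow> P (f + g)"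
  shows "P f"
proof -
  have "P (\<Sum>w\<in>S. Poly_Mapping.single w (Poly_Mapping.lookup f w))" for S
    by (induction S rule: infinite_finite_induct) (use assms in auto)
  then show ?thesis by (metis ncpoly_sum_single)
qed

lemma single_word_Cons:
  "Poly_Mapping.single (NCMono (x # xs)) (c::'k::semiring_1)
    = ncvar x * Poly_Mapping.single (NCMono xs) c"
  by (simp add: ncvar_def mult_single plus_ncmono_def)

lemma ncpoly_induct_algebra [case_names const var add mult]:
  fixes f :: "('x, 'k::semiring_1) ncpoly"
  assumes "\<And>c. P (Poly_Mapping.single 0 c)" "\<And>x. P (ncvar x)"
    "\<And>f g. P f \<Longrightarrow> P g \<Longrightarrow> P (f + g)" "\<And>f g. P f \<Longrightarrow> P g \<Longrightarrow> P (f * g)"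
  shows "P f"
proof (induction f rule: ncpoly_induct)
  case zero
  then show ?case using assms(1)[of 0] by simp
next
  case (single w c)
  have "P (Poly_Mapping.single (NCMono xs) c)" for xs
    by (induction xs) (use assms(1)[of c] assms(2,4) in \<open>auto simp: single_word_Cons zero_ncmono_def\<close>)
  then show ?case by (cases w) auto
qed (use assms(3) in auto)

lemma ncmono_eval_add:
  fixes A :: "'x \<Rightarrow> 'k::semiring_1 mat"
  assumes "\<And>x. A x \<in> carrier_mat n n"
  shows "ncmono_eval n A (u + v) = ncmono_eval n A u * ncmono_eval n A v"
proof -
  have "foldr (\<lambda>x M. A x * M) (xs @ ys) (1\<^sub>m n)
      = foldr (\<lambda>x M. A x * M) xs (1\<^sub>m n) * foldr (\<lambda>x M. A x * M) ys (1\<^sub>m n)" for xs ys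
  proof (induction xs)
    case Nil
    then show ?case using ncmono_eval_carrier[of A n "NCMono ys"] assms by (simp add: ncmono_eval_def)
  next
    case (Cons x xs)
    then show ?case
      using ncmono_eval_carrier[of A n "NCMono xs"] ncmono_eval_carrier[of A n "NCMono ys"] assms
      by (simp add: ncmono_eval_def assoc_mult_mat[of _ n n _ n _ n])
  qed
  then show ?thesis by (simp add: ncmono_eval_def plus_ncmono_def)
qed

lemma ncpoly_eval_dims [simp]:
  "dim_row (ncpoly_eval n A f) = n" "dim_col (ncpoly_eval n A f) = n"
  by (simp_all add: ncpoly_eval_def)

lemma ncpoly_eval_index:
  assumes "finite S" "Poly_Mapping.keys f \<subseteq> S" "i < n" "j < n"
  shows "ncpoly_eval n A f $$ (i, j)
    = (\<Sum>w\<in>S. Poly_Mapping.lookup f w * ncmono_eval n A w $$ (i, j))"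
  unfolding ncpoly_eval_def using assms
  by (auto intro!: sum.mono_neutral_left simp: in_keys_iff)

lemma ncpoly_eval_add: "ncpoly_eval n A (f + g) = ncpoly_eval n A f + ncpoly_eval n A g"
proof (rule eq_matI)
  fix i j assume "i < dim_row (ncpoly_eval n A f + ncpoly_eval n A g)"
    "j < dim_col (ncpoly_eval n A f + ncpoly_eval n A g)"
  then have ij: "i < n" "j < n" by auto
  let ?S = "Poly_Mapping.keys f \<union> Poly_Mapping.keys g"
  have "Poly_Mapping.keys (f + g) \<subseteq> ?S" by (rule Poly_Mapping.keys_add)
  then show "ncpoly_eval n A (f + g) $$ (i, j) = (ncpoly_eval n A f + ncpoly_eval n A g) $$ (i, j)"
    using ij by (simp add: ncpoly_eval_index[of ?S] lookup_add algebra_simps sum.distrib)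
qed auto

lemma ncpoly_eval_single:
  assumes "\<And>x. A x \<in> carrier_mat n n"
  shows "ncpoly_eval n A (Poly_Mapping.single w c) = c \<cdot>\<^sub>m ncmono_eval n A w"
  using ncmono_eval_carrier[of A n w, OF assms]
  by (intro eq_matI) (auto simp: ncpoly_eval_index[of "{w}"])

lemma ncpoly_eval_var:
  assumes "\<And>x. A x \<in> carrier_mat n n"
  shows "ncpoly_eval n A (ncvar x) = A x"
  using assms[of x] unfolding ncvar_def ncpoly_eval_single[OF assms]
  by (intro eq_matI) (auto simp: ncmono_eval_def)

lemma ncpoly_eval_mult:
  fixes A :: "'x \<Rightarrow> 'k::comm_semiring_1 mat"
  assumes A: "\<And>x. A x \<in> carrier_mat n n"
  shows "ncpoly_eval n A (f * g) = ncpoly_eval n A f * ncpoly_eval n A g"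
proof (induction f rule: ncpoly_induct)
  case zero
  then show ?case by (simp add: ncpoly_eval_0)
next
  case (single u a)
  show ?case
  proof (induction g rule: ncpoly_induct)
    case zero
    then show ?case by (simp add: ncpoly_eval_0)
  next
    case (single v b)
    have "a \<cdot>\<^sub>m ncmono_eval n A u * (b \<cdot>\<^sub>m ncmono_eval n A v)
        = a * b \<cdot>\<^sub>m (ncmono_eval n A u * ncmono_eval n A v)"
      using ncmono_eval_carrier[of A n u, OF A] ncmono_eval_carrier[of A n v, OF A]
      by (simp add: mult_smult_assoc_mat[of _ n n _ n] mult_smult_distrib[of _ n n _ n] smult_smult_times mult.commute[of b a])
    then show ?case by (simp add: mult_single ncpoly_eval_single[OF A] ncmono_eval_add[OF A])
  next
    case (add f g)
    then show ?case
      by (simp add: distrib_left ncpoly_eval_add mult_add_distrib_mat[of _ n n _ n])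
  qed
next
  case (add f g)
  then show ?case
    by (simp add: distrib_right ncpoly_eval_add add_mult_distrib_mat[of _ n n _ _ n])
qed

text \<open>
  Vectors of all lengths share one type: a vector of length \<open>n\<close> is a sequence that vanishes from
  \<open>n\<close> on. Points of different sizes thus act on the same type.
\<close>

datatype 'k cvec = CVec (coord: "nat \<Rightarrow> 'k")

lemma cvec_eqI: "(\<And>a. coord v a = coord w a) \<Longrightarrow> v = w"
  by (cases v; cases w) (auto simp: fun_eq_iff)

instantiation cvec :: (ab_group_add) ab_group_add
begin
definition zero_cvec :: "'a cvec" where "0 = CVec (\<lambda>_. 0)"
definition plus_cvec :: "'a cvec \<Rightarrow> 'a cvec \<Rightarrow> 'a cvec" where
  "v + w = CVec (\<lambda>a. coord v a + coord w a)"
definition minus_cvec :: "'a cvec \<Rightarrow> 'a cvec \<Rightarrow> 'a cvec" where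
  "v - w = CVec (\<lambda>a. coord v a - coord w a)"
definition uminus_cvec :: "'a cvec \<Rightarrow> 'a cvec" where
  "- v = CVec (\<lambda>a. - coord v a)"
instance
  by standard (auto simp: zero_cvec_def plus_cvec_def minus_cvec_def uminus_cvec_def algebra_simps)
end

lemma coord_simps [simp]:
  "coord 0 a = 0" "coord (v + w) a = coord v a + coord w a"
  "coord (v - w) a = coord v a - coord w a" "coord (- v) a = - coord v a"
  for v w :: "'k::ab_group_add cvec"
  by (simp_all add: zero_cvec_def plus_cvec_def minus_cvec_def uminus_cvec_def)

lemma coord_sum [simp]: "coord (sum f S) a = (\<Sum>i\<in>S. coord (f i) a)"
  for f :: "'i \<Rightarrow> 'k::ab_group_add cvec"
  by (induction S rule: infinite_finite_induct) auto

lemma cvec_eq_iff: "v = w \<longleftrightarrow> (\<forall>a. coord v a = coord w a)"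
  using cvec_eqI by blast

definition vecs :: "nat \<Rightarrow> 'k::zero cvec set" where
  "vecs n = {v. \<forall>a\<ge>n. coord v a = 0}"

definition mact :: "nat \<Rightarrow> 'k::comm_ring_1 mat \<Rightarrow> 'k cvec \<Rightarrow> 'k cvec" where
  "mact n M v = CVec (\<lambda>a. if a < n then \<Sum>b<n. M $$ (a, b) * coord v b else 0)"

text \<open>
  A point of size \<open>n\<close> makes \<open>k\<^sup>n\<close> a module over the free algebra. A matrix over the free algebra
  acts on families of vectors, and its evaluation never has to be written as a block matrix.
\<close>

definition act ::
  "nat \<Rightarrow> ('x \<Rightarrow> 'k::comm_ring_1 mat) \<Rightarrow> ('x, 'k) ncpoly \<Rightarrow> 'k cvec \<Rightarrow> 'k cvec" where
  "act n A f = mact n (ncpoly_eval n A f)"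

definition cscale :: "'k::comm_ring_1 \<Rightarrow> 'k cvec \<Rightarrow> 'k cvec" where
  "cscale c v = CVec (\<lambda>a. c * coord v a)"

lemma coord_cscale [simp]: "coord (cscale c v) a = c * coord v a"
  by (simp add: cscale_def)

lemma coord_mact: "coord (mact n M v) a = (if a < n then \<Sum>b<n. M $$ (a, b) * coord v b else 0)"
  by (simp add: mact_def)

lemma vecs_closed [simp]:
  "0 \<in> vecs n" "v \<in> vecs n \<Longrightarrow> w \<in> vecs n \<Longrightarrow> v + w \<in> vecs n"
  "v \<in> vecs n \<Longrightarrow> w \<in> vecs n \<Longrightarrow> v - w \<in> vecs n" "v \<in> vecs n \<Longrightarrow> - v \<in> vecs n"
  "v \<in> vecs n \<Longrightarrow> cscale c v \<in> vecs n" for v w :: "'k::comm_ring_1 cvec"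
  by (auto simp: vecs_def)

lemma vecs_sum [simp]: "(\<And>i. i \<in> S \<Longrightarrow> f i \<in> vecs n) \<Longrightarrow> sum f S \<in> vecs n"
  for f :: "'i \<Rightarrow> 'k::comm_ring_1 cvec"
  by (auto simp: vecs_def intro!: sum.neutral)

lemma mact_vecs [simp]: "mact n M v \<in> vecs n"
  by (auto simp: coord_mact vecs_def)

lemma mact_add_right: "mact n M (v + w) = mact n M v + mact n M w"
  by (rule cvec_eqI) (simp add: coord_mact distrib_left sum.distrib)

lemma mact_0_right [simp]: "mact n M 0 = 0"
  by (rule cvec_eqI) (simp add: coord_mact)

lemma mact_sum_right: "mact n M (sum f S) = (\<Sum>i\<in>S. mact n M (f i))"
  by (induction S rule: infinite_finite_induct) (auto simp: mact_add_right)

lemma mact_uminus_right: "mact n M (- v) = - mact n M v"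
  by (rule cvec_eqI) (simp add: coord_mact sum_negf)

lemma mact_cscale_right: "mact n M (cscale c v) = cscale c (mact n M v)"
  by (rule cvec_eqI) (simp add: coord_mact sum_distrib_left ac_simps)

lemma mact_add_left:
  "M \<in> carrier_mat n n \<Longrightarrow> N \<in> carrier_mat n n \<Longrightarrow> mact n (M + N) v = mact n M v + mact n N v"
  by (rule cvec_eqI) (simp add: coord_mact distrib_right sum.distrib)

lemma mact_zero_left [simp]: "mact n (0\<^sub>m n n) v = 0"
  by (rule cvec_eqI) (simp add: coord_mact)

lemma mact_one_left [simp]: "v \<in> vecs n \<Longrightarrow> mact n (1\<^sub>m n) v = v"
  by (rule cvec_eqI) (auto simp: coord_mact vecs_def if_distrib[of "\<lambda>x. x * _"] cong: if_cong)

lemma mact_mult_left: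
  assumes "M \<in> carrier_mat n n" "N \<in> carrier_mat n n"
  shows "mact n (M * N) v = mact n M (mact n N v)"
proof (rule cvec_eqI)
  fix a
  show "coord (mact n (M * N) v) a = coord (mact n M (mact n N v)) a"
  proof (cases "a < n")
    case True
    have "coord (mact n (M * N) v) a = (\<Sum>b<n. \<Sum>c<n. M $$ (a, c) * N $$ (c, b) * coord v b)"
      using True assms
      by (auto simp: coord_mact scalar_prod_def sum_distrib_right lessThan_atLeast0 intro!: sum.cong)
    also have "\<dots> = (\<Sum>c<n. \<Sum>b<n. M $$ (a, c) * N $$ (c, b) * coord v b)" by (rule sum.swap)
    also have "\<dots> = coord (mact n M (mact n N v)) a"
      using True by (simp add: coord_mact sum_distrib_left mult.assoc)
    finally show ?thesis .
  qed (simp add: coord_mact)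
qed

lemma act_vecs [simp]: "act n A f v \<in> vecs n" by (simp add: act_def)

lemma act_0_right [simp]: "act n A f 0 = 0" by (simp add: act_def)

lemma act_0_left [simp]: "act n A 0 v = 0" by (simp add: act_def ncpoly_eval_0)

lemma act_1_left [simp]: "v \<in> vecs n \<Longrightarrow> act n A 1 v = v" by (simp add: act_def ncpoly_eval_1)

lemma act_add_right: "act n A f (v + w) = act n A f v + act n A f w"
  by (simp add: act_def mact_add_right)

lemma act_sum_right: "act n A f (sum g S) = (\<Sum>i\<in>S. act n A f (g i))"
  by (simp add: act_def mact_sum_right)

lemma act_uminus_right: "act n A f (- v) = - act n A f v" for f :: "('x, 'k::comm_ring_1) ncpoly"
  by (simp add: act_def mact_uminus_right)

lemma act_add_left: "act n A (f + g) v = act n A f v + act n A g v"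
  by (simp add: act_def ncpoly_eval_add mact_add_left)

lemma act_uminus_left: "act n A (- f) v = - act n A f v" for f :: "('x, 'k::comm_ring_1) ncpoly"
  using act_add_left[of n A "- f" f v] by (simp add: eq_neg_iff_add_eq_0)

lemma act_diff_left: "act n A (f - g) v = act n A f v - act n A g v" for f :: "('x, 'k::comm_ring_1) ncpoly"
  using act_add_left[of n A "f" "- g" v] by (simp add: act_uminus_left)

lemma act_sum_left: "act n A (sum f S) v = (\<Sum>i\<in>S. act n A (f i) v)"
  by (induction S rule: infinite_finite_induct) (auto simp: act_add_left)

lemma act_mult_left:
  fixes f :: "('x, 'k::comm_ring_1) ncpoly"
  assumes "mat_tuple n A"
  shows "act n A (f * g) v = act n A f (act n A g v)"
  using assms by (simp add: act_def mat_tuple_def ncpoly_eval_mult mact_mult_left[symmetric])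

lemma act_var:
  assumes "mat_tuple n A"
  shows "act n A (ncvar x) v = mact n (A x) v"
  using assms by (simp add: act_def mat_tuple_def ncpoly_eval_var)

lemma act_cscale_right: "act n A f (cscale c v) = cscale c (act n A f v)"
  by (simp add: act_def mact_cscale_right)

lemma act_const:
  assumes "v \<in> vecs n"
  shows "act n A (Poly_Mapping.single 0 c) v = cscale c v"
  using assms by (intro cvec_eqI) (auto simp: act_def ncpoly_eval_const coord_mact vecs_def
      if_distrib[of "\<lambda>x. x * _"] if_distrib[of "\<lambda>x. _ * x"] cong: if_cong)


section \<open>Linear systems over a field\<close>

lemma homogeneous_system:
  fixes a :: "'i \<Rightarrow> 'j \<Rightarrow> 'k::field"
  assumes "finite T" "finite S" "card T < card S"
  obtains u where "\<exists>i\<in>S. u i \<noteq> 0" "\<And>j. j \<in> T \<Longrightarrow> (\<Sum>i\<in>S. u i * a i j) = 0"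
proof -
  have "\<exists>u. (\<exists>i\<in>S. u i \<noteq> 0) \<and> (\<forall>j\<in>T. (\<Sum>i\<in>S. u i * a i j) = 0)"
    using assms
  proof (induction T arbitrary: S a rule: finite_induct)
    case empty
    then obtain i where "i \<in> S" by fastforce
    then show ?case by (intro exI[of _ "\<lambda>_. 1"]) auto
  next
    case (insert j T)
    show ?case
    proof (cases "\<forall>i\<in>S. a i j = 0")
      case True
      from insert.IH[of S a] insert.prems insert.hyps obtain u
        where "\<exists>i\<in>S. u i \<noteq> 0" "\<forall>j\<in>T. (\<Sum>i\<in>S. u i * a i j) = 0" by auto
      then show ?thesis using True by (intro exI[of _ u]) auto
    next
      case False
      then obtain p where p: "p \<in> S" "a p j \<noteq> 0" by auto
      define b where "b = (\<lambda>i l. a i l - a i j / a p j * a p l)"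
      have "card T < card (S - {p})" using insert p by simp
      from insert.IH[OF _ this, of b] insert.prems obtain u where
        u: "\<exists>i\<in>S - {p}. u i \<noteq> 0" "\<And>l. l \<in> T \<Longrightarrow> (\<Sum>i\<in>S - {p}. u i * b i l) = 0" by auto
      define w where "w = (\<lambda>i. if i = p then - (\<Sum>i\<in>S - {p}. u i * a i j) / a p j else u i)"
      have split: "(\<Sum>i\<in>S. w i * a i l) = w p * a p l + (\<Sum>i\<in>S - {p}. u i * a i l)" for l
        using p insert.prems by (subst sum.remove[of S p]) (auto simp: w_def intro!: sum.cong)
      have "(\<Sum>i\<in>S. w i * a i l) = 0" if "l \<in> T" for l
      proof -
        have "0 = (\<Sum>i\<in>S - {p}. u i * a i l) - (\<Sum>i\<in>S - {p}. u i * a i j) / a p j * a p l"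
          using u(2)[OF that] unfolding b_def
          by (simp add: right_diff_distrib sum_subtractf sum_distrib_right sum_divide_distrib mult.assoc)
        then show ?thesis unfolding split by (simp add: w_def)
      qed
      moreover have "(\<Sum>i\<in>S. w i * a i j) = 0" unfolding split using p by (simp add: w_def)
      moreover have "\<exists>i\<in>S. w i \<noteq> 0" using u(1) by (auto simp: w_def)
      ultimately show ?thesis by (intro exI[of _ w]) auto
    qed
  qed
  then show ?thesis using that by blast
qed


section \<open>Inner rank modulo an ideal\<close>

text \<open>
  Inner rank at most \<open>t\<close> over the quotient by \<open>I\<close>, in terms of representatives. Since the index
  types are arbitrary, passing to a submatrix is a restriction of the index sets.
\<close>

definition rank_le_mod :: "'a::ring_1 set \<Rightarrow> 'i set \<Rightarrow> 'j set \<Rightarrow> ('i \<Rightarrow> 'j \<Rightarrow> 'a) \<Rightarrow> nat \<Rightarrow> bool" where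
  "rank_le_mod I S T M t \<longleftrightarrow>
     (\<exists>P Q. \<forall>i\<in>S. \<forall>j\<in>T. M i j - (\<Sum>l<t. P i l * Q l j) \<in> I)"

locale two_sided_ideal =
  fixes I :: "'a::ring_1 set"
  assumes zero_mem: "0 \<in> I"
    and add_mem: "a \<in> I \<Longrightarrow> b \<in> I \<Longrightarrow> a + b \<in> I"
    and mult_left_mem: "a \<in> I \<Longrightarrow> c * a \<in> I"
    and mult_right_mem: "a \<in> I \<Longrightarrow> a * c \<in> I"
begin

lemma uminus_mem: "a \<in> I \<Longrightarrow> - a \<in> I"
  using mult_left_mem[of a "- 1"] by simp

lemma diff_mem: "a \<in> I \<Longrightarrow> b \<in> I \<Longrightarrow> a - b \<in> I"
  using add_mem[of a "- b"] uminus_mem[of b] by simp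

lemma sum_mem: "(\<And>i. i \<in> S \<Longrightarrow> f i \<in> I) \<Longrightarrow> sum f S \<in> I"
  by (induction S rule: infinite_finite_induct) (auto simp: zero_mem add_mem)

lemma trans_mem: "a - b \<in> I \<Longrightarrow> b - c \<in> I \<Longrightarrow> a - c \<in> I"
  using add_mem[of "a - b" "b - c"] by simp

lemma rank_le_modI:
  assumes "finite L" "card L \<le> t"
    and "\<And>i j. i \<in> S \<Longrightarrow> j \<in> T \<Longrightarrow> M i j - (\<Sum>l\<in>L. P i l * Q l j) \<in> I"
  shows "rank_le_mod I S T M t"
proof -
  obtain h where h: "bij_betw h {..<card L} L"
    using ex_bij_betw_nat_finite[OF assms(1)] by (auto simp: lessThan_atLeast0)
  define P' where "P' i l = (if l < card L then P i (h l) else 0)" for i l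
  have "(\<Sum>l<t. P' i l * Q (h l) j) = (\<Sum>l\<in>L. P i l * Q l j)" for i j
  proof -
    have "(\<Sum>l<t. P' i l * Q (h l) j) = (\<Sum>l<card L. P' i l * Q (h l) j)"
      using assms(2) by (intro sum.mono_neutral_right) (auto simp: P'_def)
    also have "\<dots> = (\<Sum>l<card L. P i (h l) * Q (h l) j)" by (simp add: P'_def)
    also have "\<dots> = (\<Sum>l\<in>L. P i l * Q l j)" by (rule sum.reindex_bij_betw[OF h])
    finally show ?thesis .
  qed
  then show ?thesis unfolding rank_le_mod_def using assms(3)
    by (intro exI[of _ P'] exI[of _ "\<lambda>l. Q (h l)"]) simp
qed

lemma rank_le_mod_mono:
  assumes "rank_le_mod I S T M t" "t \<le> u" "S' \<subseteq> S" "T' \<subseteq> T"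
  shows "rank_le_mod I S' T' M u"
proof -
  from assms(1) obtain P Q where "\<forall>i\<in>S. \<forall>j\<in>T. M i j - (\<Sum>l<t. P i l * Q l j) \<in> I"
    unfolding rank_le_mod_def by blast
  then show ?thesis using assms(2-) by (intro rank_le_modI[of "{..<t}" u S' T' M P Q]) auto
qed

lemma rank_le_mod_cong:
  assumes "rank_le_mod I S T N t" "\<And>i j. i \<in> S \<Longrightarrow> j \<in> T \<Longrightarrow> M i j - N i j \<in> I"
  shows "rank_le_mod I S T M t"
  using assms trans_mem unfolding rank_le_mod_def by meson

lemma rank_le_mod_reindex:
  assumes "rank_le_mod I S' T' N t" "\<And>i. i \<in> S \<Longrightarrow> f i \<in> S'" "\<And>j. j \<in> T \<Longrightarrow> g j \<in> T'"
  shows "rank_le_mod I S T (\<lambda>i j. N (f i) (g j)) t"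
proof -
  from assms(1) obtain P Q where "\<forall>i\<in>S'. \<forall>j\<in>T'. N i j - (\<Sum>l<t. P i l * Q l j) \<in> I"
    unfolding rank_le_mod_def by blast
  then show ?thesis unfolding rank_le_mod_def using assms(2-)
    by (intro exI[of _ "\<lambda>i. P (f i)"] exI[of _ "\<lambda>l j. Q l (g j)"]) auto
qed

lemma rank_le_mod_mult_right:
  assumes "rank_le_mod I S T M t" "\<And>i j. i \<in> S \<Longrightarrow> j \<in> U \<Longrightarrow> N i j - (\<Sum>l\<in>T. M i l * Y l j) \<in> I"
  shows "rank_le_mod I S U N t"
proof -
  from assms(1) obtain P Q where PQ: "\<And>i j. i \<in> S \<Longrightarrow> j \<in> T \<Longrightarrow> M i j - (\<Sum>l<t. P i l * Q l j) \<in> I"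
    unfolding rank_le_mod_def by blast
  define Q' where "Q' l j = (\<Sum>m\<in>T. Q l m * Y m j)" for l j
  have "N i j - (\<Sum>l<t. P i l * Q' l j) \<in> I" if "i \<in> S" "j \<in> U" for i j
  proof (rule trans_mem)
    show "N i j - (\<Sum>l\<in>T. M i l * Y l j) \<in> I" by (rule assms(2)[OF that])
    have "(\<Sum>l<t. P i l * Q' l j) = (\<Sum>m\<in>T. (\<Sum>l<t. P i l * Q l m) * Y m j)"
      unfolding Q'_def sum_distrib_left sum_distrib_right by (subst sum.swap) (simp add: mult.assoc)
    then have "(\<Sum>l\<in>T. M i l * Y l j) - (\<Sum>l<t. P i l * Q' l j)
        = (\<Sum>m\<in>T. (M i m - (\<Sum>l<t. P i l * Q l m)) * Y m j)"
      by (simp add: left_diff_distrib sum_subtractf)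
    then show "(\<Sum>l\<in>T. M i l * Y l j) - (\<Sum>l<t. P i l * Q' l j) \<in> I"
      using PQ that by (auto intro!: sum_mem mult_right_mem)
  qed
  then show ?thesis unfolding rank_le_mod_def by blast
qed

lemma rank_le_mod_mult_left:
  assumes "rank_le_mod I S T M t" "\<And>i j. i \<in> U \<Longrightarrow> j \<in> T \<Longrightarrow> N i j - (\<Sum>l\<in>S. Y i l * M l j) \<in> I"
  shows "rank_le_mod I U T N t"
proof -
  from assms(1) obtain P Q where PQ: "\<And>i j. i \<in> S \<Longrightarrow> j \<in> T \<Longrightarrow> M i j - (\<Sum>l<t. P i l * Q l j) \<in> I"
    unfolding rank_le_mod_def by blast
  define P' where "P' i l = (\<Sum>m\<in>S. Y i m * P m l)" for l i
  have "N i j - (\<Sum>l<t. P' i l * Q l j) \<in> I" if "i \<in> U" "j \<in> T" for i j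
  proof (rule trans_mem)
    show "N i j - (\<Sum>l\<in>S. Y i l * M l j) \<in> I" by (rule assms(2)[OF that])
    have "(\<Sum>l<t. P' i l * Q l j) = (\<Sum>m\<in>S. Y i m * (\<Sum>l<t. P m l * Q l j))"
      unfolding P'_def sum_distrib_left sum_distrib_right by (subst sum.swap) (simp add: mult.assoc)
    then have "(\<Sum>l\<in>S. Y i l * M l j) - (\<Sum>l<t. P' i l * Q l j)
        = (\<Sum>m\<in>S. Y i m * (M m j - (\<Sum>l<t. P m l * Q l j)))"
      by (simp add: right_diff_distrib sum_subtractf)
    then show "(\<Sum>l\<in>S. Y i l * M l j) - (\<Sum>l<t. P' i l * Q l j) \<in> I"
      using PQ that by (auto intro!: sum_mem mult_left_mem)
  qed
  then show ?thesis unfolding rank_le_mod_def by blast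
qed

lemma rank_le_mod_zero: "rank_le_mod I S T M 0 \<longleftrightarrow> (\<forall>i\<in>S. \<forall>j\<in>T. M i j \<in> I)"
  unfolding rank_le_mod_def by auto

end

text \<open>
  The law of nullity of a Sylvester domain, for the quotient by \<open>I\<close>.
\<close>

locale sylvester_ideal = two_sided_ideal +
  assumes nullity: "(\<And>i k. i < m \<Longrightarrow> k < p \<Longrightarrow> (\<Sum>j<n. A i j * B j k) \<in> I) \<Longrightarrow>
    \<exists>s t. s + t \<le> n \<and> rank_le_mod I {..<m::nat} {..<n::nat} A s \<and> rank_le_mod I {..<n} {..<p::nat} B t"
begin

text \<open>
  Factor \<open>M = P Q\<close> through \<open>t\<close>. On the zero block the rows of \<open>P\<close> belonging to \<open>Sa\<close> annihilate the
  columns of \<open>Q\<close> belonging to \<open>Tb\<close>, so by the law of nullity the ranks of these two parts add up to at most \<open>t\<close>.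
  Multiplication by the remaining factor gives the horizontal strip over \<open>Sa\<close> and the vertical
  strip over \<open>Tb\<close>. This is the tool by which full diagonal blocks are split off.
\<close>

lemma zero_block_rank:
  assumes M: "rank_le_mod I S T M t" and sub: "Sa \<subseteq> S" "Tb \<subseteq> T" and fin: "finite Sa" "finite Tb"
    and zero: "\<And>i j. i \<in> Sa \<Longrightarrow> j \<in> Tb \<Longrightarrow> M i j \<in> I"
  obtains p q where "p + q \<le> t" "rank_le_mod I Sa T M p" "rank_le_mod I S Tb M q"
proof -
  from M obtain P Q where PQ: "\<And>i j. i \<in> S \<Longrightarrow> j \<in> T \<Longrightarrow> M i j - (\<Sum>l<t. P i l * Q l j) \<in> I"
    unfolding rank_le_mod_def by blast
  obtain g h where g: "bij_betw g {..<card Sa} Sa" and h: "bij_betw h {..<card Tb} Tb"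
    using ex_bij_betw_nat_finite[OF fin(1)] ex_bij_betw_nat_finite[OF fin(2)]
    by (auto simp: lessThan_atLeast0)
  define g' where "g' = inv_into {..<card Sa} g"
  define h' where "h' = inv_into {..<card Tb} h"
  have g': "g' i < card Sa" "g (g' i) = i" if "i \<in> Sa" for i
    using that g unfolding g'_def
    by (metis bij_betw_def inv_into_into lessThan_iff, metis bij_betw_inv_into_right)
  have h': "h' i < card Tb" "h (h' i) = i" if "i \<in> Tb" for i
    using that h unfolding h'_def
    by (metis bij_betw_def inv_into_into lessThan_iff, metis bij_betw_inv_into_right)
  have "(\<Sum>l<t. P (g i) l * Q l (h k)) \<in> I" if "i < card Sa" "k < card Tb" for i k
  proof -
    have gh: "g i \<in> Sa" "h k \<in> Tb" using that g h by (auto simp: bij_betw_def)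
    then have "M (g i) (h k) - (M (g i) (h k) - (\<Sum>l<t. P (g i) l * Q l (h k))) \<in> I"
      using sub by (intro diff_mem zero PQ) auto
    then show ?thesis by simp
  qed
  from nullity[where m = "card Sa" and p = "card Tb" and n = t and A = "\<lambda>i l. P (g i) l"
      and B = "\<lambda>l k. Q l (h k)", OF this]
  obtain p q where pq: "p + q \<le> t" "rank_le_mod I {..<card Sa} {..<t} (\<lambda>i l. P (g i) l) p"
    "rank_le_mod I {..<t} {..<card Tb} (\<lambda>l k. Q l (h k)) q" by blast
  have "rank_le_mod I Sa {..<t} (\<lambda>i l. P (g (g' i)) l) p"
    using rank_le_mod_reindex[OF pq(2), of Sa g' "{..<t}" "\<lambda>l. l"] g' by auto
  then have p: "rank_le_mod I Sa T M p"
    by (rule rank_le_mod_mult_right[where Y = Q]) (use g' PQ sub in auto)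
  have "rank_le_mod I {..<t} Tb (\<lambda>l j. Q l (h (h' j))) q"
    using rank_le_mod_reindex[OF pq(3), of "{..<t}" "\<lambda>l. l" Tb h'] h' by auto
  then have q: "rank_le_mod I S Tb M q"
    by (rule rank_le_mod_mult_left[where Y = P]) (use h' PQ sub in auto)
  show ?thesis using that pq(1) p q .
qed

end

lemma vanishing_act:
  assumes "(n, A) \<in> vanishing_set I" "h \<in> I"
  shows "act n A h v = 0"
  using assms by (auto simp: vanishing_set_def act_def)

text \<open>
  The criterion for fullness. At a zero of \<open>I\<close> a factorisation modulo \<open>I\<close> becomes an honest
  factorisation of \<open>M(A)\<close>. If \<open>t\<close> were smaller than the size of \<open>M\<close>, then the right factor would have
  more columns than rows, hence a kernel, on which \<open>M(A)\<close> vanishes as well.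
\<close>

lemma card_le_rank_mod:
  fixes M :: "'i \<Rightarrow> 'i \<Rightarrow> ('x, 'k::field) ncpoly"
  assumes rank: "rank_le_mod I S S M t" and fin: "finite S" and A: "(n, A) \<in> vanishing_set I"
    and inj: "\<And>\<xi>. (\<And>j. j \<in> S \<Longrightarrow> \<xi> j \<in> vecs n) \<Longrightarrow>
      (\<And>i. i \<in> S \<Longrightarrow> (\<Sum>j\<in>S. act n A (M i j) (\<xi> j)) = 0) \<Longrightarrow> \<forall>j\<in>S. \<xi> j = 0"
  shows "card S \<le> t"
proof (rule ccontr)
  assume "\<not> card S \<le> t"
  have tup: "mat_tuple n A" and n: "n > 0" using A by (auto simp: vanishing_set_def mat_tuple_def)
  obtain P Q where PQ: "\<And>i j. i \<in> S \<Longrightarrow> j \<in> S \<Longrightarrow> M i j - (\<Sum>l<t. P i l * Q l j) \<in> I"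
    using rank unfolding rank_le_mod_def by blast
  let ?a = "\<lambda>(j, b) (l, a). ncpoly_eval n A (Q l j) $$ (a, b)"
  have "card ({..<t} \<times> {..<n}) < card (S \<times> {..<n})"
    using \<open>\<not> card S \<le> t\<close> n by (simp add: card_cartesian_product)
  then obtain u where u: "\<exists>i\<in>S \<times> {..<n}. u i \<noteq> 0"
    "\<And>l. l \<in> {..<t} \<times> {..<n} \<Longrightarrow> (\<Sum>i\<in>S \<times> {..<n}. u i * ?a i l) = 0"
    using fin by (rule_tac homogeneous_system[of "{..<t} \<times> {..<n}" "S \<times> {..<n}" ?a]) auto
  define \<xi> where "\<xi> j = CVec (\<lambda>b. if b < n then u (j, b) else 0)" for j
  have \<xi>: "\<xi> j \<in> vecs n" for j by (simp add: \<xi>_def vecs_def)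
  have Q: "(\<Sum>j\<in>S. act n A (Q l j) (\<xi> j)) = 0" if "l < t" for l
  proof (rule cvec_eqI)
    fix a
    show "coord (\<Sum>j\<in>S. act n A (Q l j) (\<xi> j)) a = coord 0 a"
    proof (cases "a < n")
      case True
      have "coord (\<Sum>j\<in>S. act n A (Q l j) (\<xi> j)) a
          = (\<Sum>j\<in>S. \<Sum>b<n. u (j, b) * ncpoly_eval n A (Q l j) $$ (a, b))"
        using True by (simp add: act_def coord_mact \<xi>_def mult.commute)
      also have "\<dots> = (\<Sum>i\<in>S \<times> {..<n}. u i * ?a i (l, a))"
        by (subst sum.cartesian_product) (auto intro!: sum.cong)
      also have "\<dots> = 0" using u(2)[of "(l, a)"] that True by simp
      finally show ?thesis by simp
    qed (simp add: act_def coord_mact)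
  qed
  have "(\<Sum>j\<in>S. act n A (M i j) (\<xi> j)) = 0" if "i \<in> S" for i
  proof -
    have "act n A (M i j) (\<xi> j) = (\<Sum>l<t. act n A (P i l) (act n A (Q l j) (\<xi> j)))" if "j \<in> S" for j
    proof -
      have "act n A (M i j - (\<Sum>l<t. P i l * Q l j)) (\<xi> j) = 0"
        using A PQ[OF \<open>i \<in> S\<close> that] by (rule vanishing_act)
      then show ?thesis by (simp add: act_diff_left act_sum_left act_mult_left[OF tup])
    qed
    then have "(\<Sum>j\<in>S. act n A (M i j) (\<xi> j)) = (\<Sum>j\<in>S. \<Sum>l<t. act n A (P i l) (act n A (Q l j) (\<xi> j)))"
      by simp
    also have "\<dots> = (\<Sum>l<t. act n A (P i l) (\<Sum>j\<in>S. act n A (Q l j) (\<xi> j)))"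
      by (subst sum.swap) (simp add: act_sum_right)
    also have "\<dots> = 0" using Q by simp
    finally show ?thesis .
  qed
  from inj[OF _ this] \<xi> have "\<forall>j\<in>S. \<xi> j = 0" by blast
  moreover from u(1) obtain j b where "j \<in> S" "b < n" "u (j, b) \<noteq> 0" by auto
  moreover have "coord (\<xi> j) b = u (j, b)" using \<open>b < n\<close> by (simp add: \<xi>_def)
  ultimately show False by simp
qed


subsection \<open>Sylvester quotients\<close>

lemma ring_of_type_algebra_simps [simp]:
  "carrier (ring_of_type_algebra :: 'a::ring_1 ring) = UNIV"
  "x \<otimes>\<^bsub>ring_of_type_algebra\<^esub> y = (x * y :: 'a::ring_1)"
  "x \<oplus>\<^bsub>ring_of_type_algebra\<^esub> y = (x + y :: 'a::ring_1)"
  "\<one>\<^bsub>ring_of_type_algebra\<^esub> = (1 :: 'a::ring_1)" "\<zero>\<^bsub>ring_of_type_algebra\<^esub> = (0 :: 'a::ring_1)"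
  by (simp_all add: ring_of_type_algebra_def)

lemma ring_ring_of_type_algebra: "ring (ring_of_type_algebra :: 'a::ring_1 ring)"
proof -
  have "\<exists>y. x + y = 0" for x :: 'a using add.right_inverse by blast
  then show ?thesis
    unfolding ring_of_type_algebra_def using add.right_inverse
    by unfold_locales (auto simp: algebra_simps Units_def)
qed

lemma finsum_ring_of_type_algebra:
  "finite S \<Longrightarrow> finsum (ring_of_type_algebra :: 'a::ring_1 ring) f S = sum f S"
proof (induction S rule: finite_induct)
  interpret ring "ring_of_type_algebra :: 'a ring" by (rule ring_ring_of_type_algebra)
  case empty
  show ?case by simp
next
  interpret ring "ring_of_type_algebra :: 'a ring" by (rule ring_ring_of_type_algebra)
  case (insert x F)
  then show ?case by simp
qed

text \<open>
  Matrices over the quotient are the entrywise images \<open>qmat\<close> of matrices of representatives, and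
  their products are computed on representatives.
\<close>

lemma sylvester_ideal_if_sylvester_domain_Quot:
  fixes I :: "'a::ring_1 set"
  assumes I: "ideal I ring_of_type_algebra" and syl: "sylvester_domain (ring_of_type_algebra Quot I)"
  shows "sylvester_ideal I"
proof -
  let ?R = "ring_of_type_algebra :: 'a ring"
  let ?Q = "?R Quot I"
  interpret I: ideal I ?R by (rule I)
  interpret tsi: two_sided_ideal I
    using additive_subgroup.zero_closed[OF I.is_additive_subgroup]
      additive_subgroup.a_closed[OF I.is_additive_subgroup] I.I_l_closed I.I_r_closed by unfold_locales auto
  define \<pi> where "\<pi> x = I +>\<^bsub>?R\<^esub> x" for x
  interpret \<pi>: ring_hom_ring ?R ?Q \<pi>
    unfolding \<pi>_def[abs_def] by (rule I.rcos_ring_hom_ring)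
  have zero: "\<pi> x = \<zero>\<^bsub>?Q\<^esub> \<longleftrightarrow> x \<in> I" for x
    using I.rcos_const_imp_mem[of x] I.a_rcos_const[of x] by (auto simp: \<pi>_def FactRing_def)
  have eq: "\<pi> x = \<pi> y \<longleftrightarrow> x - y \<in> I" for x y
  proof -
    have "\<pi> x = \<pi> ((x - y) + y)" by simp
    also have "\<dots> = \<pi> (x - y) \<oplus>\<^bsub>?Q\<^esub> \<pi> y" using \<pi>.hom_add[of "x - y" y] by simp
    finally have *: "\<pi> x = \<pi> (x - y) \<oplus>\<^bsub>?Q\<^esub> \<pi> y" .
    have c: "\<pi> z \<in> carrier ?Q" for z using \<pi>.hom_closed[of z] by simp
    show ?thesis
    proof
      assume "\<pi> x = \<pi> y"
      with * have "\<pi> (x - y) = \<zero>\<^bsub>?Q\<^esub>" using c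
        by (metis \<pi>.S.add.r_cancel_one')
      then show "x - y \<in> I" by (simp add: zero)
    next
      assume "x - y \<in> I"
      then have "\<pi> (x - y) = \<zero>\<^bsub>?Q\<^esub>" by (simp add: zero)
      then show "\<pi> x = \<pi> y" using * c by simp
    qed
  qed
  have surj: "\<exists>x. c = \<pi> x" if "c \<in> carrier ?Q" for c
    using that by (auto simp: FactRing_def A_RCOSETS_def' \<pi>_def)
  define qmat where "qmat m n A = mat m n (\<lambda>(i, j). \<pi> (A i j))" for m n and A :: "nat \<Rightarrow> nat \<Rightarrow> 'a"
  have qmat_mats: "qmat m n A \<in> ring_mats ?Q m n" for m n A
    using \<pi>.hom_closed by (auto simp: ring_mats_def qmat_def elements_mat_def)
  have qmat_surj: "\<exists>A. C = qmat m n A" if "C \<in> ring_mats ?Q m n" for C m n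
  proof -
    have "\<exists>x. C $$ (i, j) = \<pi> x" if "i < m" "j < n" for i j
      using that \<open>C \<in> ring_mats ?Q m n\<close>
      by (intro surj) (fastforce simp: ring_mats_def elements_mat_def)
    then obtain A where "\<And>i j. i < m \<Longrightarrow> j < n \<Longrightarrow> C $$ (i, j) = \<pi> (A i j)" by metis
    then have "C = qmat m n A" using \<open>C \<in> ring_mats ?Q m n\<close>
      by (intro eq_matI) (auto simp: ring_mats_def qmat_def)
    then show ?thesis by blast
  qed
  have qmat_eq: "qmat m n A = qmat m n B \<longleftrightarrow> (\<forall>i<m. \<forall>j<n. A i j - B i j \<in> I)" for m n A B
    by (auto simp: qmat_def eq mat_eq_iff)
  have qmat_mult: "ring_mat_mult ?Q (qmat m n A) (qmat n p B) = qmat m p (\<lambda>i k. \<Sum>j<n. A i j * B j k)" for m n p A B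
  proof (rule eq_matI)
    fix i k assume "i < dim_row (qmat m p (\<lambda>i k. \<Sum>j<n. A i j * B j k))"
      "k < dim_col (qmat m p (\<lambda>i k. \<Sum>j<n. A i j * B j k))"
    then have ik: "i < m" "k < p" by (auto simp: qmat_def)
    have "\<pi> (\<Sum>j<n. A i j * B j k) = \<pi> (finsum ?R (\<lambda>j. A i j * B j k) {..<n})"
      by (simp add: finsum_ring_of_type_algebra)
    also have "\<dots> = finsum ?Q (\<pi> \<circ> (\<lambda>j. A i j * B j k)) {..<n}"
      by (rule \<pi>.hom_finsum) auto
    also have "\<dots> = finsum ?Q (\<lambda>j. \<pi> (A i j) \<otimes>\<^bsub>?Q\<^esub> \<pi> (B j k)) {..<n}"
    proof (rule \<pi>.S.finsum_cong')
      show "(\<pi> \<circ> (\<lambda>j. A i j * B j k)) j = \<pi> (A i j) \<otimes>\<^bsub>?Q\<^esub> \<pi> (B j k)" for j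
        using \<pi>.hom_mult[of "A i j" "B j k"] by simp
      show "(\<lambda>j. \<pi> (A i j) \<otimes>\<^bsub>?Q\<^esub> \<pi> (B j k)) \<in> {..<n} \<rightarrow> carrier ?Q"
        using \<pi>.hom_closed by auto
    qed simp
    also have "\<dots> = finsum ?Q (\<lambda>j. qmat m n A $$ (i, j) \<otimes>\<^bsub>?Q\<^esub> qmat n p B $$ (j, k)) {..<n}"
    proof (rule \<pi>.S.finsum_cong')
      show "(\<lambda>j. qmat m n A $$ (i, j) \<otimes>\<^bsub>?Q\<^esub> qmat n p B $$ (j, k)) \<in> {..<n} \<rightarrow> carrier ?Q"
        using ik \<pi>.hom_closed by (intro funcsetI \<pi>.S.m_closed) (simp_all add: qmat_def)
      show "\<pi> (A i j) \<otimes>\<^bsub>?Q\<^esub> \<pi> (B j k) = qmat m n A $$ (i, j) \<otimes>\<^bsub>?Q\<^esub> qmat n p B $$ (j, k)"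
        if "j \<in> {..<n}" for j
        using that ik by (simp add: qmat_def)
    qed simp
    also have "\<dots> = ring_mat_mult ?Q (qmat m n A) (qmat n p B) $$ (i, k)"
      using ik by (simp add: ring_mat_mult_def qmat_def)
    finally show "ring_mat_mult ?Q (qmat m n A) (qmat n p B) $$ (i, k)
        = qmat m p (\<lambda>i k. \<Sum>j<n. A i j * B j k) $$ (i, k)"
      using ik by (simp add: qmat_def)
  qed (auto simp: qmat_def ring_mat_mult_def)
  have rank: "rank_le_mod I {..<m} {..<n} A (inner_rank ?Q (qmat m n A))" for m n A
  proof -
    let ?P = "\<lambda>t. \<exists>B\<in>ring_mats ?Q (dim_row (qmat m n A)) t. \<exists>C\<in>ring_mats ?Q t (dim_col (qmat m n A)).
      qmat m n A = ring_mat_mult ?Q B C"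
    have dims: "dim_row (qmat m n A) = m" "dim_col (qmat m n A) = n" by (auto simp: qmat_def)
    have "qmat m n A = ring_mat_mult ?Q (qmat m n A) (qmat n n (\<lambda>i j. if i = j then 1 else 0))"
      unfolding qmat_mult qmat_eq by (auto simp: if_distrib[of "\<lambda>x. _ * x"] tsi.zero_mem cong: if_cong)
    then have "?P n" using qmat_mats unfolding dims by blast
    then have "?P (inner_rank ?Q (qmat m n A))" unfolding inner_rank_def by (rule LeastI)
    then obtain B C where BC: "B \<in> ring_mats ?Q m (inner_rank ?Q (qmat m n A))"
      "C \<in> ring_mats ?Q (inner_rank ?Q (qmat m n A)) n" "qmat m n A = ring_mat_mult ?Q B C"
      unfolding dims by blast
    obtain B' C' where B': "B = qmat m (inner_rank ?Q (qmat m n A)) B'"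
      and C': "C = qmat (inner_rank ?Q (qmat m n A)) n C'"
      using qmat_surj[OF BC(1)] qmat_surj[OF BC(2)] by blast
    have "qmat m n A = qmat m n (\<lambda>i k. \<Sum>j<inner_rank ?Q (qmat m n A). B' i j * C' j k)"
      using BC(3) unfolding B' C' qmat_mult .
    then show ?thesis unfolding rank_le_mod_def qmat_eq 
      by (intro exI[of _ B'] exI[of _ C']) auto
  qed
  show ?thesis
  proof unfold_locales
    fix m p n and A B :: "nat \<Rightarrow> nat \<Rightarrow> 'a"
    assume "\<And>i k. i < m \<Longrightarrow> k < p \<Longrightarrow> (\<Sum>j<n. A i j * B j k) \<in> I"
    then have "ring_mat_mult ?Q (qmat m n A) (qmat n p B) = mat m p (\<lambda>_. \<zero>\<^bsub>?Q\<^esub>)"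
      unfolding qmat_mult by (auto simp: qmat_def mat_eq_iff zero)
    then have "inner_rank ?Q (qmat m n A) + inner_rank ?Q (qmat n p B) \<le> n"
      using syl qmat_mats unfolding sylvester_domain_def by blast
    then show "\<exists>s t. s + t \<le> n \<and> rank_le_mod I {..<m} {..<n} A s \<and> rank_le_mod I {..<n} {..<p} B t"
      using rank by blast
  qed
qed


section \<open>Linear pencils\<close>

abbreviation ncconst :: "'k \<Rightarrow> ('x, 'k::semiring_1) ncpoly" where
  "ncconst c \<equiv> Poly_Mapping.single 0 c"

definition pencil :: "'k::comm_ring_1 mat \<Rightarrow> ('x::finite \<Rightarrow> 'k mat) \<Rightarrow> nat \<Rightarrow> nat \<Rightarrow> ('x, 'k) ncpoly" where
  "pencil Z0 Z i j = ncconst (Z0 $$ (i, j)) + (\<Sum>x\<in>UNIV. ncconst (Z x $$ (i, j)) * ncvar x)"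

text \<open>
  The homogeneous linear part of the pencil at the matrices \<open>B\<close>: its derivative in direction \<open>B\<close>.
\<close>

definition pencil_diff ::
  "nat \<Rightarrow> nat \<Rightarrow> ('x::finite \<Rightarrow> 'k::comm_ring_1 mat) \<Rightarrow> ('x \<Rightarrow> 'k mat) \<Rightarrow> (nat \<Rightarrow> 'k cvec) \<Rightarrow> nat \<Rightarrow> 'k cvec" where
  "pencil_diff n p Z B \<xi> i = (\<Sum>j<p. \<Sum>x\<in>UNIV. cscale (Z x $$ (i, j)) (mact n (B x) (\<xi> j)))"

lemma pencil_act:
  assumes "mat_tuple n A" "\<And>j. j < p \<Longrightarrow> \<xi> j \<in> vecs n"
  shows "(\<Sum>j<p. act n A (pencil Z0 Z i j) (\<xi> j))
    = (\<Sum>j<p. cscale (Z0 $$ (i, j)) (\<xi> j)) + pencil_diff n p Z A \<xi> i"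
  using assms
  by (simp add: pencil_def pencil_diff_def act_add_left act_sum_left act_mult_left act_const act_var
      sum.distrib del: coord_sum)

text \<open>
  A family of \<open>p\<close> vectors of length \<open>n\<close> is an element of \<open>k\<^sup>p \<otimes> k\<^sup>n\<close>; its slices are the \<open>n\<close> vectors
  of length \<open>p\<close> obtained by reading it in the other direction.
\<close>

definition slice :: "nat \<Rightarrow> (nat \<Rightarrow> 'k::zero cvec) \<Rightarrow> nat \<Rightarrow> 'k cvec" where
  "slice p \<xi> a = CVec (\<lambda>i. if i < p then coord (\<xi> i) a else 0)"

lemma slice_vecs [simp]: "slice p \<xi> a \<in> vecs p"
  by (simp add: slice_def vecs_def)

lemma coord_slice: "coord (slice p \<xi> a) i = (if i < p then coord (\<xi> i) a else 0)"
  by (simp add: slice_def)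

lemma coord_pencil_diff:
  assumes "i < p" "a < n"
  shows "coord (pencil_diff n p Z B \<xi> i) a
    = (\<Sum>x\<in>UNIV. \<Sum>b<n. B x $$ (a, b) * coord (mact p (Z x) (slice p \<xi> b)) i)"
proof -
  have "coord (pencil_diff n p Z B \<xi> i) a
      = (\<Sum>j<p. \<Sum>x\<in>UNIV. \<Sum>b<n. B x $$ (a, b) * (Z x $$ (i, j) * coord (\<xi> j) b))"
    using assms by (simp add: pencil_diff_def coord_mact sum_distrib_left mult.left_commute)
  also have "\<dots> = (\<Sum>x\<in>UNIV. \<Sum>j<p. \<Sum>b<n. B x $$ (a, b) * (Z x $$ (i, j) * coord (\<xi> j) b))"
    by (rule sum.swap)
  also have "\<dots> = (\<Sum>x\<in>UNIV. \<Sum>b<n. \<Sum>j<p. B x $$ (a, b) * (Z x $$ (i, j) * coord (\<xi> j) b))"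
    by (intro sum.cong refl sum.swap)
  also have "\<dots> = (\<Sum>x\<in>UNIV. \<Sum>b<n. B x $$ (a, b) * coord (mact p (Z x) (slice p \<xi> b)) i)"
    using assms by (simp add: coord_mact coord_slice sum_distrib_left)
  finally show ?thesis .
qed

text \<open>
  The minor without row and column \<open>i0\<close> is injective, and row \<open>i0\<close> depends on the other rows. In this
  form the condition passes to a matrix that is enlarged by auxiliary unknowns which are determined by the
  old ones.
\<close>

definition corank_one_at ::
  "nat \<Rightarrow> ('x \<Rightarrow> 'k::comm_ring_1 mat) \<Rightarrow> 'i set \<Rightarrow> 'i \<Rightarrow> ('i \<Rightarrow> 'i \<Rightarrow> ('x, 'k) ncpoly) \<Rightarrow> bool" where
  "corank_one_at n A S i0 M \<longleftrightarrow>
     (\<forall>\<xi>. (\<forall>j\<in>S. \<xi> j \<in> vecs n) \<longrightarrow> (\<forall>i\<in>S - {i0}. (\<Sum>j\<in>S. act n A (M i j) (\<xi> j)) = 0) \<longrightarrow>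
       (\<Sum>j\<in>S. act n A (M i0 j) (\<xi> j)) = 0 \<and> (\<xi> i0 = 0 \<longrightarrow> (\<forall>j\<in>S. \<xi> j = 0)))"


subsection \<open>Nilpotent perturbations of a point\<close>

text \<open>
  The point \<open>A \<otimes> 1 + t N\<close> with a block nilpotent \<open>N\<close>: the coordinate \<open>i\<close> stands for coordinate
  \<open>i div (l + 1)\<close> of \<open>k\<^sup>n\<close> at level \<open>i mod (l + 1)\<close>, and \<open>B k\<close> leads from level \<open>l - k\<close> to level
  \<open>l - k - 1\<close>. The order of levels matches that of \<open>amp\<close>, so \<open>t = 0\<close> gives a multiple of \<open>A\<close>.
\<close>

definition bidiag ::
  "nat \<Rightarrow> nat \<Rightarrow> 'k::comm_ring_1 \<Rightarrow> ('x \<Rightarrow> 'k mat) \<Rightarrow> (nat \<Rightarrow> 'x \<Rightarrow> 'k mat) \<Rightarrow> 'x \<Rightarrow> 'k mat" where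
  "bidiag n l t A B x = mat (n * Suc l) (n * Suc l) (\<lambda>(i, j).
     (if i mod Suc l = j mod Suc l then A x $$ (i div Suc l, j div Suc l) else 0)
     + t * (if j mod Suc l = Suc (i mod Suc l) then B (l - Suc (i mod Suc l)) x $$ (i div Suc l, j div Suc l) else 0))"

definition graded_vec :: "nat \<Rightarrow> nat \<Rightarrow> 'k::comm_ring_1 \<Rightarrow> (nat \<Rightarrow> 'k cvec) \<Rightarrow> 'k cvec" where
  "graded_vec n l s v = CVec (\<lambda>i. if i < n * Suc l
     then s ^ (l - i mod Suc l) * coord (v (l - i mod Suc l)) (i div Suc l) else 0)"

lemma graded_vec_vecs [simp]: "graded_vec n l s v \<in> vecs (n * Suc l)"
  by (simp add: graded_vec_def vecs_def)

text \<open>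
  Level \<open>l - k\<close> receives \<open>A (v k)\<close> and \<open>t B (v (k - 1))\<close>. The weights \<open>(- t)\<^sup>k\<close> in the vector turn
  this into a common power of \<open>- t\<close> times a difference.
\<close>

lemma mact_bidiag:
  fixes A :: "'x \<Rightarrow> 'k::field mat"
  assumes i: "i < n * Suc l"
  defines "k \<equiv> l - i mod Suc l" and "a \<equiv> i div Suc l"
  shows "coord (mact (n * Suc l) (bidiag n l t A B x) (graded_vec n l (- t) v)) i
    = (- t) ^ k * (coord (mact n (A x) (v k)) a
        - (if k = 0 then 0 else coord (mact n (B (k - 1) x) (v (k - 1))) a))"
proof -
  let ?m = "Suc l"
  define r where "r = i mod ?m"
  have a: "a < n" using i by (simp add: a_def less_mult_imp_div_less del: mult_Suc_right)
  have b: "r \<le> l" using mod_less_divisor[of ?m i] by (simp add: r_def)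
  have k: "k = l - r" by (simp add: k_def r_def)
  define f where "f a' b' = ((if r = b' then A x $$ (a, a') * ((- t) ^ k * coord (v k) a') else 0)
      + (if b' = Suc r then t * B (k - 1) x $$ (a, a') * ((- t) ^ (k - 1) * coord (v (k - 1)) a') else 0))"
    for a' b'
  have "coord (mact (n * ?m) (bidiag n l t A B x) (graded_vec n l (- t) v)) i
      = (\<Sum>j<n * ?m. bidiag n l t A B x $$ (i, j) * coord (graded_vec n l (- t) v) j)"
    using i by (simp add: coord_mact del: mult_Suc_right)
  also have "\<dots> = (\<Sum>j<n * ?m. f (j div ?m) (j mod ?m))"
  proof (rule sum.cong)
    fix j assume "j \<in> {..<n * ?m}"
    then have j: "j < n * ?m" by simp
    have k1: "l - Suc r = k - 1" by (simp add: k)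
    have bd: "bidiag n l t A B x $$ (i, j) = (if r = j mod ?m then A x $$ (a, j div ?m) else 0)
        + t * (if j mod ?m = Suc r then B (k - 1) x $$ (a, j div ?m) else 0)"
      unfolding bidiag_def using i j by (simp only: index_mat(1) prod.case k1[symmetric] a_def r_def)
    have gv: "coord (graded_vec n l (- t) v) j
        = (- t) ^ (l - j mod ?m) * coord (v (l - j mod ?m)) (j div ?m)"
      unfolding graded_vec_def using j by (simp only: cvec.sel if_True)
    show "bidiag n l t A B x $$ (i, j) * coord (graded_vec n l (- t) v) j = f (j div ?m) (j mod ?m)"
    proof (cases "j mod ?m = Suc r")
      case True
      then show ?thesis unfolding bd gv f_def k1[symmetric] by simp
    next
      case False
      then show ?thesis unfolding bd gv f_def k by simp
    qed
  qed simp
  also have "\<dots> = (\<Sum>a'<n. \<Sum>b'<?m. f a' b')" by (rule sum_amp) simp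
  also have "\<dots> = (\<Sum>a'<n. (- t) ^ k * (A x $$ (a, a') * coord (v k) a'
      - (if k = 0 then 0 else B (k - 1) x $$ (a, a') * coord (v (k - 1)) a')))"
  proof (rule sum.cong)
    fix a'
    have "(\<Sum>b'<?m. f a' b') = A x $$ (a, a') * ((- t) ^ k * coord (v k) a')
        + (if Suc r < ?m then t * B (k - 1) x $$ (a, a') * ((- t) ^ (k - 1) * coord (v (k - 1)) a') else 0)"
      unfolding f_def sum.distrib using b by (auto simp: sum.delta sum.delta')
    also have "Suc r < ?m \<longleftrightarrow> k \<noteq> 0" using b by (auto simp: k)
    also have "(if k \<noteq> 0 then t * B (k - 1) x $$ (a, a') * ((- t) ^ (k - 1) * coord (v (k - 1)) a') else 0)
        = (- t) ^ k * - (if k = 0 then 0 else B (k - 1) x $$ (a, a') * coord (v (k - 1)) a')"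
      by (cases k) auto
    finally show "(\<Sum>b'<?m. f a' b') = (- t) ^ k * (A x $$ (a, a') * coord (v k) a'
      - (if k = 0 then 0 else B (k - 1) x $$ (a, a') * coord (v (k - 1)) a'))"
      by (simp add: algebra_simps)
  qed simp
  also have "\<dots> = (- t) ^ k * (coord (mact n (A x) (v k)) a
        - (if k = 0 then 0 else coord (mact n (B (k - 1) x) (v (k - 1))) a))"
    using a by (simp add: coord_mact sum_distrib_left[symmetric] sum_subtractf)
  finally show ?thesis .
qed

text \<open>
  Along the line of parameter \<open>t\<close> the expression is defined at \<open>t = 0\<close>, hence at all but finitely
  many \<open>t\<close>.
\<close>

lemma bidiag_in_dom:
  fixes e :: "('x, 'k::field_char_0) ratexp"
  assumes "(n, A) \<in> ratexp_dom e"
  obtains t where "t \<noteq> 0" "(n * Suc l, bidiag n l t A B) \<in> ratexp_dom e"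
proof -
  let ?m = "Suc l"
  obtain M where tup: "mat_tuple n A" and M: "ratexp_eval n A e = Some M"
    using assms by (auto simp: ratexp_dom_def)
  have A: "A x \<in> carrier_mat n n" for x using tup by (simp add: mat_tuple_def)
  define A' where "A' = (\<lambda>x. amp ?m (A x))"
  define B' where "B' = bidiag n l 1 A B"
  have A': "mat_tuple (n * ?m) A'" using mat_tuple_amp[OF tup, of ?m] by (simp add: A'_def)
  have B': "mat_tuple (n * ?m) B'" using tup by (auto simp: mat_tuple_def B'_def bidiag_def)
  have line: "line A' B' t = bidiag n l t A B" for t
    by (rule ext, rule eq_matI)
      (auto simp: mat_tupleD[OF tup] line_def A'_def B'_def bidiag_def amp_def simp del: mult_Suc_right)
  obtain d P where d: "\<And>t. ratexp_eval (n * ?m) (line A' B' t) e =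
       (if poly d t \<noteq> 0 then Some (inverse (poly d t) \<cdot>\<^sub>m map_mat (\<lambda>p. poly p t) P) else None)"
    by (rule ratexp_eval_line[OF A' B', of e]) blast
  have "ratexp_eval (n * ?m) A' e \<noteq> None"
    using ratexp_eval_amp[OF tup _ M, of ?m] by (simp add: A'_def)
  then have "poly d 0 \<noteq> 0" using d[of 0] by (auto simp: line_0[OF A' B'] split: if_splits)
  then have "d * [:0, 1:] \<noteq> 0" by auto
  then obtain t where "poly (d * [:0, 1:]) t \<noteq> 0" by (rule poly_nonzero_point)
  then have "t \<noteq> 0" "ratexp_eval (n * ?m) (line A' B' t) e \<noteq> None" using d[of t] by auto
  then show ?thesis
    using that[of t] mat_tuple_line[OF A' B', of t] by (simp add: ratexp_dom_def line)
qed

lemma bidiag_pencil: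
  fixes A :: "'x::finite \<Rightarrow> 'k::field_char_0 mat"
  assumes tup: "mat_tuple n A" and w: "\<And>k j. k \<le> l \<Longrightarrow> j < p \<Longrightarrow> w k j \<in> vecs n"
    and i: "i < n * Suc l" and r: "r < p"
  defines "k \<equiv> l - i mod Suc l" and "a \<equiv> i div Suc l"
  shows "coord (\<Sum>j<p. act (n * Suc l) (bidiag n l t A B) (pencil Z0 Z r j) (graded_vec n l (- t) (\<lambda>k. w k j))) i
    = (- t) ^ k * (coord (\<Sum>j<p. act n A (pencil Z0 Z r j) (w k j)) a
        - (if k = 0 then 0 else coord (pencil_diff n p Z (B (k - 1)) (w (k - 1)) r) a))"
proof -
  have tupY: "mat_tuple (n * Suc l) (bidiag n l t A B)"
    using tup by (auto simp: mat_tuple_def bidiag_def)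
  have kl: "k \<le> l" by (simp add: k_def)
  have gv: "coord (graded_vec n l (- t) v) i = (- t) ^ k * coord (v k) a" for v
    using i by (simp add: graded_vec_def k_def a_def del: mult_Suc_right)
  note mb = mact_bidiag[OF i, of t A B, folded k_def a_def]
  let ?u = "\<Sum>j<p. Z0 $$ (r, j) * coord (w k j) a"
  let ?z = "\<lambda>B w. \<Sum>j<p. \<Sum>x\<in>UNIV. Z x $$ (r, j) * coord (mact n (B x) (w j)) a"
  have "coord (\<Sum>j<p. act (n * Suc l) (bidiag n l t A B) (pencil Z0 Z r j) (graded_vec n l (- t) (\<lambda>k. w k j))) i
    = (\<Sum>j<p. Z0 $$ (r, j) * ((- t) ^ k * coord (w k j) a))
      + (\<Sum>j<p. \<Sum>x\<in>UNIV. Z x $$ (r, j) * ((- t) ^ k * (coord (mact n (A x) (w k j)) a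
        - (if k = 0 then 0 else coord (mact n (B (k - 1) x) (w (k - 1) j)) a))))"
    by (subst pencil_act[OF tupY]) (simp_all add: pencil_diff_def gv mb del: mult_Suc_right)
  also have "(\<Sum>j<p. Z0 $$ (r, j) * ((- t) ^ k * coord (w k j) a)) = (- t) ^ k * ?u"
    unfolding sum_distrib_left by (intro sum.cong refl mult.left_commute)
  also have "(\<Sum>j<p. \<Sum>x\<in>UNIV. Z x $$ (r, j) * ((- t) ^ k * (coord (mact n (A x) (w k j)) a
        - (if k = 0 then 0 else coord (mact n (B (k - 1) x) (w (k - 1) j)) a))))
      = (- t) ^ k * (?z A (w k)
      - (\<Sum>j<p. \<Sum>x\<in>UNIV. Z x $$ (r, j) * (if k = 0 then 0 else coord (mact n (B (k - 1) x) (w (k - 1) j)) a)))"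
    unfolding sum_distrib_left sum_subtractf[symmetric] right_diff_distrib
    by (intro sum.cong refl arg_cong2[where f = minus] mult.left_commute)
  also have "(\<Sum>j<p. \<Sum>x\<in>UNIV. Z x $$ (r, j) * (if k = 0 then 0 else coord (mact n (B (k - 1) x) (w (k - 1) j)) a))
      = (if k = 0 then 0 else ?z (B (k - 1)) (w (k - 1)))"
    by simp
  also have "(- t) ^ k * ?u + (- t) ^ k * (?z A (w k) - (if k = 0 then 0 else ?z (B (k - 1)) (w (k - 1))))
     = (- t) ^ k * ((?u + ?z A (w k)) - (if k = 0 then 0 else ?z (B (k - 1)) (w (k - 1))))"
    by (simp only: distrib_left right_diff_distrib add_diff_eq)
  also have "?u + ?z A (w k) = coord (\<Sum>j<p. act n A (pencil Z0 Z r j) (w k j)) a"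
    using w kl by (subst pencil_act[OF tup]) (simp_all add: pencil_diff_def)
  also have "(if k = 0 then 0 else ?z (B (k - 1)) (w (k - 1)))
      = (if k = 0 then 0 else coord (pencil_diff n p Z (B (k - 1)) (w (k - 1)) r) a)"
    by (simp add: pencil_diff_def)
  finally show ?thesis .
qed

text \<open>
  A chain of solutions of \<open>Z(A) w\<^sub>k\<^sub>+\<^sub>1 = \<partial>Z(B\<^sub>k) w\<^sub>k\<close> in all rows but \<open>i0\<close> is the same as a single vector
  at a bidiagonal point on which all rows but \<open>i0\<close> vanish. There row \<open>i0\<close> vanishes too, and so
  it holds along the whole chain. Different directions \<open>B\<^sub>k\<close> may be used at the
  different steps because the perturbation is nilpotent of high order.
\<close>

lemma corank_one_chain:
  fixes e :: "('x::finite, 'k::field_char_0) ratexp"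
  assumes dom: "(n, A) \<in> ratexp_dom e" and i0: "i0 < p"
    and corank: "\<And>n A. (n, A) \<in> ratexp_dom e \<Longrightarrow> corank_one_at n A {..<p} i0 (pencil Z0 Z)"
    and w: "\<And>k j. k \<le> l \<Longrightarrow> j < p \<Longrightarrow> w k j \<in> vecs n"
    and w0: "\<And>i. i < p \<Longrightarrow> i \<noteq> i0 \<Longrightarrow> (\<Sum>j<p. act n A (pencil Z0 Z i j) (w 0 j)) = 0"
    and wSuc: "\<And>k i. k < l \<Longrightarrow> i < p \<Longrightarrow> i \<noteq> i0 \<Longrightarrow>
      (\<Sum>j<p. act n A (pencil Z0 Z i j) (w (Suc k) j)) = pencil_diff n p Z (B k) (w k) i"
    and k: "k \<le> l"
  shows "(\<Sum>j<p. act n A (pencil Z0 Z i0 j) (w k j)) = (if k = 0 then 0 else pencil_diff n p Z (B (k - 1)) (w (k - 1)) i0)"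
proof -
  obtain t where t: "t \<noteq> 0" and Y: "(n * Suc l, bidiag n l t A B) \<in> ratexp_dom e"
    using bidiag_in_dom[OF dom] by blast
  have tup: "mat_tuple n A" using dom by (simp add: ratexp_dom_def)
  define \<xi> where "\<xi> j = graded_vec n l (- t) (\<lambda>k. w k j)" for j
  let ?Y = "bidiag n l t A B"
  have coords: "coord (\<Sum>j<p. act (n * Suc l) ?Y (pencil Z0 Z r j) (\<xi> j)) i
    = (- t) ^ (l - i mod Suc l) * (coord (\<Sum>j<p. act n A (pencil Z0 Z r j) (w (l - i mod Suc l) j)) (i div Suc l)
        - (if l - i mod Suc l = 0 then 0 else coord (pencil_diff n p Z (B (l - i mod Suc l - 1)) (w (l - i mod Suc l - 1)) r) (i div Suc l)))"
    if "i < n * Suc l" "r < p" for i r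
    unfolding \<xi>_def by (rule bidiag_pencil[OF tup w that])
  have rows: "(\<Sum>j<p. act (n * Suc l) ?Y (pencil Z0 Z r j) (\<xi> j)) = 0" if r: "r < p" "r \<noteq> i0" for r
  proof (rule cvec_eqI)
    fix i
    show "coord (\<Sum>j<p. act (n * Suc l) ?Y (pencil Z0 Z r j) (\<xi> j)) i = coord 0 i"
    proof (cases "i < n * Suc l")
      case True
      define q where "q = l - i mod Suc l"
      have "q \<le> l" by (simp add: q_def)
      then have "(\<Sum>j<p. act n A (pencil Z0 Z r j) (w q j)) = (if q = 0 then 0 else pencil_diff n p Z (B (q - 1)) (w (q - 1)) r)"
        using w0[OF r] wSuc[OF _ r, of "q - 1"] by auto
      then show ?thesis using coords[OF True r(1)] unfolding q_def[symmetric] by (simp del: coord_sum)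
    next
      case False
      have "(\<Sum>j<p. act (n * Suc l) ?Y (pencil Z0 Z r j) (\<xi> j)) \<in> vecs (n * Suc l)"
        by (intro vecs_sum) simp
      then show ?thesis using False by (simp add: vecs_def del: coord_sum mult_Suc_right)
    qed
  qed
  have "(\<Sum>j<p. act (n * Suc l) ?Y (pencil Z0 Z i0 j) (\<xi> j)) = 0"
  proof -
    have "\<forall>j\<in>{..<p}. \<xi> j \<in> vecs (n * Suc l)" unfolding \<xi>_def by (intro ballI graded_vec_vecs)
    moreover have "\<forall>i\<in>{..<p} - {i0}. (\<Sum>j<p. act (n * Suc l) ?Y (pencil Z0 Z i j) (\<xi> j)) = 0"
      using rows by blast
    ultimately show ?thesis
      using corank[OF Y, unfolded corank_one_at_def, THEN spec[of _ \<xi>]] by blast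
  qed
  note zero = this
  show ?thesis
  proof (rule cvec_eqI)
    fix a
    show "coord (\<Sum>j<p. act n A (pencil Z0 Z i0 j) (w k j)) a
      = coord (if k = 0 then 0 else pencil_diff n p Z (B (k - 1)) (w (k - 1)) i0) a"
    proof (cases "a < n")
      case True
      \<comment> \<open>The coordinate \<open>a\<close> at level \<open>l - k\<close>.\<close>
      define i where "i = a * Suc l + (l - k)"
      have im: "i mod Suc l = l - k" "i div Suc l = a"
        unfolding i_def by (simp_all del: mult_Suc_right)
      have "i < Suc a * Suc l" using k unfolding i_def by simp
      also have "\<dots> \<le> n * Suc l" using True by (intro mult_le_mono1) simp
      finally have i: "i < n * Suc l" .
      have "l - i mod Suc l = k" using im k by simp
      with coords[OF i i0] show ?thesis
        using t by (simp add: zero im del: coord_sum mult_Suc_right split: if_splits)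
    next
      case False
      have "(\<Sum>j<p. act n A (pencil Z0 Z i0 j) (w k j)) \<in> vecs n" by (intro vecs_sum) simp
      moreover have "pencil_diff n p Z (B (k - 1)) (w (k - 1)) i0 \<in> vecs n"
        unfolding pencil_diff_def by (intro vecs_sum vecs_closed) simp
      ultimately show ?thesis using False by (simp add: vecs_def del: coord_sum)
    qed
  qed
qed


section \<open>Shrunk subspaces of singular pencils\<close>

interpretation cv: vector_space "cscale :: 'k::field \<Rightarrow> 'k cvec \<Rightarrow> 'k cvec"
  by unfold_locales (auto simp: cvec_eq_iff algebra_simps)

definition uvec :: "nat \<Rightarrow> 'k::field cvec" where
  "uvec a = CVec (\<lambda>b. if b = a then 1 else 0)"

lemma coord_uvec [simp]: "coord (uvec a) b = (if b = a then 1 else 0)"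
  by (simp add: uvec_def)

lemma uvec_vecs [simp]: "a < n \<Longrightarrow> uvec a \<in> vecs n"
  by (auto simp: vecs_def)

lemma vecs_expand: "v \<in> vecs n \<Longrightarrow> v = (\<Sum>a<n. cscale (coord v a) (uvec a))"
  by (rule cvec_eqI) (auto simp: vecs_def if_distrib[of "\<lambda>x. _ * x"] cong: if_cong)

lemma subspace_vecs: "cv.subspace (vecs n)"
  by (simp add: cv.subspace_def)

lemma vecs_span: "(vecs n :: 'a::field cvec set) \<subseteq> cv.span (uvec ` {..<n})"
proof
  fix v :: "'a cvec" assume "v \<in> vecs n"
  then show "v \<in> cv.span (uvec ` {..<n})"
    by (subst vecs_expand, assumption) (intro cv.span_sum cv.span_scale cv.span_base, auto)
qed

lemma independent_vecs_bound:
  fixes B :: "'a::field cvec set"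
  assumes "cv.independent B" "B \<subseteq> vecs n"
  shows "finite B \<and> card B \<le> n"
proof -
  have "finite B \<and> card B \<le> card ((uvec :: nat \<Rightarrow> 'a cvec) ` {..<n})"
    by (rule cv.independent_span_bound) (use assms vecs_span in auto)
  moreover have "card ((uvec :: nat \<Rightarrow> 'a cvec) ` {..<n}) \<le> n"
    using card_image_le[of "{..<n}" uvec] by simp
  ultimately show ?thesis by simp
qed

text \<open>
  An injective square system is solvable: with the right-hand side as one additional unknown there are more
  unknowns than equations, and injectivity forces the additional coefficient to be nonzero.
\<close>

lemma corank_one_solve:
  fixes M :: "nat \<Rightarrow> nat \<Rightarrow> ('x, 'k::field) ncpoly"
  assumes corank: "corank_one_at n A {..<p} i0 M" and i0: "i0 < p"
    and v: "v \<in> vecs n" and r: "\<And>i. i < p \<Longrightarrow> r i \<in> vecs n"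
  obtains w where "\<And>j. j < p \<Longrightarrow> w j \<in> vecs n" "w i0 = v"
    "\<And>i. i < p \<Longrightarrow> i \<noteq> i0 \<Longrightarrow> (\<Sum>j<p. act n A (M i j) (w j)) = r i"
proof -
  let ?S = "{..<p} - {i0}"
  define r' where "r' i = r i - act n A (M i i0) v" for i
  define U where "U = insert None (Some ` (?S \<times> {..<n}))"
  let ?c = "\<lambda>k (i, a). case k of None \<Rightarrow> - coord (r' i) a
    | Some (j, b) \<Rightarrow> coord (act n A (M i j) (uvec b)) a"
  have fin: "finite U" by (simp add: U_def)
  have "card (?S \<times> {..<n}) < card U"
    unfolding U_def by (subst card_insert_disjoint) (auto simp: card_image simp del: card_cartesian_product)
  then obtain u where u: "\<exists>k\<in>U. u k \<noteq> 0"
    "\<And>l. l \<in> ?S \<times> {..<n} \<Longrightarrow> (\<Sum>k\<in>U. u k * ?c k l) = 0"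
    using fin by (rule_tac homogeneous_system[of "?S \<times> {..<n}" U ?c]) auto
  define y where "y j = (\<Sum>b<n. cscale (u (Some (j, b))) (uvec b))" for j
  have y: "y j \<in> vecs n" for j unfolding y_def by (intro vecs_sum vecs_closed) simp
  have eq: "(\<Sum>j\<in>?S. act n A (M i j) (y j)) = cscale (u None) (r' i)" if i: "i \<in> ?S" for i
  proof (rule cvec_eqI)
    fix a
    show "coord (\<Sum>j\<in>?S. act n A (M i j) (y j)) a = coord (cscale (u None) (r' i)) a"
    proof (cases "a < n")
      case True
      have "0 = (\<Sum>k\<in>U. u k * ?c k (i, a))" using u(2)[of "(i, a)"] i True by simp
      also have "\<dots> = - (u None * coord (r' i) a) + (\<Sum>k\<in>?S \<times> {..<n}. u (Some k) * ?c (Some k) (i, a))"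
        unfolding U_def by (subst sum.insert) (auto simp: sum.reindex)
      also have "(\<Sum>k\<in>?S \<times> {..<n}. u (Some k) * ?c (Some k) (i, a))
          = (\<Sum>j\<in>?S. \<Sum>b<n. u (Some (j, b)) * coord (act n A (M i j) (uvec b)) a)"
        by (subst sum.cartesian_product) (auto intro!: sum.cong)
      also have "\<dots> = coord (\<Sum>j\<in>?S. act n A (M i j) (y j)) a"
        by (simp add: y_def act_sum_right act_cscale_right)
      finally show ?thesis by simp
    next
      case False
      moreover have "cscale (u None) (r' i) \<in> vecs n"
        unfolding r'_def using r i by (intro vecs_closed) auto
      moreover have "(\<Sum>j\<in>?S. act n A (M i j) (y j)) \<in> vecs n" by (intro vecs_sum) simp
      ultimately show ?thesis by (simp add: vecs_def del: coord_sum coord_cscale)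
    qed
  qed
  have split: "(\<Sum>j<p. act n A (M i j) (\<xi> j)) = act n A (M i i0) (\<xi> i0) + (\<Sum>j\<in>?S. act n A (M i j) (\<xi> j))"
    for i \<xi> using i0 by (simp add: sum.remove)
  have "u None \<noteq> 0"
  proof
    assume 0: "u None = 0"
    define \<xi> where "\<xi> j = (if j = i0 then 0 else y j)" for j
    have "(\<Sum>j\<in>?S. act n A (M i j) (\<xi> j)) = (\<Sum>j\<in>?S. act n A (M i j) (y j))" for i
      by (intro sum.cong) (auto simp: \<xi>_def)
    moreover have "cscale 0 w = 0" for w :: "'k cvec" by simp
    ultimately have "(\<Sum>j<p. act n A (M i j) (\<xi> j)) = 0" if "i \<in> ?S" for i
      using eq[OF that] 0 unfolding split by (simp add: \<xi>_def)
    then have "\<forall>j\<in>{..<p}. \<xi> j = 0"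
      using corank[unfolded corank_one_at_def, THEN spec[of _ \<xi>]] y by (auto simp: \<xi>_def)
    then have "\<xi> j = 0" if "j \<in> ?S" for j using that by blast
    then have y0: "y j = 0" if "j \<in> ?S" for j using that unfolding \<xi>_def by (metis DiffE singletonI)
    have "u (Some (j, b)) = 0" if "j \<in> ?S" "b < n" for j b
    proof -
      have "u (Some (j, b)) = coord (y j) b"
        using that(2) by (simp add: y_def if_distrib[of "\<lambda>x. _ * x"] cong: if_cong)
      then show ?thesis using y0[OF that(1)] by simp
    qed
    then show False using u(1) 0 by (auto simp: U_def)
  qed
  note u0 = this
  define w where "w j = (if j = i0 then v else cscale (inverse (u None)) (y j))" for j
  show thesis
  proof
    show "w j \<in> vecs n" if "j < p" for j using v y by (simp add: w_def)
    show "w i0 = v" by (simp add: w_def)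
    fix i assume "i < p" "i \<noteq> i0"
    then have i: "i \<in> ?S" by simp
    have "(\<Sum>j\<in>?S. act n A (M i j) (w j)) = (\<Sum>j\<in>?S. cscale (inverse (u None)) (act n A (M i j) (y j)))"
      by (intro sum.cong) (auto simp: w_def act_cscale_right)
    also have "\<dots> = cscale (inverse (u None)) (\<Sum>j\<in>?S. act n A (M i j) (y j))"
      by (rule cv.scale_sum_right[symmetric])
    also have "\<dots> = r' i" using eq[OF i] u0 by (simp add: cvec_eq_iff)
    finally show "(\<Sum>j<p. act n A (M i j) (w j)) = r i"
      unfolding split by (simp add: r'_def w_def)
  qed
qed

text \<open>
  Work at one point \<open>A\<close> of size \<open>n\<close>. Start with the vectors in \<open>k\<^sup>p \<otimes> k\<^sup>n\<close> on which the rows other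
  than \<open>i0\<close> vanish, and keep solving \<open>Z(A) w' = \<partial>Z(B) w\<close> in these rows for arbitrary directions \<open>B\<close>. Row \<open>i0\<close> then
  holds automatically. Let \<open>W0\<close> be spanned by all slices of the vectors reached, and \<open>T0\<close> by
  their images under the coefficients of the variables. The constant coefficient also maps \<open>W0\<close> to
  \<open>T0\<close>, as \<open>Z(A) w\<close> has its slices in \<open>T0\<close>.

  As \<open>B\<close> runs through all matrices, each element of \<open>T0 \<otimes> k\<^sup>n\<close> is \<open>Z(A) w\<close> for some \<open>w \<in> W0 \<otimes> k\<^sup>n\<close> with
  zero component at \<open>i0\<close>. Moreover \<open>W0 \<otimes> k\<^sup>n\<close> contains the kernel of \<open>Z(A)\<close>, which has dimension \<open>n\<close> and is determined
  by the component at \<open>i0\<close>. Hence \<open>n dim T0 + n \<le> n dim W0\<close>.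
\<close>

lemma corank_one_shrunk_subspace:
  fixes e :: "('x::finite, 'k::field_char_0) ratexp"
  assumes dom: "(n, A) \<in> ratexp_dom e" and i0: "i0 < p"
    and corank: "\<And>n A. (n, A) \<in> ratexp_dom e \<Longrightarrow> corank_one_at n A {..<p} i0 (pencil Z0 Z)"
  obtains W T where "cv.independent W" "W \<subseteq> vecs p" "cv.independent T" "T \<subseteq> vecs p" "card T < card W"
    "\<And>b. b \<in> W \<Longrightarrow> mact p Z0 b \<in> cv.span T" "\<And>b x. b \<in> W \<Longrightarrow> mact p (Z x) b \<in> cv.span T"
proof -
  have tup: "mat_tuple n A" using dom by (simp add: ratexp_dom_def)
  then have n: "n > 0" by (simp add: mat_tuple_def)
  define pa where "pa w i = (\<Sum>j<p. act n A (pencil Z0 Z i j) (w j))" for w i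
  define chain where "chain l ws B \<longleftrightarrow> (\<forall>k\<le>l. \<forall>j<p. ws k j \<in> vecs n) \<and>
     (\<forall>i<p. i \<noteq> i0 \<longrightarrow> pa (ws 0) i = 0) \<and>
     (\<forall>k<l. \<forall>i<p. i \<noteq> i0 \<longrightarrow> pa (ws (Suc k)) i = pencil_diff n p Z (B k) (ws k) i)" for l ws B
  define reach where "reach w \<longleftrightarrow> (\<exists>l ws B. chain l ws B \<and> ws l = w)" for w
  have chain_row: "pa (ws l) i = (if l = 0 then 0 else pencil_diff n p Z (B (l - 1)) (ws (l - 1)) i)"
    if "chain l ws B" "i < p" for l ws B i
  proof (cases "i = i0")
    case True
    show ?thesis unfolding True pa_def
      by (rule corank_one_chain[OF dom i0 corank, where l = l]) (use that in \<open>auto simp: chain_def pa_def\<close>)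
  next
    case False
    then show ?thesis using that by (cases l) (auto simp: chain_def)
  qed
  have reach_vecs: "w j \<in> vecs n" if "reach w" "j < p" for w j
    using that by (auto simp: reach_def chain_def)
  have reach_base: "reach w \<and> (\<forall>i<p. pa w i = 0)"
    if "\<And>j. j < p \<Longrightarrow> w j \<in> vecs n" "\<And>i. i < p \<Longrightarrow> i \<noteq> i0 \<Longrightarrow> pa w i = 0" for w
  proof -
    have c: "chain 0 (\<lambda>_. w) (\<lambda>_ _. 0\<^sub>m n n)" using that by (auto simp: chain_def)
    then have "reach w" unfolding reach_def by (intro exI[of _ 0] exI[of _ "\<lambda>_. w"] exI) auto
    then show ?thesis using chain_row[OF c] by auto
  qed
  have reach_step: "reach w' \<and> (\<forall>i<p. pa w' i = pencil_diff n p Z B w i)"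
    if "reach w" "\<And>j. j < p \<Longrightarrow> w' j \<in> vecs n"
      "\<And>i. i < p \<Longrightarrow> i \<noteq> i0 \<Longrightarrow> pa w' i = pencil_diff n p Z B w i" for w w' B
  proof -
    from that(1) obtain l ws Bs where l: "chain l ws Bs" "ws l = w" by (auto simp: reach_def)
    have c: "chain (Suc l) (ws(Suc l := w')) (Bs(l := B))"
      using l that(2,3) by (auto simp: chain_def less_Suc_eq le_Suc_eq)
    then have "reach w'" unfolding reach_def
      by (intro exI[of _ "Suc l"] exI[of _ "ws(Suc l := w')"] exI) auto
    then show ?thesis using chain_row[OF c] l by auto
  qed
  have reach_row: "(\<forall>i<p. pa w i = 0) \<or> (\<exists>w' B. reach w' \<and> (\<forall>i<p. pa w i = pencil_diff n p Z B w' i))"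
    if "reach w" for w
  proof -
    from that obtain l ws Bs where l: "chain l ws Bs" "ws l = w" by (auto simp: reach_def)
    show ?thesis
    proof (cases l)
      case 0
      then show ?thesis using chain_row[OF l(1)] l(2) by auto
    next
      case (Suc m)
      have "chain m ws Bs" using l(1) Suc by (auto simp: chain_def)
      then have "reach (ws m)" by (auto simp: reach_def)
      moreover have "\<forall>i<p. pa w i = pencil_diff n p Z (Bs m) (ws m) i"
        using chain_row[OF l(1)] l(2) Suc by auto
      ultimately show ?thesis by blast
    qed
  qed
  define G where "G = {slice p w a | w a. reach w \<and> a < n}"
  define W0 where "W0 = cv.span G"
  define T0 where "T0 = cv.span (\<Union>x. mact p (Z x) ` G)"
  have T0_diff: "slice p (pencil_diff n p Z B w) a \<in> T0" if "reach w" "a < n" for w a and B :: "'x \<Rightarrow> 'k mat"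
  proof -
    have "slice p (pencil_diff n p Z B w) a
        = (\<Sum>x\<in>UNIV. \<Sum>b<n. cscale (B x $$ (a, b)) (mact p (Z x) (slice p w b)))"
    proof (rule cvec_eqI)
      fix i
      show "coord (slice p (pencil_diff n p Z B w) a) i
        = coord (\<Sum>x\<in>UNIV. \<Sum>b<n. cscale (B x $$ (a, b)) (mact p (Z x) (slice p w b))) i"
      proof (cases "i < p")
        case True
        then show ?thesis using coord_pencil_diff[OF True that(2), of Z B w] by (simp add: coord_slice)
      qed (simp add: coord_slice coord_mact)
    qed
    also have "\<dots> \<in> T0" unfolding T0_def
      using that by (intro cv.span_sum cv.span_scale cv.span_base) (auto simp: G_def)
    finally show ?thesis .
  qed
  have Z_W0: "mact p (Z x) b \<in> T0" if "b \<in> W0" for b x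
    using that unfolding W0_def
  proof (induction rule: cv.span_induct)
    show "cv.subspace {b. mact p (Z x) b \<in> T0}"
      by (auto simp: cv.subspace_def mact_add_right mact_cscale_right T0_def
          intro: cv.span_zero cv.span_add cv.span_scale)
  qed (auto simp: T0_def intro: cv.span_base)
  have Z0_W0: "mact p Z0 b \<in> T0" if "b \<in> W0" for b
    using that unfolding W0_def
  proof (induction rule: cv.span_induct)
    show "cv.subspace {b. mact p Z0 b \<in> T0}"
      by (auto simp: cv.subspace_def mact_add_right mact_cscale_right T0_def
          intro: cv.span_zero cv.span_add cv.span_scale)
    fix b assume "b \<in> G"
    then obtain w a where w: "reach w" "a < n" "b = slice p w a" by (auto simp: G_def)
    have "mact p Z0 b = slice p (pa w) a - slice p (pencil_diff n p Z A w) a"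
    proof (rule cvec_eqI)
      fix i
      have "pa w i = (\<Sum>j<p. cscale (Z0 $$ (i, j)) (w j)) + pencil_diff n p Z A w i"
        unfolding pa_def by (rule pencil_act[OF tup reach_vecs[OF w(1)]])
      then show "coord (mact p Z0 b) i = coord (slice p (pa w) a - slice p (pencil_diff n p Z A w) a) i"
        by (simp add: coord_mact coord_slice w(3))
    qed
    moreover have "slice p (pa w) a \<in> T0"
    proof -
      from reach_row[OF w(1)] show ?thesis
      proof
        assume "\<forall>i<p. pa w i = 0"
        then have "slice p (pa w) a = 0" by (intro cvec_eqI) (simp add: coord_slice)
        then show ?thesis by (simp add: T0_def cv.span_zero)
      next
        assume "\<exists>w' B. reach w' \<and> (\<forall>i<p. pa w i = pencil_diff n p Z B w' i)"
        then obtain w' B where w': "reach w'" "\<forall>i<p. pa w i = pencil_diff n p Z B w' i" by blast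
        then have "slice p (pa w) a = slice p (pencil_diff n p Z B w') a"
          by (intro cvec_eqI) (simp add: coord_slice)
        then show ?thesis using T0_diff[OF w'(1) w(2)] by simp
      qed
    qed
    ultimately show "mact p Z0 b \<in> T0"
      using T0_diff[OF w(1,2)] by (simp add: T0_def cv.span_diff)
  qed
  have pa_sum: "pa (\<lambda>j. \<Sum>k\<in>K. cscale (c k) (F k j)) i = (\<Sum>k\<in>K. cscale (c k) (pa (F k) i))"
    for K :: "'q set" and c F i
    unfolding pa_def act_sum_right act_cscale_right cv.scale_sum_right by (rule sum.swap)
  \<comment> \<open>\<open>w\<close> lies in \<open>W0 \<otimes> k\<^sup>n\<close>, has zero component at \<open>i0\<close> and solves \<open>Z(A) w = t \<otimes> e\<^sub>a\<close>.\<close>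
  define lifts where "lifts t a w \<longleftrightarrow> (\<forall>j<p. w j \<in> vecs n) \<and> w i0 = 0 \<and>
     (\<forall>i<p. pa w i = cscale (coord t i) (uvec a)) \<and> (\<forall>b<n. slice p w b \<in> W0)" for t a w
  have slice_add: "slice p (\<lambda>j. f j + g j) b = slice p f b + slice p g b" for f g :: "nat \<Rightarrow> 'k cvec" and b
    by (rule cvec_eqI) (simp add: coord_slice)
  have slice_scale: "slice p (\<lambda>j. cscale c (f j)) b = cscale c (slice p f b)" for f b c
    by (rule cvec_eqI) (simp add: coord_slice)
  have lifts: "\<exists>w. lifts t a w" if "t \<in> T0" "a < n" for t a
    using that(1) unfolding T0_def
  proof (induction rule: cv.span_induct)
    show "cv.subspace {t. \<exists>w. lifts t a w}"
    proof (unfold cv.subspace_def, intro conjI ballI allI)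
      have "slice p (\<lambda>_. 0) b = (0 :: 'k cvec)" for b
        by (rule cvec_eqI) (simp add: coord_slice)
      then have "lifts 0 a (\<lambda>_. 0)" by (simp add: lifts_def pa_def W0_def cv.span_zero)
      then show "0 \<in> {t. \<exists>w. lifts t a w}" by blast
    next
      fix s t assume "s \<in> {t. \<exists>w. lifts t a w}" "t \<in> {t. \<exists>w. lifts t a w}"
      then obtain f g where "lifts s a f" "lifts t a g" by blast
      then have "lifts (s + t) a (\<lambda>j. f j + g j)"
        by (auto simp: lifts_def pa_def act_add_right sum.distrib slice_add W0_def cv.span_add
            cv.scale_left_distrib)
      then show "s + t \<in> {t. \<exists>w. lifts t a w}" by blast
    next
      fix c t assume "t \<in> {t. \<exists>w. lifts t a w}"
      then obtain f where "lifts t a f" by blast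
      then have "lifts (cscale c t) a (\<lambda>j. cscale c (f j))"
        by (auto simp: lifts_def pa_def act_cscale_right cv.scale_sum_right[symmetric] slice_scale W0_def cv.span_scale)
      then show "cscale c t \<in> {t. \<exists>w. lifts t a w}" by blast
    qed
    fix t assume "t \<in> (\<Union>x. mact p (Z x) ` G)"
    then obtain x w b where w: "reach w" "b < n" "t = mact p (Z x) (slice p w b)" by (auto simp: G_def)
    \<comment> \<open>The matrix unit \<open>E\<^sub>a\<^sub>b\<close> in the variable \<open>x\<close> moves slice \<open>b\<close> of \<open>w\<close> to position \<open>a\<close>.\<close>
    define B where "B = (\<lambda>y. mat n n (\<lambda>(a', b'). if y = x \<and> a' = a \<and> b' = b then 1 else (0::'k)))"
    have B: "pencil_diff n p Z B w i = cscale (coord t i) (uvec a)" if i: "i < p" for i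
    proof (rule cvec_eqI)
      fix a'
      show "coord (pencil_diff n p Z B w i) a' = coord (cscale (coord t i) (uvec a)) a'"
      proof (cases "a' < n")
        case True
        have "coord (pencil_diff n p Z B w i) a'
            = (\<Sum>y\<in>UNIV. \<Sum>b'<n. B y $$ (a', b') * coord (mact p (Z y) (slice p w b')) i)"
          by (rule coord_pencil_diff[OF i True])
        also have "\<dots> = (\<Sum>y\<in>UNIV. \<Sum>b'<n. if y = x then if b' = b then
            if a' = a then coord (mact p (Z y) (slice p w b')) i else 0 else 0 else 0)"
          using True by (intro sum.cong refl) (auto simp: B_def)
        also have "\<dots> = (\<Sum>y\<in>UNIV. if y = x then \<Sum>b'<n. if b' = b then
            if a' = a then coord (mact p (Z y) (slice p w b')) i else 0 else 0 else 0)"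
          by (intro sum.cong refl) auto
        also have "\<dots> = coord (cscale (coord t i) (uvec a)) a'"
          using w(2) by (simp add: w(3))
        finally show ?thesis .
      next
        case False
        have "pencil_diff n p Z B w i \<in> vecs n"
          unfolding pencil_diff_def by (intro vecs_sum vecs_closed mact_vecs)
        then show ?thesis using False \<open>a < n\<close> by (simp add: vecs_def)
      qed
    qed
    obtain w' where w': "\<And>j. j < p \<Longrightarrow> w' j \<in> vecs n" "w' i0 = 0"
      "\<And>i. i < p \<Longrightarrow> i \<noteq> i0 \<Longrightarrow> pa w' i = cscale (coord t i) (uvec a)"
      unfolding pa_def
      by (rule corank_one_solve[OF corank[OF dom] i0, of 0 "\<lambda>i. cscale (coord t i) (uvec a)"])
        (use \<open>a < n\<close> in auto)
    have "reach w' \<and> (\<forall>i<p. pa w' i = pencil_diff n p Z B w i)"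
      by (rule reach_step[OF w(1)]) (use w' B in auto)
    then have "lifts t a w'" using w'(1,2) B
      by (auto simp: lifts_def W0_def G_def intro!: cv.span_base)
    then show "\<exists>w. lifts t a w" by blast
  qed
  have sub: "G \<subseteq> vecs p" "(\<Union>x. mact p (Z x) ` G) \<subseteq> vecs p" by (auto simp: G_def)
  then have sub': "W0 \<subseteq> vecs p" "T0 \<subseteq> vecs p"
    unfolding W0_def T0_def by (simp_all only: cv.span_minimal[OF _ subspace_vecs])
  obtain BW where BW: "BW \<subseteq> W0" "cv.independent BW" "W0 \<subseteq> cv.span BW"
    using cv.basis_exists[of W0] by metis
  obtain BT where BT: "BT \<subseteq> T0" "cv.independent BT" "T0 \<subseteq> cv.span BT"
    using cv.basis_exists[of T0] by metis
  have fin: "finite BW" "finite BT"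
    using independent_vecs_bound BW(1,2) BT(1,2) sub' by blast+
  have less: "card BT < card BW"
  proof (rule ccontr)
    assume le: "\<not> card BT < card BW"
    obtain FT where FT: "\<And>q a. q \<in> BT \<Longrightarrow> a < n \<Longrightarrow> lifts q a (FT q a)"
      using lifts BT(1) by (metis subsetD)
    have "\<exists>w. (\<forall>j<p. w j \<in> vecs n) \<and> w i0 = uvec a \<and> (\<forall>i<p. pa w i = 0) \<and> (\<forall>b<n. slice p w b \<in> W0)"
      if a: "a < n" for a
    proof -
      obtain w where w: "\<And>j. j < p \<Longrightarrow> w j \<in> vecs n" "w i0 = uvec a"
        "\<And>i. i < p \<Longrightarrow> i \<noteq> i0 \<Longrightarrow> pa w i = 0"
        unfolding pa_def
        by (rule corank_one_solve[OF corank[OF dom] i0, of "uvec a" "\<lambda>_. 0"]) (use a in auto)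
      have "reach w \<and> (\<forall>i<p. pa w i = 0)" by (rule reach_base) (use w in auto)
      then show ?thesis using w by (auto simp: W0_def G_def intro!: exI[of _ w] cv.span_base)
    qed
    then obtain FN where FN: "\<And>a. a < n \<Longrightarrow> (\<forall>j<p. FN a j \<in> vecs n) \<and> FN a i0 = uvec a \<and>
        (\<forall>i<p. pa (FN a) i = 0) \<and> (\<forall>b<n. slice p (FN a) b \<in> W0)" by metis
    define F where "F k = (case k of (None, a) \<Rightarrow> FN a | (Some q, a) \<Rightarrow> FT q a)" for k
    \<comment> \<open>A basis of \<open>T0 \<otimes> k\<^sup>n \<oplus> k\<^sup>n\<close>, the index \<open>None\<close> standing for the kernel of \<open>Z(A)\<close>; it has more elements than a basis of \<open>W0 \<otimes> k\<^sup>n\<close>.\<close>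
    define U where "U = insert None (Some ` BT) \<times> {..<n}"
    have finU: "finite U" using fin by (simp add: U_def)
    have sumU: "(\<Sum>k\<in>U. h k) = (\<Sum>a<n. h (None, a)) + (\<Sum>q\<in>BT. \<Sum>a<n. h (Some q, a))"
      for h :: "_ \<Rightarrow> 'k cvec"
      unfolding U_def sum.cartesian_product' using fin
      by (simp add: sum.reindex)
    have F: "(\<forall>j<p. F k j \<in> vecs n) \<and> (\<forall>b<n. slice p (F k) b \<in> W0)" if "k \<in> U" for k
      using that FN FT by (auto simp: U_def F_def lifts_def)
    have cardI: "card (insert None (Some ` BT)) = Suc (card BT)" using fin by (simp add: card_image)
    have cardU: "card (BW \<times> {..<n}) < card U"
      using le n by (simp add: U_def card_cartesian_product cardI del: mult_Suc)
    let ?c = "\<lambda>k (u, b). cv.representation BW (slice p (F k) b) u"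
    obtain y where y: "\<exists>k\<in>U. y k \<noteq> 0" "\<And>l. l \<in> BW \<times> {..<n} \<Longrightarrow> (\<Sum>k\<in>U. y k * ?c k l) = 0"
      using fin finU cardU by (rule_tac homogeneous_system[of "BW \<times> {..<n}" U ?c]) auto
    define w where "w j = (\<Sum>k\<in>U. cscale (y k) (F k j))" for j
    have w_slice: "slice p w b = 0" if "b < n" for b
    proof -
      have "slice p w b = (\<Sum>k\<in>U. cscale (y k) (slice p (F k) b))"
        by (rule cvec_eqI) (simp add: coord_slice w_def)
      also have "\<dots> = (\<Sum>k\<in>U. cscale (y k) (\<Sum>u\<in>BW. cscale (?c k (u, b)) u))"
      proof (intro sum.cong refl arg_cong[where f = "cscale _"])
        fix k assume "k \<in> U"
        then have "slice p (F k) b \<in> cv.span BW" using F BW(3) that by blast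
        then show "slice p (F k) b = (\<Sum>u\<in>BW. cscale (?c k (u, b)) u)"
          using cv.sum_representation_eq[OF BW(2) _ fin(1) subset_refl] by simp
      qed
      also have "\<dots> = (\<Sum>u\<in>BW. cscale (\<Sum>k\<in>U. y k * ?c k (u, b)) u)"
        unfolding cv.scale_sum_right cv.scale_sum_left by (subst sum.swap) simp
      also have "\<dots> = 0"
      proof (rule sum.neutral, rule ballI)
        fix u assume "u \<in> BW"
        then have "(\<Sum>k\<in>U. y k * ?c k (u, b)) = 0" using y(2)[of "(u, b)"] that by simp
        then show "cscale (\<Sum>k\<in>U. y k * ?c k (u, b)) u = 0" by (simp only: cv.scale_zero_left)
      qed
      finally show ?thesis .
    qed
    have w0: "w j = 0" if j: "j < p" for j
    proof (rule cvec_eqI)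
      fix b
      have "w j \<in> vecs n" unfolding w_def using F j by (intro vecs_sum vecs_closed) auto
      moreover have "coord (w j) b = coord (slice p w b) j" using j by (simp add: coord_slice)
      ultimately show "coord (w j) b = coord 0 b"
        using w_slice[of b] by (cases "b < n") (auto simp: vecs_def)
    qed
    have yN: "y (None, a) = 0" if "a < n" for a
    proof -
      have "0 = coord (\<Sum>k\<in>U. cscale (y k) (F k i0)) a" using w0[OF i0] by (simp add: w_def[symmetric])
      also have "(\<Sum>k\<in>U. cscale (y k) (F k i0)) = (\<Sum>a<n. cscale (y (None, a)) (uvec a))"
        unfolding sumU using FN FT by (simp add: F_def lifts_def)
      also have "coord \<dots> a = y (None, a)"
        using that by (simp add: if_distrib[of "\<lambda>x. _ * x"] cong: if_cong)
      finally show ?thesis by simp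
    qed
    have yS: "y (Some q, a) = 0" if "q \<in> BT" "a < n" for q a
    proof -
      have "(\<Sum>q\<in>BT. cscale (y (Some q, a)) q) = 0"
      proof (rule cvec_eqI)
        fix i
        show "coord (\<Sum>q\<in>BT. cscale (y (Some q, a)) q) i = coord 0 i"
        proof (cases "i < p")
          case True
          have "0 = pa w i" using w0 by (simp add: pa_def)
          also have "\<dots> = (\<Sum>k\<in>U. cscale (y k) (pa (F k) i))"
            unfolding w_def by (rule pa_sum)
          also have "\<dots> = (\<Sum>q\<in>BT. \<Sum>a<n. cscale (y (Some q, a)) (cscale (coord q i) (uvec a)))"
            unfolding sumU using FN FT True by (simp add: F_def lifts_def)
          finally have "0 = coord (\<Sum>q\<in>BT. \<Sum>a<n. cscale (y (Some q, a)) (cscale (coord q i) (uvec a))) a"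
            by (metis coord_simps(1))
          also have "\<dots> = coord (\<Sum>q\<in>BT. cscale (y (Some q, a)) q) i"
            using \<open>a < n\<close> by (simp add: if_distrib[of "\<lambda>x. _ * x"] cong: if_cong)
          finally show ?thesis by simp
        next
          case False
          have "(\<Sum>q\<in>BT. cscale (y (Some q, a)) q) \<in> vecs p"
            using BT(1) sub'(2) by (intro vecs_sum vecs_closed) auto
          then show ?thesis using False by (simp add: vecs_def del: coord_sum)
        qed
      qed
      then show ?thesis
        using cv.independentD[OF BT(2) fin(2) subset_refl, of "\<lambda>q. y (Some q, a)" q] that(1) by simp
    qed
    show False using y(1) yN yS by (auto simp: U_def)
  qed
  show thesis
  proof (rule that[of BW BT])
    show "mact p Z0 b \<in> cv.span BT" if "b \<in> BW" for b
      using Z0_W0[of b] that BW(1) BT(3) by blast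
    show "mact p (Z x) b \<in> cv.span BT" if "b \<in> BW" for b x
      using Z_W0[of b x] that BW(1) BT(3) by blast
  qed (use BW BT less sub' in auto)
qed


section \<open>Singular matrices over the free algebra are not full\<close>

lemma ncconst_commute: "ncconst c * f = f * (ncconst c :: ('x, 'k::comm_semiring_1) ncpoly)"
  by (induction f rule: ncpoly_induct) (auto simp: mult_single distrib_left distrib_right mult.commute)

lemma ncconst_sum: "ncconst (sum f S) = (\<Sum>i\<in>S. ncconst (f i))"
  by (induction S rule: infinite_finite_induct) (auto simp: single_add)

lemma ncconst_mult: "ncconst (a * b) = ncconst a * (ncconst b :: ('x, 'k::comm_semiring_1) ncpoly)"
  by (simp add: mult_single)

text \<open>
  In a basis of \<open>k\<^sup>p\<close> that extends \<open>W\<close>, the columns belonging to \<open>W\<close> factor through \<open>T\<close>; the other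
  \<open>p - card W\<close> columns are left as they are.
\<close>

lemma pencil_rank:
  fixes I :: "('x::finite, 'k::field) ncpoly set"
  assumes I: "two_sided_ideal I"
    and W: "cv.independent W" "W \<subseteq> vecs p" and T: "cv.independent T" "T \<subseteq> vecs p"
    and card: "card T < card W"
    and Z0: "\<And>b. b \<in> W \<Longrightarrow> mact p Z0 b \<in> cv.span T"
    and Z: "\<And>b x. b \<in> W \<Longrightarrow> mact p (Z x) b \<in> cv.span T"
  shows "rank_le_mod I {..<p} {..<p} (pencil Z0 Z) (p - 1)"
proof -
  interpret two_sided_ideal I by (rule I)
  obtain B where B: "W \<subseteq> B" "B \<subseteq> vecs p" "cv.independent B" "vecs p \<subseteq> cv.span B"
    using cv.maximal_independent_subset_extend[OF W(2,1)] by metis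
  have fin: "finite B" "card B \<le> p" "finite T" "finite W"
    using independent_vecs_bound[OF B(3,2)] independent_vecs_bound[OF T] independent_vecs_bound[OF W] by auto
  define pv :: "'k cvec \<Rightarrow> nat \<Rightarrow> ('x, 'k) ncpoly" where "pv b i = ncconst (coord (mact p Z0 b) i)
    + (\<Sum>x\<in>UNIV. ncconst (coord (mact p (Z x) b) i) * ncvar x)" for b i
  define F where "F b j = cv.representation B (uvec j) b" for b j
  have pencil: "pencil Z0 Z i j = (\<Sum>b\<in>B. pv b i * ncconst (F b j))" if ij: "i < p" "j < p" for i j
  proof -
    have "uvec j \<in> cv.span B" using B(4) ij by auto
    then have u: "uvec j = (\<Sum>b\<in>B. cscale (F b j) b)"
      unfolding F_def using cv.sum_representation_eq[OF B(3) _ fin(1) subset_refl] by simp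
    have c: "M $$ (i, j) = (\<Sum>b\<in>B. coord (mact p M b) i * F b j)" for M :: "'k mat"
    proof -
      have "M $$ (i, j) = coord (mact p M (uvec j)) i"
        using ij by (simp add: coord_mact if_distrib[of "\<lambda>x. _ * x"] cong: if_cong)
      also have "\<dots> = (\<Sum>b\<in>B. coord (mact p M b) i * F b j)"
        by (subst u) (simp add: mact_sum_right mact_cscale_right mult.commute)
      finally show ?thesis .
    qed
    have "pencil Z0 Z i j = (\<Sum>b\<in>B. ncconst (coord (mact p Z0 b) i) * ncconst (F b j))
        + (\<Sum>x\<in>UNIV. \<Sum>b\<in>B. ncconst (coord (mact p (Z x) b) i) * ncconst (F b j) * ncvar x)"
      unfolding pencil_def c by (simp add: ncconst_sum ncconst_mult sum_distrib_right)
    also have "(\<Sum>x\<in>UNIV. \<Sum>b\<in>B. ncconst (coord (mact p (Z x) b) i) * ncconst (F b j) * ncvar x)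
        = (\<Sum>b\<in>B. \<Sum>x\<in>UNIV. ncconst (coord (mact p (Z x) b) i) * ncvar x * ncconst (F b j))"
      by (subst sum.swap) (simp only: mult.assoc ncconst_commute[of "F _ _" "ncvar _"])
    finally show ?thesis
      by (simp add: pv_def distrib_right sum_distrib_right sum.distrib)
  qed
  define lam :: "'k cvec \<Rightarrow> 'k cvec \<Rightarrow> ('x, 'k) ncpoly" where
    "lam b q = ncconst (cv.representation T (mact p Z0 b) q)
      + (\<Sum>x\<in>UNIV. ncconst (cv.representation T (mact p (Z x) b) q) * ncvar x)" for b q
  have pv: "pv b i = (\<Sum>q\<in>T. ncconst (coord q i) * lam b q)" if b: "b \<in> W" for b i
  proof -
    have c: "coord v i = (\<Sum>q\<in>T. coord q i * cv.representation T v q)" if "v \<in> cv.span T" for v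
    proof -
      have "v = (\<Sum>q\<in>T. cscale (cv.representation T v q) q)"
        using cv.sum_representation_eq[OF T(1) that fin(3) subset_refl] by simp
      from arg_cong[OF this, of "\<lambda>v. coord v i"] show ?thesis by (simp add: mult.commute)
    qed
    show ?thesis
      unfolding pv_def lam_def c[OF Z0[OF b]] c[OF Z[OF b]] ncconst_sum ncconst_mult
        sum_distrib_right distrib_left sum.distrib sum_distrib_left mult.assoc
      by (subst (2) sum.swap) simp
  qed
  define P where "P i l = (case l of Inl q \<Rightarrow> ncconst (coord q i) | Inr b \<Rightarrow> pv b i)" for i l
  define Q where "Q l j = (case l of Inl q \<Rightarrow> (\<Sum>b\<in>W. lam b q * ncconst (F b j)) | Inr b \<Rightarrow> ncconst (F b j))" for l j
  show ?thesis
  proof (rule rank_le_modI[where L = "T <+> (B - W)" and P = P and Q = Q])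
    show "finite (T <+> (B - W))" using fin by simp
    have "card W \<le> card B" using B(1) fin by (simp add: card_mono)
    moreover have "card (T <+> (B - W)) = card T + (card B - card W)"
      using fin B(1) by (simp add: card_Plus card_Diff_subset)
    ultimately show "card (T <+> (B - W)) \<le> p - 1" using card fin(2) by linarith
    fix i j assume ij: "i \<in> {..<p}" "j \<in> {..<p}"
    have "(\<Sum>l\<in>T <+> (B - W). P i l * Q l j)
        = (\<Sum>q\<in>T. ncconst (coord q i) * (\<Sum>b\<in>W. lam b q * ncconst (F b j))) + (\<Sum>b\<in>B - W. pv b i * ncconst (F b j))"
      using fin by (subst sum.Plus) (simp_all add: P_def Q_def)
    also have "(\<Sum>q\<in>T. ncconst (coord q i) * (\<Sum>b\<in>W. lam b q * ncconst (F b j))) = (\<Sum>b\<in>W. pv b i * ncconst (F b j))"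
    proof -
      have "(\<Sum>q\<in>T. ncconst (coord q i) * (\<Sum>b\<in>W. lam b q * ncconst (F b j)))
          = (\<Sum>b\<in>W. \<Sum>q\<in>T. ncconst (coord q i) * lam b q * ncconst (F b j))"
        unfolding sum_distrib_left mult.assoc by (rule sum.swap)
      also have "\<dots> = (\<Sum>b\<in>W. pv b i * ncconst (F b j))"
        by (intro sum.cong refl) (simp add: pv sum_distrib_right)
      finally show ?thesis .
    qed
    also have "(\<Sum>b\<in>W. pv b i * ncconst (F b j)) + (\<Sum>b\<in>B - W. pv b i * ncconst (F b j)) = pencil Z0 Z i j"
      unfolding pencil[OF ij[simplified]] using sum.subset_diff[OF B(1) fin(1), of "\<lambda>b. pv b i * ncconst (F b j)"]
      by (simp add: add.commute)
    finally show "pencil Z0 Z i j - (\<Sum>l\<in>T <+> (B - W). P i l * Q l j) \<in> I"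
      by (simp add: zero_mem)
  qed
qed

definition word_len_le :: "nat \<Rightarrow> ('x, 'k::zero) ncpoly \<Rightarrow> bool" where
  "word_len_le g f \<longleftrightarrow> (\<forall>w\<in>Poly_Mapping.keys f. length (letters w) \<le> g)"

lemma word_len_le_add: "word_len_le g f \<Longrightarrow> word_len_le g h \<Longrightarrow> word_len_le g (f + h)"
  using Poly_Mapping.keys_add[of f h] by (fastforce simp: word_len_le_def)

lemma word_len_le_uminus: "word_len_le g f \<Longrightarrow> word_len_le g (- f)"
  for f :: "('x, 'k::ab_group_add) ncpoly"
  by (simp add: word_len_le_def)

lemma word_len_le_mono: "word_len_le g f \<Longrightarrow> g \<le> h \<Longrightarrow> word_len_le h f"
  by (force simp: word_len_le_def)

lemma word_len_le_exists: "\<exists>g. word_len_le g f"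
  by (rule exI[of _ "Max (length ` letters ` Poly_Mapping.keys f)"])
    (auto simp: word_len_le_def intro!: Max_ge)

lemma word_len_le_simps [simp]:
  "word_len_le g 0" "word_len_le g (ncconst c)" "word_len_le (Suc g) (ncvar x)" "word_len_le g 1"
  unfolding single_one[symmetric]
  by (auto simp: word_len_le_def zero_ncmono_def ncvar_def keys_single split: if_splits)

lemma word_len_le_0:
  assumes "word_len_le 0 f"
  shows "f = ncconst (Poly_Mapping.lookup f 0)"
proof -
  have "Poly_Mapping.keys f \<subseteq> {0}"
    using assms by (auto simp: word_len_le_def zero_ncmono_def) (metis ncmono.exhaust_sel)
  then show ?thesis
    by (intro poly_mapping_eqI) (auto simp: lookup_single when_def in_keys_iff)
qed

lemma split_first_letter:
  fixes f :: "('x::finite, 'k::comm_ring_1) ncpoly"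
  assumes "word_len_le (Suc g) f"
  obtains c h where "f = ncconst c + (\<Sum>x\<in>UNIV. ncvar x * h x)" "\<And>x. word_len_le g (h x)"
proof -
  define good where "good f \<longleftrightarrow> (\<exists>c h. f = ncconst c + (\<Sum>x\<in>UNIV. ncvar x * h x) \<and> (\<forall>x. word_len_le g (h x)))"
    for f :: "('x, 'k) ncpoly"
  have add: "good (f + f')" if "good f" "good f'" for f f'
  proof -
    from that obtain c h c' h' where "f = ncconst c + (\<Sum>x\<in>UNIV. ncvar x * h x)" "\<forall>x. word_len_le g (h x)"
      "f' = ncconst c' + (\<Sum>x\<in>UNIV. ncvar x * h' x)" "\<forall>x. word_len_le g (h' x)" unfolding good_def by blast
    then show ?thesis unfolding good_def
      by (intro exI[of _ "c + c'"] exI[of _ "\<lambda>x. h x + h' x"])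
        (auto simp: single_add distrib_left sum.distrib word_len_le_add)
  qed
  have zero: "good 0" unfolding good_def by (intro exI[of _ 0] exI[of _ "\<lambda>_. 0"]) simp
  have single: "good (Poly_Mapping.single w c)" if "length (letters w) \<le> Suc g" for w c
  proof (cases "letters w")
    case Nil
    then have "w = 0" by (cases w) (simp add: zero_ncmono_def)
    then show ?thesis unfolding good_def by (intro exI[of _ c] exI[of _ "\<lambda>_. 0"]) simp
  next
    case (Cons y ys)
    then have w: "w = NCMono (y # ys)" by (cases w) simp
    define h where "h x = (if x = y then Poly_Mapping.single (NCMono ys) c else 0)" for x
    have "(\<Sum>x\<in>UNIV. ncvar x * h x) = (\<Sum>x\<in>UNIV. if x = y then ncvar x * Poly_Mapping.single (NCMono ys) c else 0)"
      by (intro sum.cong) (auto simp: h_def)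
    then have "Poly_Mapping.single w c = ncconst 0 + (\<Sum>x\<in>UNIV. ncvar x * h x)"
      by (simp add: w single_word_Cons)
    moreover have "word_len_le g (h x)" for x
      using that Cons by (auto simp: h_def word_len_le_def split: if_splits)
    ultimately show ?thesis unfolding good_def by blast
  qed
  have "good (\<Sum>w\<in>S. Poly_Mapping.single w (Poly_Mapping.lookup f w))" if "S \<subseteq> Poly_Mapping.keys f" for S
    using finite_subset[OF that finite_keys] that
  proof (induction S rule: finite_induct)
    case empty
    show ?case using zero by simp
  next
    case (insert w S)
    then show ?case using assms by (auto simp: word_len_le_def intro!: add single)
  qed
  then have "good f" by (metis ncpoly_sum_single subset_refl)
  then show thesis using that unfolding good_def by blast
qed

lemma split_first_letter_choice:
  obtains c :: "('x::finite, 'k::comm_ring_1) ncpoly \<Rightarrow> 'k" and h where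
    "\<And>f. word_len_le (Suc g) f \<Longrightarrow> f = ncconst (c f) + (\<Sum>x\<in>UNIV. ncvar x * h f x)"
    "\<And>f x. word_len_le (Suc g) f \<Longrightarrow> word_len_le g (h f x)"
proof -
  have "\<forall>f :: ('x, 'k) ncpoly. \<exists>ch. word_len_le (Suc g) f \<longrightarrow>
      f = ncconst (fst ch) + (\<Sum>x\<in>UNIV. ncvar x * snd ch x) \<and> (\<forall>x. word_len_le g (snd ch x))"
  proof
    fix f :: "('x, 'k) ncpoly"
    show "\<exists>ch. word_len_le (Suc g) f \<longrightarrow>
      f = ncconst (fst ch) + (\<Sum>x\<in>UNIV. ncvar x * snd ch x) \<and> (\<forall>x. word_len_le g (snd ch x))"
    proof (cases "word_len_le (Suc g) f")
      case True
      then obtain c h where "f = ncconst c + (\<Sum>x\<in>UNIV. ncvar x * h x)" "\<And>x. word_len_le g (h x)"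
        by (rule split_first_letter) (rule that)
      then show ?thesis by (intro exI[of _ "(c, h)"]) auto
    qed simp
  qed
  from choice[OF this] obtain ch :: "('x, 'k) ncpoly \<Rightarrow> 'k \<times> ('x \<Rightarrow> ('x, 'k) ncpoly)"
    where ch: "\<forall>f. word_len_le (Suc g) f \<longrightarrow>
      f = ncconst (fst (ch f)) + (\<Sum>x\<in>UNIV. ncvar x * snd (ch f) x) \<and> (\<forall>x. word_len_le g (snd (ch f) x))" ..
  show thesis
    by (rule that[of "\<lambda>f. fst (ch f)" "\<lambda>f. snd (ch f)"]) (use ch in blast)+
qed

lemma corank_one_at_reindex:
  assumes h: "bij_betw h S' S" and i0: "i0 \<in> S'" and c: "corank_one_at n A S (h i0) M"
  shows "corank_one_at n A S' i0 (\<lambda>i j. M (h i) (h j))"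
  unfolding corank_one_at_def
proof (intro allI impI)
  fix \<xi> assume \<xi>: "\<forall>j\<in>S'. \<xi> j \<in> vecs n" and
    rows: "\<forall>i\<in>S' - {i0}. (\<Sum>j\<in>S'. act n A (M (h i) (h j)) (\<xi> j)) = 0"
  define \<eta> where "\<eta> j = \<xi> (inv_into S' h j)" for j
  have inv: "inv_into S' h (h j) = j" if "j \<in> S'" for j
    using that h by (auto simp: bij_betw_def)
  have sum: "(\<Sum>j\<in>S'. act n A (M i (h j)) (\<xi> j)) = (\<Sum>j\<in>S. act n A (M i j) (\<eta> j))" for i
  proof -
    have "(\<Sum>j\<in>S. act n A (M i j) (\<eta> j)) = (\<Sum>j\<in>S'. act n A (M i (h j)) (\<eta> (h j)))"
      by (rule sum.reindex_bij_betw[OF h, symmetric])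
    then show ?thesis by (simp add: \<eta>_def inv)
  qed
  have \<eta>: "\<eta> j \<in> vecs n" if "j \<in> S" for j
    using that \<xi> h unfolding \<eta>_def by (metis bij_betw_def inv_into_into)
  have \<eta>rows: "(\<Sum>j\<in>S. act n A (M i j) (\<eta> j)) = 0" if i: "i \<in> S - {h i0}" for i
  proof -
    obtain i' where i': "i' \<in> S'" "i = h i'" using i h by (auto simp: bij_betw_def)
    moreover have "i' \<noteq> i0" using i i' by auto
    ultimately show ?thesis using rows sum[of i] i' by auto
  qed
  have "(\<Sum>j\<in>S. act n A (M (h i0) j) (\<eta> j)) = 0 \<and> (\<eta> (h i0) = 0 \<longrightarrow> (\<forall>j\<in>S. \<eta> j = 0))"
    using c[unfolded corank_one_at_def, THEN spec[of _ \<eta>]] \<eta> \<eta>rows by blast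
  moreover have "\<forall>j\<in>S'. \<xi> j = \<eta> (h j)" by (simp add: \<eta>_def inv)
  moreover have "\<forall>j\<in>S'. h j \<in> S" using h by (auto simp: bij_betw_def)
  ultimately show "(\<Sum>j\<in>S'. act n A (M (h i0) (h j)) (\<xi> j)) = 0 \<and> (\<xi> i0 = 0 \<longrightarrow> (\<forall>j\<in>S'. \<xi> j = 0))"
    unfolding sum using i0 by simp
qed

lemma corank_one_at_cong:
  assumes "corank_one_at n A S i0 M" "i0 \<in> S" "\<And>i j. i \<in> S \<Longrightarrow> j \<in> S \<Longrightarrow> M' i j = M i j"
  shows "corank_one_at n A S i0 M'"
proof -
  have "(\<Sum>j\<in>S. act n A (M' i j) (\<xi> j)) = (\<Sum>j\<in>S. act n A (M i j) (\<xi> j))" if "i \<in> S" for i \<xi>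
    using assms(3) that by (intro sum.cong) auto
  then show ?thesis using assms(1,2) unfolding corank_one_at_def by auto
qed

text \<open>
  Linearisation, one letter at a time. With \<open>M = C + \<Sum> x H\<^sub>x\<close> the matrix with rows \<open>(C, (x)\<^sub>x)\<close> and
  \<open>(- H\<^sub>x, 1)\<close> has shorter words, and its auxiliary unknowns are forced to be \<open>H\<^sub>x \<xi>\<close>, so it inherits
  corank one. Column operations turn it into \<open>(M, (x)\<^sub>x)\<close> over \<open>(0, 1)\<close>. Splitting off the identity
  block uses the law of nullity: over an arbitrary ring a full matrix may cease to
  be full after an identity matrix is added to it.
\<close>

lemma corank_one_rank:
  fixes I :: "('x::finite, 'k::field_char_0) ncpoly set" and M :: "nat \<Rightarrow> nat \<Rightarrow> ('x, 'k) ncpoly"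
  assumes I: "sylvester_ideal I" and V: "vanishing_set I \<noteq> {}" and e: "ratexp_dom e \<noteq> {}"
    and i0: "i0 < p"
    and corank: "\<And>n A. (n, A) \<in> ratexp_dom e \<Longrightarrow> corank_one_at n A {..<p} i0 M"
    and len: "\<And>i j. i < p \<Longrightarrow> j < p \<Longrightarrow> word_len_le (Suc g) (M i j)"
  shows "rank_le_mod I {..<p} {..<p} M (p - 1)"
  using i0 corank len
proof (induction g arbitrary: p i0 M)
  interpret sylvester_ideal I by (rule I)
  case 0
  obtain c' :: "('x, 'k) ncpoly \<Rightarrow> 'k" and h' where
    ch': "\<And>f. word_len_le (Suc 0) f \<Longrightarrow> f = ncconst (c' f) + (\<Sum>x\<in>UNIV. ncvar x * h' f x)"
      "\<And>f x. word_len_le (Suc 0) f \<Longrightarrow> word_len_le 0 (h' f x)"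
    by (rule split_first_letter_choice[of 0]) (rule that)
  define c where "c i j = c' (M i j)" for i j
  define h where "h i j x = Poly_Mapping.lookup (h' (M i j) x) 0" for i j x
  have ch: "M i j = ncconst (c i j) + (\<Sum>x\<in>UNIV. ncvar x * ncconst (h i j x))" if "i < p" "j < p" for i j
  proof -
    have len: "word_len_le (Suc 0) (M i j)" by (rule 0(3)[OF that])
    have "h' (M i j) x = ncconst (h i j x)" for x
      unfolding h_def by (rule word_len_le_0[OF ch'(2)[OF len]])
    then show ?thesis using ch'(1)[OF len] by (simp add: c_def)
  qed
  define Z0 where "Z0 = mat p p (\<lambda>(i, j). c i j)"
  define Z where "Z x = mat p p (\<lambda>(i, j). h i j x)" for x
  have M: "pencil Z0 Z i j = M i j" if "i < p" "j < p" for i j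
    using that by (simp add: pencil_def Z0_def Z_def ch ncconst_commute)
  from e obtain n A where dom: "(n, A) \<in> ratexp_dom e" by auto
  have corank: "corank_one_at n A {..<p} i0 (pencil Z0 Z)" if "(n, A) \<in> ratexp_dom e" for n A
    by (rule corank_one_at_cong[OF 0(2)[OF that]]) (use M 0(1) in auto)
  obtain W T where
    "cv.independent W" "W \<subseteq> vecs p" "cv.independent T" "T \<subseteq> vecs p" "card T < card W"
    "\<And>b. b \<in> W \<Longrightarrow> mact p Z0 b \<in> cv.span T" "\<And>b x. b \<in> W \<Longrightarrow> mact p (Z x) b \<in> cv.span T"
    by (rule corank_one_shrunk_subspace[OF dom 0(1) corank]) (assumption, rule that)
  then have "rank_le_mod I {..<p} {..<p} (pencil Z0 Z) (p - 1)"
    by (intro pencil_rank[where W = W and T = T]) (auto intro: two_sided_ideal_axioms)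
  then show ?case by (rule rank_le_mod_cong) (use M zero_mem in auto)
next
  interpret sylvester_ideal I by (rule I)
  case (Suc g)
  obtain c' :: "('x, 'k) ncpoly \<Rightarrow> 'k" and h' where
    ch': "\<And>f. word_len_le (Suc (Suc g)) f \<Longrightarrow> f = ncconst (c' f) + (\<Sum>x\<in>UNIV. ncvar x * h' f x)"
      "\<And>f x. word_len_le (Suc (Suc g)) f \<Longrightarrow> word_len_le (Suc g) (h' f x)"
    by (rule split_first_letter_choice[of "Suc g"]) (rule that)
  define c where "c i j = c' (M i j)" for i j
  define h where "h i j x = h' (M i j) x" for i j x
  have M: "M i j = ncconst (c i j) + (\<Sum>x\<in>UNIV. ncvar x * h i j x)" if "i < p" "j < p" for i j
    unfolding c_def h_def by (rule ch'(1)[OF Suc.prems(3)[OF that]])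
  have h: "word_len_le (Suc g) (h i j x)" if "i < p" "j < p" for i j x
    unfolding h_def by (rule ch'(2)[OF Suc.prems(3)[OF that]])
  \<comment> \<open>The index \<open>(i, None)\<close> is the old index \<open>i\<close>, and \<open>(i, Some x)\<close> is the auxiliary unknown \<open>(H\<^sub>x \<xi>)\<^sub>i\<close>.\<close>
  define S where "S = {..<p} \<times> (UNIV :: 'x option set)"
  define H :: "nat \<times> 'x option \<Rightarrow> nat \<times> 'x option \<Rightarrow> ('x, 'k) ncpoly" where
    "H s t = (case s of
       (i, None) \<Rightarrow> (case t of (j, None) \<Rightarrow> ncconst (c i j) | (j, Some y) \<Rightarrow> if i = j then ncvar y else 0)
     | (i, Some x) \<Rightarrow> (case t of (j, None) \<Rightarrow> - h i j x | (j, Some y) \<Rightarrow> if i = j \<and> x = y then 1 else 0))" for s t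
  have finS: "finite S" by (simp add: S_def)
  have sumS: "(\<Sum>s\<in>S. f s) = (\<Sum>j<p. f (j, None)) + (\<Sum>j<p. \<Sum>y\<in>UNIV. f (j, Some y))"
    for f :: "_ \<Rightarrow> 'b::comm_monoid_add"
    unfolding S_def sum.cartesian_product' UNIV_option_conv
    by (simp add: sum.reindex sum.distrib)
  have corankH: "corank_one_at n A S (i0, None) H" if dom: "(n, A) \<in> ratexp_dom e" for n A
    unfolding corank_one_at_def
  proof (intro allI impI)
    have tup: "mat_tuple n A" using dom by (simp add: ratexp_dom_def)
    fix \<xi> assume \<xi>: "\<forall>j\<in>S. \<xi> j \<in> vecs n"
      and rows: "\<forall>i\<in>S - {(i0, None)}. (\<Sum>j\<in>S. act n A (H i j) (\<xi> j)) = 0"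
    define \<eta> where "\<eta> j = \<xi> (j, None)" for j
    have \<eta>: "\<eta> j \<in> vecs n" if "j < p" for j using \<xi> that by (simp add: \<eta>_def S_def)
    have Srow: "\<xi> (i, Some x) = (\<Sum>j<p. act n A (h i j x) (\<eta> j))" if i: "i < p" for i x
    proof -
      have "(i, Some x) \<in> S - {(i0, None)}" using i by (simp add: S_def)
      from bspec[OF rows this] have "0 = (\<Sum>j\<in>S. act n A (H (i, Some x) j) (\<xi> j))" by (rule sym)
      also have "\<dots> = (\<Sum>j<p. act n A (- h i j x) (\<eta> j))
          + (\<Sum>j<p. \<Sum>y\<in>UNIV. act n A (if i = j \<and> x = y then 1 else 0) (\<xi> (j, Some y)))"
        unfolding sumS by (simp add: H_def \<eta>_def)
      also have "(\<Sum>j<p. \<Sum>y\<in>UNIV. act n A (if i = j \<and> x = y then 1 else 0) (\<xi> (j, Some y)))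
          = (\<Sum>j<p. \<Sum>y\<in>UNIV. if x = y then (if i = j then \<xi> (j, Some y) else 0) else 0)"
        using \<xi> by (intro sum.cong refl) (auto simp: S_def)
      also have "\<dots> = \<xi> (i, Some x)" using i by simp
      finally have "0 = - (\<Sum>j<p. act n A (h i j x) (\<eta> j)) + \<xi> (i, Some x)"
        by (simp only: act_uminus_left sum_negf)
      then show ?thesis by simp
    qed
    have Nrow: "(\<Sum>j\<in>S. act n A (H (i, None) j) (\<xi> j)) = (\<Sum>j<p. act n A (M i j) (\<eta> j))" if i: "i < p" for i
    proof -
      have "(\<Sum>j\<in>S. act n A (H (i, None) j) (\<xi> j)) = (\<Sum>j<p. act n A (ncconst (c i j)) (\<eta> j))
          + (\<Sum>j<p. \<Sum>y\<in>UNIV. act n A (if i = j then ncvar y else 0) (\<xi> (j, Some y)))"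
        unfolding sumS by (simp add: H_def \<eta>_def)
      also have "(\<Sum>j<p. \<Sum>y\<in>UNIV. act n A (if i = j then ncvar y else 0) (\<xi> (j, Some y)))
          = (\<Sum>j<p. if i = j then \<Sum>y\<in>UNIV. act n A (ncvar y) (\<xi> (j, Some y)) else 0)"
        by (intro sum.cong refl) auto
      also have "\<dots> = (\<Sum>y\<in>UNIV. act n A (ncvar y) (\<xi> (i, Some y)))" using i by simp
      also have "\<dots> = (\<Sum>y\<in>UNIV. \<Sum>j<p. act n A (ncvar y * h i j y) (\<eta> j))"
        by (simp add: Srow[OF i] act_sum_right act_mult_left[OF tup])
      also have "\<dots> = (\<Sum>j<p. \<Sum>y\<in>UNIV. act n A (ncvar y * h i j y) (\<eta> j))" by (rule sum.swap)
      finally show ?thesis using i by (simp add: M act_add_left act_sum_left sum.distrib)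
    qed
    have B: "\<forall>i\<in>{..<p} - {i0}. (\<Sum>j<p. act n A (M i j) (\<eta> j)) = 0"
    proof
      fix i assume "i \<in> {..<p} - {i0}"
      then have i: "i < p" "(i, None) \<in> S - {(i0, None)}" by (auto simp: S_def)
      show "(\<Sum>j<p. act n A (M i j) (\<eta> j)) = 0"
        unfolding Nrow[OF i(1), symmetric] by (rule bspec[OF rows i(2)])
    qed
    have "\<forall>j\<in>{..<p}. \<eta> j \<in> vecs n" using \<eta> by blast
    from Suc.prems(2)[OF dom, unfolded corank_one_at_def, THEN spec[of _ \<eta>], THEN mp, OF this, THEN mp, OF B]
    have concl: "(\<Sum>j<p. act n A (M i0 j) (\<eta> j)) = 0 \<and> (\<eta> i0 = 0 \<longrightarrow> (\<forall>j\<in>{..<p}. \<eta> j = 0))" .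
    have zero: "\<forall>j\<in>S. \<xi> j = 0" if z: "\<forall>j\<in>{..<p}. \<eta> j = 0"
    proof
      fix s assume s: "s \<in> S"
      obtain j y where jy: "s = (j, y)" by (cases s)
      show "\<xi> s = 0"
      proof (cases y)
        case None
        then show ?thesis using z s by (simp add: jy S_def \<eta>_def)
      next
        case (Some x)
        have j: "j < p" using s by (simp add: jy S_def)
        have "\<xi> (j, Some x) = (\<Sum>l<p. act n A (h j l x) (\<eta> l))" by (rule Srow[OF j])
        also have "\<dots> = 0" by (rule sum.neutral) (simp add: z)
        finally show ?thesis by (simp add: jy Some)
      qed
    qed
    show "(\<Sum>j\<in>S. act n A (H (i0, None) j) (\<xi> j)) = 0 \<and> (\<xi> (i0, None) = 0 \<longrightarrow> (\<forall>j\<in>S. \<xi> j = 0))"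
    proof (intro conjI impI)
      show "(\<Sum>j\<in>S. act n A (H (i0, None) j) (\<xi> j)) = 0"
        unfolding Nrow[OF Suc.prems(1)] using concl by (rule conjunct1)
      assume "\<xi> (i0, None) = 0"
      then have "\<eta> i0 = 0" by (simp only: \<eta>_def)
      from mp[OF conjunct2[OF concl] this] have "\<forall>j\<in>{..<p}. \<eta> j = 0" .
      then show "\<forall>j\<in>S. \<xi> j = 0" by (rule zero)
    qed
  qed
  have lenH: "word_len_le (Suc g) (H s t)" if "s \<in> S" "t \<in> S" for s t
    using that h by (auto simp: H_def S_def word_len_le_uminus split: option.splits)
  define p' where "p' = card S"
  obtain b where b: "bij_betw b {..<p'} S"
    using ex_bij_betw_nat_finite[OF finS] by (auto simp: lessThan_atLeast0 p'_def)
  obtain k0 where k0: "k0 < p'" "b k0 = (i0, None)"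
  proof -
    have "(i0, None) \<in> b ` {..<p'}" using b Suc.prems(1) by (simp add: bij_betw_def S_def)
    then show thesis using that by auto
  qed
  have bS: "b i \<in> S" if "i < p'" for i using b that by (auto simp: bij_betw_def)
  have "rank_le_mod I {..<p'} {..<p'} (\<lambda>i j. H (b i) (b j)) (p' - 1)"
  proof (rule Suc.IH[OF k0(1)])
    show "corank_one_at n A {..<p'} k0 (\<lambda>i j. H (b i) (b j))" if "(n, A) \<in> ratexp_dom e" for n A
    proof (rule corank_one_at_reindex[OF b])
      show "k0 \<in> {..<p'}" using k0 by simp
      show "corank_one_at n A S (b k0) H" unfolding k0(2) by (rule corankH[OF that])
    qed
  qed (use lenH bS in auto)
  then have "rank_le_mod I S S (\<lambda>s t. H (b (inv_into {..<p'} b s)) (b (inv_into {..<p'} b t))) (p' - 1)"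
    by (rule rank_le_mod_reindex) (use b in \<open>auto simp: bij_betw_def inv_into_into\<close>)
  moreover have "b (inv_into {..<p'} b s) = s" if "s \<in> S" for s
    using b that by (auto simp: bij_betw_def f_inv_into_f)
  ultimately have rankH: "rank_le_mod I S S H (p' - 1)"
    by (rule_tac rank_le_mod_cong) (auto simp: zero_mem)
  \<comment> \<open>The column operation that clears the entries \<open>- h\<close>.\<close>
  define E where "E s t = (case t of (j, None) \<Rightarrow> (case s of (i, None) \<Rightarrow> if i = j then 1 else 0 | (i, Some x) \<Rightarrow> h i j x)
    | (j, Some y) \<Rightarrow> if s = t then 1 else 0)" for s t :: "nat \<times> 'x option"
  define N where "N s t = (\<Sum>l\<in>S. H s l * E l t)" for s t
  have rankN: "rank_le_mod I S S N (p' - 1)"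
    by (rule rank_le_mod_mult_right[OF rankH, where Y = E]) (simp add: N_def zero_mem)
  have N_MM: "N (i, None) (j, None) = M i j" if ij: "i < p" "j < p" for i j
  proof -
    have "N (i, None) (j, None) = (\<Sum>l<p. if l = j then ncconst (c i l) else 0)
        + (\<Sum>l<p. if i = l then (\<Sum>y\<in>UNIV. ncvar y * h l j y) else 0)"
      unfolding N_def sumS
      by (intro arg_cong2[where f = "(+)"] sum.cong refl) (auto simp: H_def E_def)
    then show ?thesis using ij by (simp add: M)
  qed
  have N_SM: "N (i, Some x) (j, None) = 0" if ij: "i < p" "j < p" for i j x
  proof -
    have "N (i, Some x) (j, None) = (\<Sum>l<p. if l = j then - h i l x else 0)
        + (\<Sum>l<p. \<Sum>y\<in>UNIV. if x = y then (if i = l then h l j y else 0) else 0)"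
      unfolding N_def sumS
      by (intro arg_cong2[where f = "(+)"] sum.cong refl) (auto simp: H_def E_def)
    then show ?thesis using ij by simp
  qed
  have N_SS: "N (i, Some x) (j, Some y) = (if (i, x) = (j, y) then 1 else 0)" if ij: "i < p" "j < p" for i j x y
  proof -
    have "N (i, Some x) (j, Some y) = (\<Sum>l<p. 0)
        + (\<Sum>l<p. \<Sum>z\<in>UNIV. if y = z then (if j = l then (if i = l \<and> x = z then 1 else 0) else 0) else 0)"
      unfolding N_def sumS
      by (intro arg_cong2[where f = "(+)"] sum.cong refl) (auto simp: H_def E_def)
    then show ?thesis using ij by simp
  qed
  let ?Sa = "{..<p} \<times> range Some :: (nat \<times> 'x option) set"
  let ?Tb = "{..<p} \<times> {None} :: (nat \<times> 'x option) set"
  have zero: "N s t \<in> I" if "s \<in> ?Sa" "t \<in> ?Tb" for s t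
    using that N_SM zero_mem by auto
  have subs: "?Sa \<subseteq> S" "?Tb \<subseteq> S" "finite ?Sa" "finite ?Tb" by (auto simp: S_def)
  obtain u v where uv: "u + v \<le> p' - 1" "rank_le_mod I ?Sa S N u" "rank_le_mod I S ?Tb N v"
    using zero_block_rank[OF rankN subs zero] by blast
  obtain n A where A: "(n, A) \<in> vanishing_set I" using V by auto
  have "card ?Sa \<le> u"
  proof (rule card_le_rank_mod[OF _ subs(3) A])
    show "rank_le_mod I ?Sa ?Sa N u" by (rule rank_le_mod_mono[OF uv(2)]) (use subs in auto)
    fix \<xi> assume \<xi>: "\<And>j. j \<in> ?Sa \<Longrightarrow> \<xi> j \<in> vecs n"
      and rows: "\<And>i. i \<in> ?Sa \<Longrightarrow> (\<Sum>j\<in>?Sa. act n A (N i j) (\<xi> j)) = 0"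
    show "\<forall>j\<in>?Sa. \<xi> j = 0"
    proof
      fix s assume s: "s \<in> ?Sa"
      have "0 = (\<Sum>j\<in>?Sa. act n A (N s j) (\<xi> j))" using rows[OF s] by simp
      also have "\<dots> = (\<Sum>j\<in>?Sa. if s = j then \<xi> j else 0)"
        using s \<xi> by (intro sum.cong refl) (auto simp: N_SS split: if_splits)
      also have "\<dots> = \<xi> s" using s by simp
      finally show "\<xi> s = 0" by simp
    qed
  qed
  moreover have "p' = p + card ?Sa"
  proof -
    have "S = ?Sa \<union> ?Tb" by (auto simp: S_def)
    then have "p' = card ?Sa + card ?Tb"
      unfolding p'_def by (simp only:) (rule card_Un_disjoint, auto)
    then show ?thesis by simp
  qed
  ultimately have "v \<le> p - 1" using uv(1) by linarith
  have "rank_le_mod I {..<p} {..<p} (\<lambda>i j. N (i, None) (j, None)) v"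
    by (rule rank_le_mod_reindex[OF uv(3)]) (auto simp: S_def)
  then have "rank_le_mod I {..<p} {..<p} M v"
    by (rule rank_le_mod_cong) (auto simp: N_MM zero_mem)
  then show ?case by (rule rank_le_mod_mono) (use \<open>v \<le> p - 1\<close> in auto)
qed


section \<open>Linear systems representing rational expressions\<close>

definition block_vec :: "nat \<Rightarrow> (nat \<Rightarrow> 'a) \<Rightarrow> (nat \<Rightarrow> 'a) \<Rightarrow> nat \<Rightarrow> 'a" where
  "block_vec N f g i = (if i < N then f i else g (i - N))"

definition block_mat :: "nat \<Rightarrow> (nat \<Rightarrow> nat \<Rightarrow> 'a) \<Rightarrow> (nat \<Rightarrow> nat \<Rightarrow> 'a) \<Rightarrow> (nat \<Rightarrow> nat \<Rightarrow> 'a) \<Rightarrow>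
    (nat \<Rightarrow> nat \<Rightarrow> 'a) \<Rightarrow> nat \<Rightarrow> nat \<Rightarrow> 'a" where
  "block_mat N A B C D i = (if i < N then block_vec N (A i) (B i) else block_vec N (C (i - N)) (D (i - N)))"

lemma block_vec_simps [simp]:
  "i < N \<Longrightarrow> block_vec N f g i = f i" "block_vec N f g (N + i) = g i"
  by (simp_all add: block_vec_def)

lemma block_mat_simps:
  "i < N \<Longrightarrow> block_mat N A B C D i = block_vec N (A i) (B i)"
  "block_mat N A B C D (N + i) = block_vec N (C i) (D i)"
  by (simp_all add: block_mat_def)

lemma all_less_plus_iff: "(\<forall>i<N + N'. P i) \<longleftrightarrow> (\<forall>i<N. P i) \<and> (\<forall>i<N'. P (N + i))" for N N' :: nat
proof safe
  fix i assume a: "\<forall>i<N. P i" "\<forall>i<N'. P (N + i)" "i < N + N'"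
  show "P i"
  proof (cases "i < N")
    case False
    then have "P (N + (i - N))" using a by (intro a(2)[rule_format]) simp
    then show ?thesis using False by simp
  qed (use a in simp)
qed auto

lemma sum_lessThan_plus: "(\<Sum>j<N + N'. f j) = (\<Sum>j<N. f j) + (\<Sum>j<N'. f (N + j))"
  for f :: "nat \<Rightarrow> 'a::comm_monoid_add"
  by (induction N') (simp_all add: add.assoc)

lemma sum_lessThan_1: "(\<Sum>j<1. f j) = f (0 :: nat)"
  by (simp add: lessThan_Suc)

lemma block_vec_act:
  "(\<Sum>j<N + N'. act n A (block_vec N f g j) (\<xi> j))
    = (\<Sum>j<N. act n A (f j) (\<xi> j)) + (\<Sum>j<N'. act n A (g j) (\<xi> (N + j)))"
  by (simp add: sum_lessThan_plus)

definition nonsingular_at ::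
  "nat \<Rightarrow> ('x \<Rightarrow> 'k::field mat) \<Rightarrow> nat \<Rightarrow> (nat \<Rightarrow> nat \<Rightarrow> ('x, 'k) ncpoly) \<Rightarrow> bool" where
  "nonsingular_at n A N L \<longleftrightarrow> (\<forall>\<xi>. (\<forall>j<N. \<xi> j \<in> vecs n) \<longrightarrow>
     (\<forall>i<N. (\<Sum>j<N. act n A (L i j) (\<xi> j)) = 0) \<longrightarrow> (\<forall>j<N. \<xi> j = 0))"

text \<open>
  \<open>M = c L\<^sup>-\<^sup>1 d\<close> at the point, expressed through solutions of \<open>L \<xi> = d v\<close>.
\<close>

definition transfer_at ::
  "nat \<Rightarrow> ('x \<Rightarrow> 'k::field mat) \<Rightarrow> nat \<Rightarrow> (nat \<Rightarrow> ('x, 'k) ncpoly) \<Rightarrow> (nat \<Rightarrow> nat \<Rightarrow> ('x, 'k) ncpoly) \<Rightarrow>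
    (nat \<Rightarrow> ('x, 'k) ncpoly) \<Rightarrow> 'k mat \<Rightarrow> bool" where
  "transfer_at n A N c L d M \<longleftrightarrow> (\<forall>v\<in>vecs n. \<exists>\<xi>. (\<forall>j<N. \<xi> j \<in> vecs n) \<and>
     (\<forall>i<N. (\<Sum>j<N. act n A (L i j) (\<xi> j)) = act n A (d i) v) \<and>
     (\<Sum>j<N. act n A (c j) (\<xi> j)) = mact n M v)"

definition represents ::
  "nat \<Rightarrow> (nat \<Rightarrow> ('x, 'k::field) ncpoly) \<Rightarrow> (nat \<Rightarrow> nat \<Rightarrow> ('x, 'k) ncpoly) \<Rightarrow>
    (nat \<Rightarrow> ('x, 'k) ncpoly) \<Rightarrow> ('x, 'k) ratexp \<Rightarrow> bool" where
  "represents N c L d e \<longleftrightarrow> (\<forall>(n, A)\<in>ratexp_dom e.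
     nonsingular_at n A N L \<and> transfer_at n A N c L d (the (ratexp_eval n A e)))"

lemma nonsingular_atD:
  assumes "nonsingular_at n A N L" "\<And>j. j < N \<Longrightarrow> \<xi> j \<in> vecs n"
    "\<And>i. i < N \<Longrightarrow> (\<Sum>j<N. act n A (L i j) (\<xi> j)) = 0" "j < N"
  shows "\<xi> j = 0"
  using assms unfolding nonsingular_at_def by blast

lemma transfer_atE:
  assumes "transfer_at n A N c L d M" "v \<in> vecs n"
  obtains \<xi> where "\<And>j. j < N \<Longrightarrow> \<xi> j \<in> vecs n"
    "\<And>i. i < N \<Longrightarrow> (\<Sum>j<N. act n A (L i j) (\<xi> j)) = act n A (d i) v"
    "(\<Sum>j<N. act n A (c j) (\<xi> j)) = mact n M v"
  using assms unfolding transfer_at_def by blast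

lemma nonsingular_at_block:
  assumes "nonsingular_at n A N L" "nonsingular_at n A N' L'"
  shows "nonsingular_at n A (N + N') (block_mat N L B (\<lambda>_ _. 0) L')"
  unfolding nonsingular_at_def all_less_plus_iff block_vec_act
proof (intro allI impI)
  fix \<xi>
  assume \<xi>: "(\<forall>j<N. \<xi> j \<in> vecs n) \<and> (\<forall>j<N'. \<xi> (N + j) \<in> vecs n)"
    and rows: "(\<forall>i<N. (\<Sum>j<N + N'. act n A (block_mat N L B (\<lambda>_ _. 0) L' i j) (\<xi> j)) = 0) \<and>
      (\<forall>i<N'. (\<Sum>j<N + N'. act n A (block_mat N L B (\<lambda>_ _. 0) L' (N + i) j) (\<xi> j)) = 0)"
  have 2: "\<xi> (N + j) = 0" if "j < N'" for j
    by (rule nonsingular_atD[OF assms(2), of "\<lambda>j. \<xi> (N + j)"])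
      (use \<xi> rows that in \<open>auto simp: block_mat_simps block_vec_act\<close>)
  have "\<xi> j = 0" if "j < N" for j
    by (rule nonsingular_atD[OF assms(1), of \<xi>])
      (use \<xi> rows that 2 in \<open>auto simp: block_mat_simps block_vec_act\<close>)
  with 2 show "(\<forall>j<N. \<xi> j = 0) \<and> (\<forall>j<N'. \<xi> (N + j) = 0)" by blast
qed

lemma transfer_at_intro:
  fixes A :: "'x \<Rightarrow> 'k::field mat"
  assumes "\<And>v. v \<in> vecs n \<Longrightarrow> \<exists>\<xi> \<eta>. (\<forall>j<N. \<xi> j \<in> vecs n) \<and> (\<forall>j<N'. \<eta> j \<in> vecs n) \<and>
     (\<forall>i<N. (\<Sum>j<N. act n A (L i j) (\<xi> j)) + (\<Sum>j<N'. act n A (B i j) (\<eta> j)) = act n A (d i) v) \<and>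
     (\<forall>i<N'. (\<Sum>j<N. act n A (C i j) (\<xi> j)) + (\<Sum>j<N'. act n A (L' i j) (\<eta> j)) = act n A (d' i) v) \<and>
     (\<Sum>j<N. act n A (c j) (\<xi> j)) + (\<Sum>j<N'. act n A (c' j) (\<eta> j)) = mact n M v"
  shows "transfer_at n A (N + N') (block_vec N c c') (block_mat N L B C L') (block_vec N d d') M"
  unfolding transfer_at_def
proof
  fix v :: "'k cvec" assume "v \<in> vecs n"
  from assms[OF this] obtain \<xi> \<eta> where *: "\<forall>j<N. \<xi> j \<in> vecs n" "\<forall>j<N'. \<eta> j \<in> vecs n"
     "\<forall>i<N. (\<Sum>j<N. act n A (L i j) (\<xi> j)) + (\<Sum>j<N'. act n A (B i j) (\<eta> j)) = act n A (d i) v"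
     "\<forall>i<N'. (\<Sum>j<N. act n A (C i j) (\<xi> j)) + (\<Sum>j<N'. act n A (L' i j) (\<eta> j)) = act n A (d' i) v"
     "(\<Sum>j<N. act n A (c j) (\<xi> j)) + (\<Sum>j<N'. act n A (c' j) (\<eta> j)) = mact n M v" by blast
  show "\<exists>\<xi>. (\<forall>j<N + N'. \<xi> j \<in> vecs n) \<and>
      (\<forall>i<N + N'. (\<Sum>j<N + N'. act n A (block_mat N L B C L' i j) (\<xi> j)) = act n A (block_vec N d d' i) v) \<and>
      (\<Sum>j<N + N'. act n A (block_vec N c c' j) (\<xi> j)) = mact n M v"
    by (rule exI[of _ "block_vec N \<xi> \<eta>"])
      (use * in \<open>simp add: all_less_plus_iff block_vec_act block_mat_simps\<close>)
qed

lemma represents_Pol: "represents 1 (\<lambda>_. 1) (\<lambda>_ _. 1) (\<lambda>_. p) (Pol p)"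
  for p :: "('x, 'k::field) ncpoly"
  unfolding represents_def
proof (intro ballI, clarify, intro conjI)
  fix n and A :: "'x \<Rightarrow> 'k mat"
  show "nonsingular_at n A 1 (\<lambda>_ _. 1)" by (simp add: nonsingular_at_def)
  show "transfer_at n A 1 (\<lambda>_. 1) (\<lambda>_ _. 1) (\<lambda>_. p) (the (ratexp_eval n A (Pol p)))"
    unfolding transfer_at_def
  proof
    fix v :: "'k cvec" assume "v \<in> vecs n"
    then show "\<exists>\<xi>. (\<forall>j<1::nat. \<xi> j \<in> vecs n) \<and> (\<forall>i<1. (\<Sum>j<1. act n A 1 (\<xi> j)) = act n A p v) \<and>
        (\<Sum>j<1. act n A 1 (\<xi> j)) = mact n (the (ratexp_eval n A (Pol p))) v"
      by (intro exI[of _ "\<lambda>_. act n A p v"]) (simp add: sum_lessThan_1 act_def[of n A p])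
  qed
qed

lemma represents_Add:
  fixes a :: "('x, 'k::field) ratexp"
  assumes "represents N c L d a" "represents N' c' L' d' b"
  shows "represents (N + N') (block_vec N c c') (block_mat N L (\<lambda>_ _. 0) (\<lambda>_ _. 0) L') (block_vec N d d') (Add a b)"
  unfolding represents_def
proof (intro ballI, clarify, intro conjI)
  fix n A assume "(n, A) \<in> ratexp_dom (Add a b)"
  then have dom: "(n, A) \<in> ratexp_dom a" "(n, A) \<in> ratexp_dom b" by (auto simp: ratexp_dom_Add)
  then obtain M M' where M: "ratexp_eval n A a = Some M" "ratexp_eval n A b = Some M'"
    by (auto simp: ratexp_dom_def)
  note carr = ratexp_eval_carrier[OF M(1)] ratexp_eval_carrier[OF M(2)]
  have a: "nonsingular_at n A N L" "transfer_at n A N c L d M"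
    and b: "nonsingular_at n A N' L'" "transfer_at n A N' c' L' d' M'"
    using assms dom M by (auto simp: represents_def)
  show "nonsingular_at n A (N + N') (block_mat N L (\<lambda>_ _. 0) (\<lambda>_ _. 0) L')"
    by (rule nonsingular_at_block[OF a(1) b(1)])
  show "transfer_at n A (N + N') (block_vec N c c') (block_mat N L (\<lambda>_ _. 0) (\<lambda>_ _. 0) L') (block_vec N d d')
      (the (ratexp_eval n A (Add a b)))"
  proof (rule transfer_at_intro, goal_cases)
    case (1 v)
    note v = this
    obtain \<xi> where \<xi>: "\<And>j. j < N \<Longrightarrow> \<xi> j \<in> vecs n"
      "\<And>i. i < N \<Longrightarrow> (\<Sum>j<N. act n A (L i j) (\<xi> j)) = act n A (d i) v"
      "(\<Sum>j<N. act n A (c j) (\<xi> j)) = mact n M v" using transfer_atE[OF a(2) v] by blast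
    obtain \<eta> where \<eta>: "\<And>j. j < N' \<Longrightarrow> \<eta> j \<in> vecs n"
      "\<And>i. i < N' \<Longrightarrow> (\<Sum>j<N'. act n A (L' i j) (\<eta> j)) = act n A (d' i) v"
      "(\<Sum>j<N'. act n A (c' j) (\<eta> j)) = mact n M' v" using transfer_atE[OF b(2) v] by blast
    show ?case
      by (intro exI[of _ \<xi>] exI[of _ \<eta>]) (simp add: \<xi> \<eta> M mact_add_left[OF carr])
  qed
qed

text \<open>
  The output of the second system is the input of the first.
\<close>

lemma represents_Mul:
  fixes a :: "('x, 'k::field) ratexp"
  assumes "represents N c L d a" "represents N' c' L' d' b"
  shows "represents (N + N') (block_vec N c (\<lambda>_. 0)) (block_mat N L (\<lambda>i j. - (d i * c' j)) (\<lambda>_ _. 0) L')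
    (block_vec N (\<lambda>_. 0) d') (Mul a b)"
  unfolding represents_def
proof (intro ballI, clarify, intro conjI)
  fix n A assume "(n, A) \<in> ratexp_dom (Mul a b)"
  then have dom: "(n, A) \<in> ratexp_dom a" "(n, A) \<in> ratexp_dom b" by (auto simp: ratexp_dom_Mul)
  then obtain M M' where M: "ratexp_eval n A a = Some M" "ratexp_eval n A b = Some M'" and tup: "mat_tuple n A"
    by (auto simp: ratexp_dom_def)
  note carr = ratexp_eval_carrier[OF M(1)] ratexp_eval_carrier[OF M(2)]
  have a: "nonsingular_at n A N L" "transfer_at n A N c L d M"
    and b: "nonsingular_at n A N' L'" "transfer_at n A N' c' L' d' M'"
    using assms dom M by (auto simp: represents_def)
  show "nonsingular_at n A (N + N') (block_mat N L (\<lambda>i j. - (d i * c' j)) (\<lambda>_ _. 0) L')"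
    by (rule nonsingular_at_block[OF a(1) b(1)])
  show "transfer_at n A (N + N') (block_vec N c (\<lambda>_. 0)) (block_mat N L (\<lambda>i j. - (d i * c' j)) (\<lambda>_ _. 0) L')
      (block_vec N (\<lambda>_. 0) d') (the (ratexp_eval n A (Mul a b)))"
  proof (rule transfer_at_intro, goal_cases)
    case (1 v)
    note v = this
    obtain \<eta> where \<eta>: "\<And>j. j < N' \<Longrightarrow> \<eta> j \<in> vecs n"
      "\<And>i. i < N' \<Longrightarrow> (\<Sum>j<N'. act n A (L' i j) (\<eta> j)) = act n A (d' i) v"
      "(\<Sum>j<N'. act n A (c' j) (\<eta> j)) = mact n M' v" using transfer_atE[OF b(2) v] by blast
    obtain \<xi> where \<xi>: "\<And>j. j < N \<Longrightarrow> \<xi> j \<in> vecs n"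
      "\<And>i. i < N \<Longrightarrow> (\<Sum>j<N. act n A (L i j) (\<xi> j)) = act n A (d i) (mact n M' v)"
      "(\<Sum>j<N. act n A (c j) (\<xi> j)) = mact n M (mact n M' v)"
      using transfer_atE[OF a(2), of "mact n M' v"] by auto
    have "(\<Sum>j<N'. act n A (- (d i * c' j)) (\<eta> j)) = - act n A (d i) (mact n M' v)" for i
      unfolding \<eta>(3)[symmetric] act_sum_right
      by (simp add: act_uminus_left act_mult_left[OF tup] sum_negf)
    then show ?case
      by (intro exI[of _ \<xi>] exI[of _ \<eta>]) (simp add: \<xi> \<eta>(1,2) M mact_mult_left[OF carr])
  qed
qed

text \<open>
  The additional unknown is the input for which the given system has the prescribed output.
\<close>

lemma represents_Inv:
  fixes a :: "('x, 'k::field) ratexp"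
  assumes "represents N c L d a"
  shows "represents (N + 1) (block_vec N (\<lambda>_. 0) (\<lambda>_. 1)) (block_mat N L (\<lambda>i _. d i) (\<lambda>_ j. - c j) (\<lambda>_ _. 0))
    (block_vec N (\<lambda>_. 0) (\<lambda>_. 1)) (Inv a)"
  unfolding represents_def
proof (intro ballI, clarify, intro conjI)
  fix n A assume dom: "(n, A) \<in> ratexp_dom (Inv a)"
  then obtain M M' where M: "ratexp_eval n A a = Some M" "mat_inverse M = Some M'" and tup: "mat_tuple n A"
    by (auto simp: ratexp_dom_def split: option.splits)
  have carr: "M \<in> carrier_mat n n" using M(1) by (rule ratexp_eval_carrier)
  from mat_inverse(2)[OF carr M(2)] have M': "M * M' = 1\<^sub>m n" "M' * M = 1\<^sub>m n" "M' \<in> carrier_mat n n" by auto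
  have inv: "mact n M (mact n M' v) = v" "mact n M' (mact n M v) = v" if "v \<in> vecs n" for v
    using that M' carr by (simp_all add: mact_mult_left[symmetric])
  have "(n, A) \<in> ratexp_dom a" using tup M by (simp add: ratexp_dom_def)
  then have a: "nonsingular_at n A N L" "transfer_at n A N c L d M"
    using assms M by (auto simp: represents_def)
  show "nonsingular_at n A (N + 1) (block_mat N L (\<lambda>i _. d i) (\<lambda>_ j. - c j) (\<lambda>_ _. 0))"
    unfolding nonsingular_at_def
  proof (intro allI impI)
    fix \<xi> j
    assume \<xi>: "\<forall>j<N + 1. \<xi> j \<in> vecs n" and j: "j < N + 1"
      and rows: "\<forall>i<N + 1. (\<Sum>j<N + 1. act n A (block_mat N L (\<lambda>i _. d i) (\<lambda>_ j. - c j) (\<lambda>_ _. 0) i j) (\<xi> j)) = 0"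
    have \<xi>': "\<xi> j \<in> vecs n" if "j < N" for j using \<xi> that by simp
    have \<xi>N: "\<xi> N \<in> vecs n" using \<xi> by simp
    have row1: "(\<Sum>j<N. act n A (L i j) (\<xi> j)) + act n A (d i) (\<xi> N) = 0" if "i < N" for i
      using rows[rule_format, of i] that unfolding block_mat_simps(1)[OF that] block_vec_act by simp
    have row2: "(\<Sum>j<N. act n A (- c j) (\<xi> j)) = 0"
      using rows[rule_format, of "N + 0"] unfolding block_mat_simps(2) block_vec_act by simp
    obtain \<eta> where \<eta>: "\<And>j. j < N \<Longrightarrow> \<eta> j \<in> vecs n"
      "\<And>i. i < N \<Longrightarrow> (\<Sum>j<N. act n A (L i j) (\<eta> j)) = act n A (d i) (\<xi> N)"
      "(\<Sum>j<N. act n A (c j) (\<eta> j)) = mact n M (\<xi> N)" using transfer_atE[OF a(2) \<xi>N] by blast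
    have z: "\<xi> j + \<eta> j = 0" if "j < N" for j
    proof (rule nonsingular_atD[OF a(1), of "\<lambda>j. \<xi> j + \<eta> j"])
      show "(\<Sum>j<N. act n A (L i j) (\<xi> j + \<eta> j)) = 0" if "i < N" for i
        using row1[OF that] \<eta>(2)[OF that] by (simp add: act_add_right sum.distrib)
    qed (use that \<xi>' \<eta> in auto)
    have "(\<Sum>j<N. act n A (c j) (\<eta> j)) = (\<Sum>j<N. act n A (- c j) (\<xi> j))"
    proof (rule sum.cong)
      fix j assume "j \<in> {..<N}"
      then have "\<eta> j = - \<xi> j" using z[of j] by (simp add: eq_neg_iff_add_eq_0 add.commute)
      then show "act n A (c j) (\<eta> j) = act n A (- c j) (\<xi> j)"
        by (simp add: act_uminus_right act_uminus_left)
    qed simp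
    then have "mact n M (\<xi> N) = 0" using row2 \<eta>(3) by simp
    then have "\<xi> N = 0" using inv(2)[OF \<xi>N] by simp
    moreover have "\<xi> j = 0" if "j < N" for j
      by (rule nonsingular_atD[OF a(1), of \<xi>]) (use \<xi>' row1 calculation that in auto)
    ultimately show "\<xi> j = 0" using j by (cases "j < N") (auto simp: less_Suc_eq)
  qed
  show "transfer_at n A (N + 1) (block_vec N (\<lambda>_. 0) (\<lambda>_. 1)) (block_mat N L (\<lambda>i _. d i) (\<lambda>_ j. - c j) (\<lambda>_ _. 0))
    (block_vec N (\<lambda>_. 0) (\<lambda>_. 1)) (the (ratexp_eval n A (Inv a)))"
  proof (rule transfer_at_intro, goal_cases)
    case (1 v)
    note v = this
    define \<tau> where "\<tau> = mact n M' v"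
    have \<tau>: "\<tau> \<in> vecs n" by (simp add: \<tau>_def)
    obtain \<eta> where \<eta>: "\<And>j. j < N \<Longrightarrow> \<eta> j \<in> vecs n"
      "\<And>i. i < N \<Longrightarrow> (\<Sum>j<N. act n A (L i j) (\<eta> j)) = act n A (d i) \<tau>"
      "(\<Sum>j<N. act n A (c j) (\<eta> j)) = mact n M \<tau>" using transfer_atE[OF a(2) \<tau>] by blast
    have M\<tau>: "mact n M \<tau> = v" using inv(1)[OF v] by (simp add: \<tau>_def)
    show ?case
      by (intro exI[of _ "\<lambda>j. - \<eta> j"] exI[of _ "\<lambda>_. \<tau>"])
        (use \<eta> \<tau> v M in \<open>simp add: act_uminus_right act_uminus_left sum_negf M\<tau> \<tau>_def[symmetric] sum_lessThan_1\<close>)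
  qed
qed

lemma represents_exists: "\<exists>N c L d. represents N c L d e"
proof (induction e)
  case (Pol p)
  show ?case using represents_Pol by blast
next
  case (Add a b)
  then show ?case using represents_Add by blast
next
  case (Mul a b)
  then show ?case using represents_Mul by blast
next
  case (Inv a)
  then show ?case using represents_Inv by blast
qed

text \<open>
  Modulo \<open>I\<close> the indices in \<open>K\<close> and the others do not interact, the input reaches only the indices
  outside \<open>K\<close>, and the output reads only those in \<open>K\<close>. Such a system computes \<open>0\<close> for a reason that
  is visible modulo \<open>I\<close>, while over the free skew field it may compute any element of the ideal
  generated by \<open>I\<close>.
\<close>

definition null_system ::
  "('x, 'k::field) ncpoly set \<Rightarrow> nat set \<Rightarrow> nat \<Rightarrow> (nat \<Rightarrow> ('x, 'k) ncpoly) \<Rightarrow>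
    (nat \<Rightarrow> nat \<Rightarrow> ('x, 'k) ncpoly) \<Rightarrow> (nat \<Rightarrow> ('x, 'k) ncpoly) \<Rightarrow> bool" where
  "null_system I K N c L d \<longleftrightarrow> (\<forall>i<N. \<forall>j<N. (i \<in> K) \<noteq> (j \<in> K) \<longrightarrow> L i j \<in> I) \<and>
     (\<forall>i<N. i \<in> K \<longrightarrow> d i \<in> I) \<and> (\<forall>j<N. j \<notin> K \<longrightarrow> c j \<in> I)"

definition null_represented :: "('x, 'k::field) ncpoly set \<Rightarrow> ('x, 'k) ratexp \<Rightarrow> bool" where
  "null_represented I e \<longleftrightarrow> (\<exists>K N c L d. represents N c L d e \<and> null_system I K N c L d)"

lemma null_represented_Pol:
  assumes "h \<in> I"
  shows "null_represented I (Pol h)"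
  unfolding null_represented_def
  by (intro exI[of _ UNIV] exI conjI, rule represents_Pol) (simp add: null_system_def assms)

lemma null_represented_Add:
  assumes I: "two_sided_ideal I" and "null_represented I a" "null_represented I b"
  shows "null_represented I (Add a b)"
proof -
  interpret two_sided_ideal I by (rule I)
  from assms obtain K N c L d K' N' c' L' d' where
    a: "represents N c L d a" "null_system I K N c L d" and
    b: "represents N' c' L' d' b" "null_system I K' N' c' L' d'" unfolding null_represented_def by blast
  have "null_system I {i. if i < N then i \<in> K else i - N \<in> K'} (N + N') (block_vec N c c')
      (block_mat N L (\<lambda>_ _. 0) (\<lambda>_ _. 0) L') (block_vec N d d')"
    unfolding null_system_def all_less_plus_iff
    using a(2) b(2) zero_mem by (auto simp: null_system_def block_mat_simps)
  then show ?thesis using represents_Add[OF a(1) b(1)] unfolding null_represented_def by blast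
qed

lemma null_represented_Mul_right:
  assumes I: "two_sided_ideal I" and "null_represented I b"
  shows "null_represented I (Mul a b)"
proof -
  interpret two_sided_ideal I by (rule I)
  obtain N c L d where a: "represents N c L d a" using represents_exists by blast
  from assms obtain K' N' c' L' d' where
    b: "represents N' c' L' d' b" "null_system I K' N' c' L' d'" unfolding null_represented_def by blast
  have "null_system I {i. i < N \<or> i - N \<in> K'} (N + N') (block_vec N c (\<lambda>_. 0))
      (block_mat N L (\<lambda>i j. - (d i * c' j)) (\<lambda>_ _. 0) L') (block_vec N (\<lambda>_. 0) d')"
    unfolding null_system_def all_less_plus_iff
    using b(2) zero_mem mult_left_mem uminus_mem by (auto simp: null_system_def block_mat_simps)
  then show ?thesis using represents_Mul[OF a(1) b(1)] unfolding null_represented_def by blast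
qed

lemma null_represented_Mul_left:
  assumes I: "two_sided_ideal I" and "null_represented I a"
  shows "null_represented I (Mul a b)"
proof -
  interpret two_sided_ideal I by (rule I)
  obtain N' c' L' d' where b: "represents N' c' L' d' b" using represents_exists by blast
  from assms obtain K N c L d where
    a: "represents N c L d a" "null_system I K N c L d" unfolding null_represented_def by blast
  have "null_system I {i. i < N \<and> i \<in> K} (N + N') (block_vec N c (\<lambda>_. 0))
      (block_mat N L (\<lambda>i j. - (d i * c' j)) (\<lambda>_ _. 0) L') (block_vec N (\<lambda>_. 0) d')"
    unfolding null_system_def all_less_plus_iff
    using a(2) zero_mem mult_right_mem uminus_mem by (auto simp: null_system_def block_mat_simps)
  then show ?thesis using represents_Mul[OF a(1) b(1)] unfolding null_represented_def by blast
qed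

text \<open>
  The matrix \<open>M\<close> with rows \<open>(L, d)\<close> and \<open>(c, f)\<close> is singular on the domain of \<open>e\<close>, hence of rank at most
  \<open>N\<close> modulo \<open>I\<close>. There the indices in \<open>K\<close> and those outside \<open>K\<close> give full blocks, because \<open>L\<close> is
  invertible at a zero of \<open>I\<close>. Splitting them off leaves \<open>f\<close> with rank \<open>0\<close>.
\<close>

lemma null_represented_polynomial_mem:
  fixes I :: "('x::finite, 'k::field_char_0) ncpoly set"
  assumes I: "sylvester_ideal I" and e: "null_represented I e"
    and dom: "ratexp_dom e \<inter> vanishing_set I \<noteq> {}"
    and eq: "\<And>n A. (n, A) \<in> ratexp_dom e \<Longrightarrow> ratexp_eval n A e = Some (ncpoly_eval n A f)"
  shows "f \<in> I"
proof -
  interpret sylvester_ideal I by (rule I)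
  from e obtain K N c L d where rep: "represents N c L d e" and null: "null_system I K N c L d"
    unfolding null_represented_def by blast
  \<comment> \<open>The bordered matrix; its last row and column have index \<open>N\<close>.\<close>
  define M where "M = block_mat N L (\<lambda>i _. d i) (\<lambda>_ j. c j) (\<lambda>_ _. f)"
  have M: "i < N \<Longrightarrow> j < N \<Longrightarrow> M i j = L i j" "i < N \<Longrightarrow> M i N = d i" "j < N \<Longrightarrow> M N j = c j" "M N N = f" for i j
    by (simp_all add: M_def block_mat_def block_vec_def)
  have corank: "corank_one_at n A {..<Suc N} N M" if D: "(n, A) \<in> ratexp_dom e" for n A
    unfolding corank_one_at_def
  proof (intro allI impI)
    fix \<xi> assume \<xi>: "\<forall>j\<in>{..<Suc N}. \<xi> j \<in> vecs n"
      and rows: "\<forall>i\<in>{..<Suc N} - {N}. (\<Sum>j<Suc N. act n A (M i j) (\<xi> j)) = 0"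
    have a: "nonsingular_at n A N L" "transfer_at n A N c L d (ncpoly_eval n A f)"
      using rep D eq[OF D] by (auto simp: represents_def)
    have \<xi>': "\<xi> j \<in> vecs n" if "j < N" for j using \<xi> that by simp
    have \<xi>N: "\<xi> N \<in> vecs n" using \<xi> by simp
    have row: "(\<Sum>j<N. act n A (L i j) (\<xi> j)) + act n A (d i) (\<xi> N) = 0" if "i < N" for i
      using rows[rule_format, of i] that by (simp add: M)
    obtain \<eta> where \<eta>: "\<And>j. j < N \<Longrightarrow> \<eta> j \<in> vecs n"
      "\<And>i. i < N \<Longrightarrow> (\<Sum>j<N. act n A (L i j) (\<eta> j)) = act n A (d i) (\<xi> N)"
      "(\<Sum>j<N. act n A (c j) (\<eta> j)) = mact n (ncpoly_eval n A f) (\<xi> N)"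
      using transfer_atE[OF a(2) \<xi>N] by blast
    have z: "\<xi> j + \<eta> j = 0" if "j < N" for j
    proof (rule nonsingular_atD[OF a(1), of "\<lambda>j. \<xi> j + \<eta> j"])
      show "(\<Sum>j<N. act n A (L i j) (\<xi> j + \<eta> j)) = 0" if "i < N" for i
        using row[OF that] \<eta>(2)[OF that] by (simp add: act_add_right sum.distrib)
    qed (use that \<xi>' \<eta> in auto)
    have "(\<Sum>j<N. act n A (c j) (\<xi> j)) + (\<Sum>j<N. act n A (c j) (\<eta> j)) = 0"
      unfolding sum.distrib[symmetric] act_add_right[symmetric] by (simp add: z)
    then have "(\<Sum>j<Suc N. act n A (M N j) (\<xi> j)) = 0"
      by (simp add: M \<eta>(3) act_def[of n A f])
    moreover have "\<xi> j = 0" if "\<xi> N = 0" "j \<in> {..<Suc N}" for j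
    proof (cases "j < N")
      case True
      show ?thesis
        by (rule nonsingular_atD[OF a(1), of \<xi>]) (use \<xi>' row that True in auto)
    next
      case False
      then show ?thesis using that by (simp add: less_Suc_eq)
    qed
    ultimately show "(\<Sum>j<Suc N. act n A (M N j) (\<xi> j)) = 0 \<and> (\<xi> N = 0 \<longrightarrow> (\<forall>j\<in>{..<Suc N}. \<xi> j = 0))"
      by blast
  qed
  obtain g where g: "\<And>i j. i < Suc N \<Longrightarrow> j < Suc N \<Longrightarrow> word_len_le (Suc g) (M i j)"
  proof -
    have "\<forall>i j. \<exists>g. word_len_le g (M i j)" using word_len_le_exists by blast
    then obtain G where G: "\<And>i j. word_len_le (G i j) (M i j)" by metis
    define g where "g = (\<Sum>i<Suc N. \<Sum>j<Suc N. G i j)"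
    have "G i j \<le> g" if ij: "i < Suc N" "j < Suc N" for i j
    proof -
      have "G i j \<le> (\<Sum>j<Suc N. G i j)" using ij by (intro member_le_sum) auto
      also have "\<dots> \<le> g" unfolding g_def using ij
        by (intro member_le_sum[of i _ "\<lambda>i. \<Sum>j<Suc N. G i j"]) auto
      finally show ?thesis .
    qed
    then have "word_len_le (Suc g) (M i j)" if "i < Suc N" "j < Suc N" for i j
      using that G word_len_le_mono by (meson le_SucI)
    then show thesis using that by blast
  qed
  obtain n A where D: "(n, A) \<in> ratexp_dom e" and A: "(n, A) \<in> vanishing_set I" using dom by auto
  have "rank_le_mod I {..<Suc N} {..<Suc N} M (Suc N - 1)"
    by (rule corank_one_rank[OF I _ _ _ corank g]) (use A D in auto)
  then have rank: "rank_le_mod I {..<Suc N} {..<Suc N} M N" by simp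
  have nonsing: "nonsingular_at n A N L" using rep D by (auto simp: represents_def)
  have full: "card S \<le> t" if S: "S \<subseteq> {..<N}" and
    cross: "\<And>i j. i < N \<Longrightarrow> i \<notin> S \<Longrightarrow> j \<in> S \<Longrightarrow> L i j \<in> I" and r: "rank_le_mod I S S M t" for S t
  proof (rule card_le_rank_mod[OF r _ A])
    show finS: "finite S" using S finite_subset by blast
    fix \<xi> assume \<xi>: "\<And>j. j \<in> S \<Longrightarrow> \<xi> j \<in> vecs n"
      and rows: "\<And>i. i \<in> S \<Longrightarrow> (\<Sum>j\<in>S. act n A (M i j) (\<xi> j)) = 0"
    define \<eta> where "\<eta> j = (if j \<in> S then \<xi> j else 0)" for j
    have sum: "(\<Sum>j<N. act n A (L i j) (\<eta> j)) = (\<Sum>j\<in>S. act n A (L i j) (\<xi> j))" for i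
    proof -
      have "(\<Sum>j<N. act n A (L i j) (\<eta> j)) = (\<Sum>j\<in>S. act n A (L i j) (\<eta> j))"
        using S by (intro sum.mono_neutral_right) (auto simp: \<eta>_def)
      then show ?thesis by (simp add: \<eta>_def)
    qed
    have \<eta>0: "\<eta> j = 0" if "j < N" for j
    proof (rule nonsingular_atD[OF nonsing _ _ that])
      show "\<eta> j \<in> vecs n" for j using \<xi> by (simp add: \<eta>_def)
      fix i assume i: "i < N"
      show "(\<Sum>j<N. act n A (L i j) (\<eta> j)) = 0"
      proof (cases "i \<in> S")
        case True
        have "(\<Sum>j\<in>S. act n A (L i j) (\<xi> j)) = (\<Sum>j\<in>S. act n A (M i j) (\<xi> j))"
          using i S by (intro sum.cong) (auto simp: M)
        then show ?thesis using rows[OF True] by (simp add: sum)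
      next
        case False
        then show ?thesis
          unfolding sum using cross[OF i False] by (intro sum.neutral) (auto intro: vanishing_act[OF A])
      qed
    qed
    show "\<forall>j\<in>S. \<xi> j = 0"
    proof
      fix j assume j: "j \<in> S"
      then have "\<eta> j = 0" using S by (intro \<eta>0) auto
      then show "\<xi> j = 0" using j by (simp add: \<eta>_def)
    qed
  qed
  define S1 where "S1 = {i. i < N \<and> i \<in> K}"
  define S2 where "S2 = {i. i < N \<and> i \<notin> K}"
  have S12: "{..<N} = S1 \<union> S2" "S1 \<inter> S2 = {}" "finite S1" "finite S2" by (auto simp: S1_def S2_def)
  then have card: "N = card S1 + card S2" by (metis card_Un_disjoint card_lessThan)
  note nulls = null[unfolded null_system_def]
  obtain p q where pq: "p + q \<le> N" "rank_le_mod I S1 {..<Suc N} M p"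
      "rank_le_mod I {..<Suc N} (insert N S2) M q"
  proof (rule zero_block_rank[OF rank, of S1 "insert N S2"])
    show "M i j \<in> I" if "i \<in> S1" "j \<in> insert N S2" for i j
      using that nulls by (auto simp: S1_def S2_def M)
  qed (auto simp: S1_def S2_def)
  have "card S1 \<le> p"
    by (rule full[OF _ _ rank_le_mod_mono[OF pq(2)]]) (use nulls in \<open>auto simp: S1_def\<close>)
  have r2: "rank_le_mod I (insert N S2) (insert N S2) M q"
    by (rule rank_le_mod_mono[OF pq(3)]) (auto simp: S2_def)
  obtain p' q' where pq': "p' + q' \<le> q" "rank_le_mod I {N} (insert N S2) M p'"
      "rank_le_mod I (insert N S2) S2 M q'"
  proof (rule zero_block_rank[OF r2, of "{N}" S2])
    show "M i j \<in> I" if "i \<in> {N}" "j \<in> S2" for i j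
      using that nulls by (auto simp: S2_def M)
  qed (auto simp: S2_def)
  have "card S2 \<le> q'"
    by (rule full[OF _ _ rank_le_mod_mono[OF pq'(3)]]) (use nulls in \<open>auto simp: S2_def\<close>)
  then have "p' = 0" using pq(1) pq'(1) card \<open>card S1 \<le> p\<close> by linarith
  then have "M N N \<in> I" using pq'(2) by (simp add: rank_le_mod_zero)
  then show ?thesis by (simp add: M)
qed


section \<open>Rational functions on the resolving variables\<close>

lemma ncpoly_eval_over:
  assumes f: "f \<in> ncpolys_over V" and AB: "\<And>x. x \<in> V \<Longrightarrow> A x = B x"
  shows "ncpoly_eval n A f = ncpoly_eval n B f"
proof -
  have "ncmono_eval n A w = ncmono_eval n B w" if "w \<in> Poly_Mapping.keys f" for w
  proof -
    have "set (letters w) \<subseteq> V" using f that by (auto simp: ncpolys_over_def)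
    then show ?thesis unfolding ncmono_eval_def using AB by (intro foldr_cong) auto
  qed
  then show ?thesis unfolding ncpoly_eval_def by simp
qed

lemma ratexp_eval_over:
  "ratexp_over V e \<Longrightarrow> (\<And>x. x \<in> V \<Longrightarrow> A x = B x) \<Longrightarrow> ratexp_eval n A e = ratexp_eval n B e"
  by (induction e) (auto simp: ncpoly_eval_over[of _ V A B])

text \<open>
  Expressions for the elements of the resolution ring. Whether they are defined at a point depends
  only on the coordinates in \<open>V\<close>, so they can be evaluated on the graph of \<open>r\<close>.
\<close>

primrec inv_over :: "'x set \<Rightarrow> ('x, 'k::zero) ratexp \<Rightarrow> bool" where
  "inv_over V (Pol f) \<longleftrightarrow> True"
| "inv_over V (Add a b) \<longleftrightarrow> inv_over V a \<and> inv_over V b"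
| "inv_over V (Mul a b) \<longleftrightarrow> inv_over V a \<and> inv_over V b"
| "inv_over V (Inv a) \<longleftrightarrow> ratexp_over V a"

lemma ratexp_over_imp_inv_over: "ratexp_over V e \<Longrightarrow> inv_over V e"
  by (induction e) auto

lemma inv_over_defined:
  "inv_over V e \<Longrightarrow> (\<And>x. x \<in> V \<Longrightarrow> A x = B x) \<Longrightarrow> ratexp_eval n A e = None \<longleftrightarrow> ratexp_eval n B e = None"
  by (induction e) (auto simp: ratexp_eval_over[of V _ A B] split: option.splits)

lemma ratfun_of_eq_iff:
  assumes "ratexp_dom a \<noteq> {}" "ratexp_dom b \<noteq> {}"
  shows "ratfun_of a = ratfun_of b \<longleftrightarrow> ratexp_equiv a b"
  using Quotient3_rel[OF Quotient3_ratfun, of a b] assms by (simp add: ratexp_equiv_refl)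

lemma ratfun_of_Add:
  assumes "ratexp_dom a \<noteq> {}" "ratexp_dom b \<noteq> {}"
  shows "ratfun_of (Add a b) = ratfun_of a + ratfun_of b"
  using assms by (simp add: plus_ratfun.abs_eq ratexp_equiv_refl)

lemma ratfun_of_Mul:
  assumes "ratexp_dom a \<noteq> {}" "ratexp_dom b \<noteq> {}"
  shows "ratfun_of (Mul a b) = ratfun_of a * ratfun_of b"
  using assms by (simp add: times_ratfun.abs_eq ratexp_equiv_refl)

lemma ratfun_of_uminus:
  assumes "ratexp_dom a \<noteq> {}"
  shows "ratfun_of (Mul (Pol (Poly_Mapping.single 0 (- 1))) a) = - ratfun_of a"
  using assms by (simp add: uminus_ratfun.abs_eq ratexp_equiv_refl)

lemma ratfun_of_0: "ratfun_of (Pol 0) = 0"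
  by (simp add: zero_ratfun_def)

lemma ratexp_dom_Add_nonempty:
  "ratexp_dom a \<noteq> {} \<Longrightarrow> ratexp_dom b \<noteq> {} \<Longrightarrow> ratexp_dom (Add a b) \<noteq> {}"
  for a b :: "('x, 'k::field_char_0) ratexp"
  by (simp add: ratexp_dom_Add ratexp_common_point)

lemma ratexp_dom_Mul_nonempty:
  "ratexp_dom a \<noteq> {} \<Longrightarrow> ratexp_dom b \<noteq> {} \<Longrightarrow> ratexp_dom (Mul a b) \<noteq> {}"
  for a b :: "('x, 'k::field_char_0) ratexp"
  by (simp add: ratexp_dom_Mul ratexp_common_point)

lemma ratfun_of_ncpoly_hom:
  "ratfun_of_ncpoly (f + g) = ratfun_of_ncpoly f + ratfun_of_ncpoly g"
  "ratfun_of_ncpoly (f * g) = ratfun_of_ncpoly f * ratfun_of_ncpoly g"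
proof -
  have "ratexp_equiv (Pol (f + g)) (Add (Pol f) (Pol g))"
    by (rule ratexp_equivI) (simp_all add: ratexp_dom_Pol ratexp_dom_Add_nonempty ncpoly_eval_add)
  moreover have "ratexp_equiv (Pol (f * g)) (Mul (Pol f) (Pol g))"
    by (rule ratexp_equivI)
      (simp_all add: ratexp_dom_Pol ratexp_dom_Mul_nonempty ncpoly_eval_mult mat_tuple_def)
  ultimately show "ratfun_of_ncpoly (f + g) = ratfun_of_ncpoly f + ratfun_of_ncpoly g"
    "ratfun_of_ncpoly (f * g) = ratfun_of_ncpoly f * ratfun_of_ncpoly g"
    unfolding ratfun_of_ncpoly_def
    by (simp_all add: ratfun_of_Add[symmetric] ratfun_of_Mul[symmetric] ratfun_of_eq_iff
        ratexp_dom_Pol ratexp_dom_Add_nonempty ratexp_dom_Mul_nonempty)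
qed

text \<open>
  The expressions \<open>re\<close> represent the components of \<open>r\<close>, and \<open>dom_exp\<close> is only defined where all of them
  are.
\<close>

locale resolution =
  fixes V :: "'x::finite set" and r :: "'x \<Rightarrow> ('x, 'k::field_char_0) ratfun"
    and re :: "'x \<Rightarrow> ('x, 'k) ratexp" and dom_exp :: "('x, 'k) ratexp"
  assumes re_over: "j \<notin> V \<Longrightarrow> ratexp_over V (re j)"
    and re_dom: "j \<notin> V \<Longrightarrow> ratexp_dom (re j) \<noteq> {}"
    and re_r: "j \<notin> V \<Longrightarrow> ratfun_of (re j) = r j"
    and dom_exp_over: "ratexp_over V dom_exp"
    and dom_exp_dom: "ratexp_dom dom_exp \<noteq> {}"
    and dom_exp_re: "j \<notin> V \<Longrightarrow> ratexp_dom dom_exp \<subseteq> ratexp_dom (re j)"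
begin

abbreviation "R \<equiv> resolution_ring V r"

definition graph_point :: "nat \<Rightarrow> ('x \<Rightarrow> 'k mat) \<Rightarrow> 'x \<Rightarrow> 'k mat" where
  "graph_point n A x = (if x \<in> V then A x else the (ratexp_eval n A (re x)))"

lemma graph_point_V: "x \<in> V \<Longrightarrow> graph_point n A x = A x"
  by (simp add: graph_point_def)

lemma re_defined:
  assumes "(n, A) \<in> ratexp_dom dom_exp" "j \<notin> V"
  shows "ratexp_eval n A (re j) = Some (graph_point n A j)"
  using assms dom_exp_re[OF assms(2)] by (auto simp: graph_point_def ratexp_dom_def)

lemma graph_point_tuple:
  assumes "(n, A) \<in> ratexp_dom dom_exp"
  shows "mat_tuple n (graph_point n A)"
proof -
  have tup: "mat_tuple n A" using assms by (simp add: ratexp_dom_def)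
  moreover have "graph_point n A x \<in> carrier_mat n n" for x
  proof (cases "x \<in> V")
    case True
    then show ?thesis using mat_tupleD(1)[OF tup] by (simp add: graph_point_V)
  next
    case False
    then show ?thesis using re_defined[OF assms False] by (rule_tac ratexp_eval_carrier)
  qed
  ultimately show ?thesis by (simp add: mat_tuple_def)
qed

lemma graph_point_over: "ratexp_over V e \<Longrightarrow> ratexp_eval n (graph_point n A) e = ratexp_eval n A e"
  by (rule ratexp_eval_over) (auto simp: graph_point_V)

lemma graph_point_dom:
  assumes "inv_over V e" "(n, A) \<in> ratexp_dom e" "(n, A) \<in> ratexp_dom dom_exp"
  shows "(n, graph_point n A) \<in> ratexp_dom e"
  using assms graph_point_tuple[OF assms(3)] inv_over_defined[OF assms(1), of "graph_point n A" A n]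
  by (auto simp: ratexp_dom_def graph_point_V)

lemma r_height:
  assumes "j \<notin> V"
  shows "r j \<in> ratfuns_height_le V (resolution_height V r)"
proof -
  have "ratfun_of (re j) \<in> ratfuns_over V"
    unfolding ratfuns_over_def using re_over[OF assms] re_dom[OF assms]
    by (intro CollectI exI[of _ "re j"]) simp
  moreover have "ratfun_height V (r j) \<le> resolution_height V r"
    unfolding resolution_height_def using assms by (intro Max_ge) auto
  ultimately show ?thesis by (simp add: ratfuns_height_le_def re_r[OF assms])
qed

lemma ring_R: "ring R"
proof -
  interpret rf: ring "ratfun_ring :: ('x, 'k) ratfun ring" by (rule ring_ring_of_type_algebra)
  show ?thesis unfolding resolution_ring_def
    by (rule rf.subring_is_ring, rule rf.generate_ring_is_subring) simp
qed

lemma R_simps [simp]: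
  "x \<oplus>\<^bsub>R\<^esub> y = x + y" "x \<otimes>\<^bsub>R\<^esub> y = x * y" "\<zero>\<^bsub>R\<^esub> = 0" "\<one>\<^bsub>R\<^esub> = 1"
  by (simp_all add: resolution_ring_def)

lemma R_carrier_ncpoly: "ratfun_of_ncpoly f \<in> carrier R"
  unfolding resolution_ring_def by (auto intro: generate_ring.incl)

lemma R_carrier_r: "j \<notin> V \<Longrightarrow> r j \<in> carrier R"
  unfolding resolution_ring_def using r_height[of j] by (auto intro: generate_ring.incl)

lemma R_a_inv:
  assumes "x \<in> carrier R"
  shows "\<ominus>\<^bsub>R\<^esub> x = - x"
proof -
  interpret ring R by (rule ring_R)
  have "\<ominus>\<^bsub>R\<^esub> x + x = 0" using l_neg[OF assms] by simp
  then show ?thesis by (simp add: eq_neg_iff_add_eq_0)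
qed

lemma R_closed:
  assumes "x \<in> carrier R" "y \<in> carrier R"
  shows "x + y \<in> carrier R" "x * y \<in> carrier R" "- x \<in> carrier R" "x - y \<in> carrier R"
proof -
  interpret ring R by (rule ring_R)
  show p: "x + y \<in> carrier R" and "x * y \<in> carrier R" using assms a_closed m_closed by fastforce+
  show "- x \<in> carrier R" using a_inv_closed[OF assms(1)] R_a_inv[OF assms(1)] by simp
  have "- y \<in> carrier R" using a_inv_closed[OF assms(2)] R_a_inv[OF assms(2)] by simp
  then show "x - y \<in> carrier R" using a_closed[OF assms(1), of "- y"] by simp
qed

lemma R_carrier_represented:
  assumes "s \<in> carrier R"
  obtains e where "inv_over V e" "ratexp_dom e \<noteq> {}" "ratfun_of e = s"
proof -
  have "s \<in> generate_ring ratfun_ring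
      (ratfuns_height_le V (resolution_height V r) \<union> range ratfun_of_ncpoly)"
    using assms by (simp add: resolution_ring_def)
  then have "\<exists>e. inv_over V e \<and> ratexp_dom e \<noteq> {} \<and> ratfun_of e = s"
  proof (induction rule: generate_ring.induct)
    case one
    show ?case by (intro exI[of _ "Pol 1"]) (simp add: ratexp_dom_Pol one_ratfun_def)
  next
    case (incl h)
    then show ?case
    proof
      assume "h \<in> ratfuns_height_le V (resolution_height V r)"
      then show ?thesis
        by (auto simp: ratfuns_height_le_def ratfuns_over_def intro: ratexp_over_imp_inv_over)
    next
      assume "h \<in> range ratfun_of_ncpoly"
      then obtain f where "h = ratfun_of (Pol f)" by (auto simp: ratfun_of_ncpoly_def)
      then show ?thesis by (intro exI[of _ "Pol f"]) (simp add: ratexp_dom_Pol)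
    qed
  next
    case (a_inv h)
    then obtain e where e: "inv_over V e" "ratexp_dom e \<noteq> {}" "ratfun_of e = h" by blast
    interpret rf: ring "ratfun_ring :: ('x, 'k) ratfun ring" by (rule ring_ring_of_type_algebra)
    have "\<ominus>\<^bsub>ratfun_ring\<^esub> h + h = 0" using rf.l_neg[of h] by simp
    then have "\<ominus>\<^bsub>ratfun_ring\<^esub> h = - h" by (simp add: eq_neg_iff_add_eq_0)
    then show ?case using e
      by (intro exI[of _ "Mul (Pol (Poly_Mapping.single 0 (- 1))) e"])
        (simp add: ratfun_of_uminus ratexp_dom_Mul_nonempty ratexp_dom_Pol)
  next
    case (eng_add h1 h2)
    then obtain e1 e2 where "inv_over V e1" "ratexp_dom e1 \<noteq> {}" "ratfun_of e1 = h1"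
      "inv_over V e2" "ratexp_dom e2 \<noteq> {}" "ratfun_of e2 = h2" by blast
    then show ?case by (intro exI[of _ "Add e1 e2"]) (simp add: ratfun_of_Add ratexp_dom_Add_nonempty)
  next
    case (eng_mult h1 h2)
    then obtain e1 e2 where "inv_over V e1" "ratexp_dom e1 \<noteq> {}" "ratfun_of e1 = h1"
      "inv_over V e2" "ratexp_dom e2 \<noteq> {}" "ratfun_of e2 = h2" by blast
    then show ?case by (intro exI[of _ "Mul e1 e2"]) (simp add: ratfun_of_Mul ratexp_dom_Mul_nonempty)
  qed
  then show thesis using that by blast
qed

text \<open>
  The elements represented by an expression with property \<open>Q\<close> form an ideal, so membership in a
  generated ideal yields such an expression without any formula for the elements of the ideal.
\<close>

lemma genideal_represented:
  assumes S: "S \<subseteq> carrier R"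
    and gen: "\<And>s. s \<in> S \<Longrightarrow> \<exists>e. inv_over V e \<and> ratexp_dom e \<noteq> {} \<and> ratfun_of e = s \<and> Q e"
    and zero: "Q (Pol 0)" and add: "\<And>a b. Q a \<Longrightarrow> Q b \<Longrightarrow> Q (Add a b)"
    and left: "\<And>a b. inv_over V a \<Longrightarrow> Q b \<Longrightarrow> Q (Mul a b)"
    and right: "\<And>a b. inv_over V b \<Longrightarrow> Q a \<Longrightarrow> Q (Mul a b)"
    and s: "s \<in> genideal R S"
  obtains e where "inv_over V e" "ratexp_dom e \<noteq> {}" "ratfun_of e = s" "Q e"
proof -
  interpret R: ring R by (rule ring_R)
  define J where "J = {s \<in> carrier R. \<exists>e. inv_over V e \<and> ratexp_dom e \<noteq> {} \<and> ratfun_of e = s \<and> Q e}"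
  have J_I: "ratfun_of e \<in> J" if "inv_over V e" "ratexp_dom e \<noteq> {}" "ratfun_of e \<in> carrier R" "Q e" for e
    unfolding J_def using that by blast
  have "ideal J R"
  proof (rule idealI)
    show "ring R" by (rule ring_R)
    show "subgroup J (add_monoid R)"
    proof (rule R.add.subgroupI)
      show "J \<subseteq> carrier R" by (auto simp: J_def)
      have "ratfun_of (Pol 0) \<in> J"
        using R.zero_closed zero by (intro J_I) (simp_all add: ratexp_dom_Pol ratfun_of_0)
      then show "J \<noteq> {}" by blast
    next
      fix a assume "a \<in> J"
      then obtain e where a: "a \<in> carrier R" and e: "inv_over V e" "ratexp_dom e \<noteq> {}" "ratfun_of e = a" "Q e"
        unfolding J_def by blast
      have eq: "ratfun_of (Mul (Pol (Poly_Mapping.single 0 (- 1))) e) = - a"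
        using e by (simp add: ratfun_of_uminus)
      have "ratfun_of (Mul (Pol (Poly_Mapping.single 0 (- 1))) e) \<in> J"
      proof (rule J_I)
        show "ratexp_dom (Mul (Pol (Poly_Mapping.single 0 (- 1))) e) \<noteq> {}"
          by (intro ratexp_dom_Mul_nonempty ratexp_dom_Pol e)
        show "ratfun_of (Mul (Pol (Poly_Mapping.single 0 (- 1))) e) \<in> carrier R"
          unfolding eq by (rule R_closed(3)[OF a a])
        show "Q (Mul (Pol (Poly_Mapping.single 0 (- 1))) e)" by (rule left[OF _ e(4)]) simp
      qed (use e in simp)
      then have "- a \<in> J" unfolding eq .
      then show "\<ominus>\<^bsub>R\<^esub> a \<in> J" by (simp add: R_a_inv[OF a])
    next
      fix a b assume "a \<in> J" "b \<in> J"
      then obtain e e' where ab: "a \<in> carrier R" "b \<in> carrier R"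
        and e: "inv_over V e" "ratexp_dom e \<noteq> {}" "ratfun_of e = a" "Q e"
          "inv_over V e'" "ratexp_dom e' \<noteq> {}" "ratfun_of e' = b" "Q e'"
        unfolding J_def by blast
      have eq: "ratfun_of (Add e e') = a + b" using e by (simp add: ratfun_of_Add)
      have "ratfun_of (Add e e') \<in> J"
      proof (rule J_I)
        show "ratexp_dom (Add e e') \<noteq> {}" by (intro ratexp_dom_Add_nonempty e)
        show "ratfun_of (Add e e') \<in> carrier R" unfolding eq by (rule R_closed(1)[OF ab])
        show "Q (Add e e')" by (rule add[OF e(4,8)])
      qed (use e in simp)
      then show "a \<oplus>\<^bsub>R\<^esub> b \<in> J" unfolding eq by simp
    qed
  next
    fix a x assume "a \<in> J" and x: "x \<in> carrier R"
    then obtain e where a: "a \<in> carrier R" and e: "inv_over V e" "ratexp_dom e \<noteq> {}" "ratfun_of e = a" "Q e"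
      unfolding J_def by blast
    obtain e' where e': "inv_over V e'" "ratexp_dom e' \<noteq> {}" "ratfun_of e' = x"
      using R_carrier_represented[OF x] by blast
    have eq: "ratfun_of (Mul e' e) = x * a" "ratfun_of (Mul e e') = a * x"
      using e e' by (simp_all add: ratfun_of_Mul)
    have "ratfun_of (Mul e' e) \<in> J"
    proof (rule J_I)
      show "ratexp_dom (Mul e' e) \<noteq> {}" by (intro ratexp_dom_Mul_nonempty e e')
      show "ratfun_of (Mul e' e) \<in> carrier R" unfolding eq by (rule R_closed(2)[OF x a])
      show "Q (Mul e' e)" by (rule left[OF e'(1) e(4)])
    qed (use e e' in simp)
    then show "x \<otimes>\<^bsub>R\<^esub> a \<in> J" unfolding eq by simp
    have "ratfun_of (Mul e e') \<in> J"
    proof (rule J_I)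
      show "ratexp_dom (Mul e e') \<noteq> {}" by (intro ratexp_dom_Mul_nonempty e e')
      show "ratfun_of (Mul e e') \<in> carrier R" unfolding eq by (rule R_closed(2)[OF a x])
      show "Q (Mul e e')" by (rule right[OF e'(1) e(4)])
    qed (use e e' in simp)
    then show "a \<otimes>\<^bsub>R\<^esub> x \<in> J" unfolding eq by simp
  qed
  moreover have "S \<subseteq> J" using S gen by (auto simp: J_def)
  ultimately have "genideal R S \<subseteq> J" by (rule R.genideal_minimal)
  then show thesis using s that unfolding J_def by blast
qed

lemma resolution_ideal_generators:
  "{ratfun_of_ncpoly (ncvar j) - r j |j. j \<in> - V} \<subseteq> carrier R"
  using R_closed(4)[OF R_carrier_ncpoly R_carrier_r] by auto

lemma ideal_resolution_ideal: "ideal (resolution_ideal V r) R"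
  unfolding resolution_ideal_def
  by (rule ring.genideal_ideal[OF ring_R resolution_ideal_generators])

lemma ncvar_minus_r_mem: "j \<notin> V \<Longrightarrow> ratfun_of_ncpoly (ncvar j) - r j \<in> resolution_ideal V r"
  unfolding resolution_ideal_def
  using ring.genideal_self[OF ring_R resolution_ideal_generators] by blast

text \<open>
  \<open>e\<close> is \<open>f(X', r(X'))\<close>, with the domain of \<open>dom_exp\<close>.
\<close>

definition substitutes :: "('x, 'k) ratexp \<Rightarrow> ('x, 'k) ncpoly \<Rightarrow> bool" where
  "substitutes e f \<longleftrightarrow> ratexp_over V e \<and> ratexp_dom e = ratexp_dom dom_exp \<and>
     (\<forall>(n, A)\<in>ratexp_dom dom_exp. ratexp_eval n A e = Some (ncpoly_eval n (graph_point n A) f)) \<and>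
     ratfun_of e \<in> carrier R \<and> ratfun_of_ncpoly f - ratfun_of e \<in> resolution_ideal V r"

lemma substitutesD:
  assumes "substitutes e f"
  shows "ratexp_over V e" "ratexp_dom e = ratexp_dom dom_exp"
    "\<And>n A. (n, A) \<in> ratexp_dom dom_exp \<Longrightarrow> ratexp_eval n A e = Some (ncpoly_eval n (graph_point n A) f)"
    "ratfun_of e \<in> carrier R" "ratfun_of_ncpoly f - ratfun_of e \<in> resolution_ideal V r"
  using assms unfolding substitutes_def by blast+

text \<open>
  The summand \<open>0 * dom_exp\<close> serves to give it exactly the domain of
  \<open>dom_exp\<close>. The congruence modulo the resolution ideal is multiplicative because
  \<open>f g - a b = f (g - b) + (f - a) b\<close>.
\<close>

lemma substitution_exists: "\<exists>e. substitutes e f"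
proof -
  interpret R: ring R by (rule ring_R)
  interpret Ir: ideal "resolution_ideal V r" R by (rule ideal_resolution_ideal)
  have Ir0: "0 \<in> resolution_ideal V r"
    using additive_subgroup.zero_closed[OF Ir.is_additive_subgroup] by simp
  have Ir_add: "a + b \<in> resolution_ideal V r" if "a \<in> resolution_ideal V r" "b \<in> resolution_ideal V r" for a b
    using additive_subgroup.a_closed[OF Ir.is_additive_subgroup that] by simp
  have restrict: "ratexp_dom (Add a (Mul (Pol 0) dom_exp)) = ratexp_dom a \<inter> ratexp_dom dom_exp" for a
    by (auto simp: ratexp_dom_Add ratexp_dom_Mul) (auto simp: ratexp_dom_def)
  have ratfun_restrict: "ratfun_of (Add a (Mul (Pol 0) dom_exp)) = ratfun_of a" if "ratexp_dom a \<noteq> {}" for a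
    using that dom_exp_dom
    by (simp add: ratfun_of_Add ratfun_of_Mul ratexp_dom_Mul_nonempty ratexp_dom_Pol ratfun_of_0)
  have eval_restrict: "ratexp_eval n A (Add a (Mul (Pol 0) dom_exp)) = Some M"
    if A: "(n, A) \<in> ratexp_dom dom_exp" and M: "ratexp_eval n A a = Some M" for n A a M
  proof -
    obtain N where N: "ratexp_eval n A dom_exp = Some N" using A by (auto simp: ratexp_dom_def)
    have "M + 0\<^sub>m n n * N = M"
      using ratexp_eval_carrier[OF M] ratexp_eval_carrier[OF N] by simp
    then show ?thesis using M N by (simp add: ncpoly_eval_0)
  qed
  have zero_over: "0 \<in> ncpolys_over V" by (simp add: ncpolys_over_def)
  have poly: "\<exists>e. substitutes e f" if f: "f \<in> ncpolys_over V" for f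
    unfolding substitutes_def
  proof (intro exI[of _ "Add (Pol f) (Mul (Pol 0) dom_exp)"] conjI ballI, goal_cases)
    case 2
    show ?case unfolding restrict by (auto simp: ratexp_dom_def)
  next
    case (3 nA)
    obtain n A where nA: "nA = (n, A)" by (cases nA)
    have "ncpoly_eval n A f = ncpoly_eval n (graph_point n A) f"
      by (rule ncpoly_eval_over[OF f]) (simp add: graph_point_V)
    then have "ratexp_eval n A (Pol f) = Some (ncpoly_eval n (graph_point n A) f)" by simp
    from eval_restrict[OF _ this] show ?case using 3 by (simp only: nA prod.case)
  next
    case 4
    show ?case unfolding ratfun_restrict[OF ratexp_dom_Pol]
      using R_carrier_ncpoly by (simp add: ratfun_of_ncpoly_def)
  next
    case 5
    show ?case unfolding ratfun_restrict[OF ratexp_dom_Pol] using Ir0 by (simp add: ratfun_of_ncpoly_def)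
  qed (use f dom_exp_over zero_over in auto)
  show ?thesis
  proof (induction f rule: ncpoly_induct_algebra)
    case (const c)
    show ?case by (rule poly) (simp add: ncpolys_over_def zero_ncmono_def)
  next
    case (var x)
    show ?case
    proof (cases "x \<in> V")
      case True
      show ?thesis by (rule poly) (simp add: ncpolys_over_def ncvar_def True)
    next
      case False
      show ?thesis unfolding substitutes_def
      proof (intro exI[of _ "Add (re x) (Mul (Pol 0) dom_exp)"] conjI ballI, goal_cases)
        case 2
        show ?case unfolding restrict using dom_exp_re[OF False] by blast
      next
        case (3 nA)
        obtain n A where nA: "nA = (n, A)" by (cases nA)
        have "ncpoly_eval n (graph_point n A) (ncvar x) = graph_point n A x"
          using graph_point_tuple[of n A] 3 by (intro ncpoly_eval_var) (simp add: nA mat_tuple_def)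
        moreover have "ratexp_eval n A (re x) = Some (graph_point n A x)"
          using re_defined[of n A x] 3 False by (simp add: nA)
        ultimately have "ratexp_eval n A (re x) = Some (ncpoly_eval n (graph_point n A) (ncvar x))" by simp
        from eval_restrict[OF _ this] show ?case using 3 by (simp only: nA prod.case)
      next
        case 4
        show ?case unfolding ratfun_restrict[OF re_dom[OF False]] re_r[OF False] by (rule R_carrier_r[OF False])
      next
        case 5
        show ?case unfolding ratfun_restrict[OF re_dom[OF False]] re_r[OF False] by (rule ncvar_minus_r_mem[OF False])
      qed (use dom_exp_over re_over False zero_over in auto)
    qed
  next
    case (add f g)
    then obtain a b where "substitutes a f" "substitutes b g" by blast
    note a = substitutesD[OF this(1)] and b = substitutesD[OF this(2)]
    have ab: "ratfun_of (Add a b) = ratfun_of a + ratfun_of b"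
      using a(2) b(2) dom_exp_dom by (simp add: ratfun_of_Add)
    show ?case unfolding substitutes_def
    proof (intro exI[of _ "Add a b"] conjI ballI, goal_cases)
      case 5
      have "ratfun_of_ncpoly (f + g) - ratfun_of (Add a b)
          = (ratfun_of_ncpoly f - ratfun_of a) + (ratfun_of_ncpoly g - ratfun_of b)"
        by (simp add: ab ratfun_of_ncpoly_hom)
      then show ?case using Ir_add[OF a(5) b(5)] by simp
    qed (use a b R_closed(1)[OF a(4) b(4)] in \<open>auto simp: ab ratexp_dom_Add ncpoly_eval_add\<close>)
  next
    case (mult f g)
    then obtain a b where "substitutes a f" "substitutes b g" by blast
    note a = substitutesD[OF this(1)] and b = substitutesD[OF this(2)]
    have ab: "ratfun_of (Mul a b) = ratfun_of a * ratfun_of b"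
      using a(2) b(2) dom_exp_dom by (simp add: ratfun_of_Mul)
    show ?case unfolding substitutes_def
    proof (intro exI[of _ "Mul a b"] conjI ballI, goal_cases)
      case (3 nA)
      obtain n A where nA: "nA = (n, A)" by (cases nA)
      then show ?case using 3 a(3)[of n A] b(3)[of n A] graph_point_tuple[of n A]
        by (simp add: ncpoly_eval_mult mat_tuple_def)
    next
      case 5
      have "ratfun_of_ncpoly (f * g) - ratfun_of (Mul a b)
          = ratfun_of_ncpoly f * (ratfun_of_ncpoly g - ratfun_of b) + (ratfun_of_ncpoly f - ratfun_of a) * ratfun_of b"
        by (simp add: ab ratfun_of_ncpoly_hom algebra_simps)
      moreover have "ratfun_of_ncpoly f * (ratfun_of_ncpoly g - ratfun_of b) \<in> resolution_ideal V r"
        using Ir.I_l_closed[OF b(5) R_carrier_ncpoly[of f]] by simp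
      moreover have "(ratfun_of_ncpoly f - ratfun_of a) * ratfun_of b \<in> resolution_ideal V r"
        using Ir.I_r_closed[OF a(5) b(4)] by simp
      ultimately show ?case using Ir_add by simp
    qed (use a b R_closed(2)[OF a(4) b(4)] in \<open>auto simp: ab ratexp_dom_Mul\<close>)
  qed
qed

text \<open>
  Elements of the resolution ideal vanish on the graph of \<open>r\<close>, and restricting a function of the
  variables in \<open>V\<close> to the graph does not change it.
\<close>

lemma resolution_ideal_over_V:
  assumes e: "ratexp_over V e" "ratexp_dom e \<noteq> {}" and mem: "ratfun_of e \<in> resolution_ideal V r"
  shows "ratexp_equiv e (Pol 0)"
proof -
  \<comment> \<open>\<open>a\<close> vanishes on the graph wherever it is defined there.\<close>
  define Q where "Q a \<longleftrightarrow> (\<forall>n A. (n, A) \<in> ratexp_dom a \<longrightarrow> (n, A) \<in> ratexp_dom dom_exp \<longrightarrow>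
    ratexp_eval n (graph_point n A) a = Some (0\<^sub>m n n))" for a
  have defd: "\<exists>M. ratexp_eval n (graph_point n A) a = Some M \<and> M \<in> carrier_mat n n"
    if "inv_over V a" "(n, A) \<in> ratexp_dom a" "(n, A) \<in> ratexp_dom dom_exp" for n A a
  proof -
    from graph_point_dom[OF that] obtain M where "ratexp_eval n (graph_point n A) a = Some M"
      by (auto simp: ratexp_dom_def)
    then show ?thesis using ratexp_eval_carrier by blast
  qed
  obtain a where a: "inv_over V a" "ratexp_dom a \<noteq> {}" "ratfun_of a = ratfun_of e" "Q a"
  proof (rule genideal_represented[OF resolution_ideal_generators, of Q])
    show "ratfun_of e \<in> genideal R {ratfun_of_ncpoly (ncvar j) - r j |j. j \<in> - V}"
      using mem by (simp add: resolution_ideal_def)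
    show "Q (Pol 0)" by (simp add: Q_def ncpoly_eval_0)
    show "Q (Add a b)" if "Q a" "Q b" for a b using that by (auto simp: Q_def ratexp_dom_Add)
    show "Q (Mul a b)" if ab: "inv_over V a" "Q b" for a b
      unfolding Q_def
    proof (intro allI impI)
      fix n A assume "(n, A) \<in> ratexp_dom (Mul a b)" and D: "(n, A) \<in> ratexp_dom dom_exp"
      then have "(n, A) \<in> ratexp_dom a" "(n, A) \<in> ratexp_dom b" by (simp_all add: ratexp_dom_Mul)
      moreover from defd[OF ab(1) this(1) D] obtain M
        where "ratexp_eval n (graph_point n A) a = Some M" "M \<in> carrier_mat n n" by blast
      ultimately show "ratexp_eval n (graph_point n A) (Mul a b) = Some (0\<^sub>m n n)"
        using ab(2) D by (simp add: Q_def)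
    qed
    show "Q (Mul a b)" if ab: "inv_over V b" "Q a" for a b
      unfolding Q_def
    proof (intro allI impI)
      fix n A assume "(n, A) \<in> ratexp_dom (Mul a b)" and D: "(n, A) \<in> ratexp_dom dom_exp"
      then have "(n, A) \<in> ratexp_dom a" "(n, A) \<in> ratexp_dom b" by (simp_all add: ratexp_dom_Mul)
      moreover from defd[OF ab(1) this(2) D] obtain M
        where "ratexp_eval n (graph_point n A) b = Some M" "M \<in> carrier_mat n n" by blast
      ultimately show "ratexp_eval n (graph_point n A) (Mul a b) = Some (0\<^sub>m n n)"
        using ab(2) D by (simp add: Q_def)
    qed
    fix s assume "s \<in> {ratfun_of_ncpoly (ncvar j) - r j |j. j \<in> - V}"
    then obtain j where j: "j \<notin> V" "s = ratfun_of_ncpoly (ncvar j) - r j" by auto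
    let ?m = "Mul (Pol (Poly_Mapping.single 0 (- 1))) (re j)"
    have dom: "ratexp_dom ?m \<noteq> {}" by (intro ratexp_dom_Mul_nonempty ratexp_dom_Pol re_dom j)
    have "Q (Add (Pol (ncvar j)) ?m)" unfolding Q_def
    proof (intro allI impI)
      fix n A assume D: "(n, A) \<in> ratexp_dom dom_exp"
      have G: "graph_point n A x \<in> carrier_mat n n" for x
        using graph_point_tuple[OF D] by (simp add: mat_tuple_def)
      have "ratexp_eval n (graph_point n A) (re j) = Some (graph_point n A j)"
        using graph_point_over[OF re_over[OF j(1)], of n A] re_defined[OF D j(1)] by simp
      moreover have "graph_point n A j + (- 1 \<cdot>\<^sub>m 1\<^sub>m n) * graph_point n A j = 0\<^sub>m n n"
        using G[of j] by (simp add: mult_smult_assoc_mat[of _ n n _ n]) (rule eq_matI, auto)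
      ultimately show "ratexp_eval n (graph_point n A) (Add (Pol (ncvar j)) ?m) = Some (0\<^sub>m n n)"
        by (simp add: ncpoly_eval_var[OF G] ncpoly_eval_const)
    qed
    then show "\<exists>e. inv_over V e \<and> ratexp_dom e \<noteq> {} \<and> ratfun_of e = s \<and> Q e"
      using j re_over[OF j(1)] re_dom[OF j(1)] dom
      by (intro exI[of _ "Add (Pol (ncvar j)) ?m"])
        (simp add: ratexp_over_imp_inv_over ratexp_dom_Add_nonempty ratexp_dom_Pol ratfun_of_Add
          ratfun_of_uminus re_r ratfun_of_ncpoly_def)
  qed (rule that)
  have equiv: "ratexp_equiv a e" using a(3) by (simp add: ratfun_of_eq_iff a(2) e(2))
  \<comment> \<open>A representative of zero that is defined only where both \<open>a\<close> and the graph are; it links \<open>e\<close> to \<open>0\<close>.\<close>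
  let ?b = "Mul (Pol 0) (Add a dom_exp)"
  have b: "ratexp_dom ?b \<noteq> {}"
    using a(2) dom_exp_dom by (intro ratexp_dom_Mul_nonempty ratexp_dom_Pol ratexp_dom_Add_nonempty)
  have "ratexp_equiv e ?b"
  proof (rule ratexp_equivI[OF e(2) b])
    fix n A assume tup: "mat_tuple n A" and eD: "ratexp_eval n A e \<noteq> None" and bD: "ratexp_eval n A ?b \<noteq> None"
    then have D: "(n, A) \<in> ratexp_dom a" "(n, A) \<in> ratexp_dom dom_exp"
      by (auto simp: ratexp_dom_def split: option.splits)
    have G: "(n, graph_point n A) \<in> ratexp_dom a" by (rule graph_point_dom[OF a(1) D])
    have "ratexp_eval n A e = ratexp_eval n (graph_point n A) e" by (rule graph_point_over[OF e(1), symmetric])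
    also have "\<dots> = ratexp_eval n (graph_point n A) a"
    proof -
      have "(n, graph_point n A) \<in> ratexp_dom e"
        using graph_point_over[OF e(1), of n A] eD graph_point_tuple[OF D(2)] by (simp add: ratexp_dom_def)
      then show ?thesis using equiv G by (simp add: ratexp_equiv_def)
    qed
    also have "\<dots> = Some (0\<^sub>m n n)" using a(4) D by (simp add: Q_def)
    also have "\<dots> = ratexp_eval n A ?b"
      using bD by (auto simp: ncpoly_eval_0 split: option.splits dest!: ratexp_eval_carrier)
    finally show "ratexp_eval n A e = ratexp_eval n A ?b" .
  qed
  moreover have "ratexp_equiv ?b (Pol 0)"
    by (rule ratexp_equivI[OF b ratexp_dom_Pol])
      (auto simp: ncpoly_eval_0 split: option.splits dest!: ratexp_eval_carrier)
  ultimately show ?thesis by (rule ratexp_equiv_trans)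
qed

text \<open>
  For \<open>h \<in> I\<close> the function \<open>h(X', r(X'))\<close> depends on \<open>V\<close> only and is congruent to \<open>h\<close>, so it lies in the resolution ideal
  and vanishes wherever it is defined, not merely at generic points.
\<close>

lemma graph_point_vanishing:
  assumes I: "ratfun_of_ncpoly ` I \<subseteq> resolution_ideal V r" and D: "(n, A) \<in> ratexp_dom dom_exp"
  shows "(n, graph_point n A) \<in> vanishing_set I"
proof -
  interpret Ir: ideal "resolution_ideal V r" R by (rule ideal_resolution_ideal)
  have "ncpoly_eval n (graph_point n A) h = 0\<^sub>m n n" if h: "h \<in> I" for h
  proof -
    obtain e where "substitutes e h" using substitution_exists by blast
    note e = substitutesD[OF this]
    have "ratfun_of_ncpoly h \<in> resolution_ideal V r" using I h by blast
    moreover have "- (ratfun_of_ncpoly h - ratfun_of e) \<in> resolution_ideal V r"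
      using additive_subgroup.a_inv_closed[OF Ir.is_additive_subgroup e(5)]
        R_a_inv[OF R_closed(4)[OF R_carrier_ncpoly e(4)]] by simp
    ultimately have "ratfun_of_ncpoly h + - (ratfun_of_ncpoly h - ratfun_of e) \<in> resolution_ideal V r"
      using additive_subgroup.a_closed[OF Ir.is_additive_subgroup] by fastforce
    then have "ratfun_of e \<in> resolution_ideal V r" by simp
    then have "ratexp_equiv e (Pol 0)"
      using e(1,2) dom_exp_dom by (intro resolution_ideal_over_V) auto
    moreover have "(n, A) \<in> ratexp_dom e \<inter> ratexp_dom (Pol 0)"
      using D e(2) by (auto simp: ratexp_dom_def)
    ultimately have "ratexp_eval n A e = ratexp_eval n A (Pol 0)" by (simp add: ratexp_equiv_def)
    then show ?thesis using e(3)[OF D] by (simp add: ncpoly_eval_0)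
  qed
  then show ?thesis using graph_point_tuple[OF D] by (simp add: vanishing_set_def)
qed

lemma vanishing_imp_resolution_ideal:
  assumes f: "\<And>n A. (n, A) \<in> ratexp_dom dom_exp \<Longrightarrow> ncpoly_eval n (graph_point n A) f = 0\<^sub>m n n"
  shows "ratfun_of_ncpoly f \<in> resolution_ideal V r"
proof -
  obtain e where "substitutes e f" using substitution_exists by blast
  note e = substitutesD[OF this]
  have "ratexp_equiv e (Pol 0)"
  proof (rule ratexp_equivI)
    fix n A assume "mat_tuple n A" "ratexp_eval n A e \<noteq> None"
    then have "(n, A) \<in> ratexp_dom dom_exp" unfolding e(2)[symmetric] by (simp add: ratexp_dom_def)
    then show "ratexp_eval n A e = ratexp_eval n A (Pol 0)" using e(3) f by (simp add: ncpoly_eval_0)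
  qed (use e(2) dom_exp_dom in \<open>auto simp: ratexp_dom_Pol\<close>)
  then have "ratfun_of e = 0"
    using ratfun_of_eq_iff[of e "Pol 0"] e(2) dom_exp_dom by (simp add: ratexp_dom_Pol ratfun_of_0)
  then show ?thesis using e(5) by simp
qed

end

lemma resolution_exists:
  fixes V :: "'x::finite set" and r :: "'x \<Rightarrow> ('x, 'k::field_char_0) ratfun"
  assumes r: "\<And>j. j \<notin> V \<Longrightarrow> r j \<in> ratfuns_over V"
  obtains re dom_exp where "resolution V r re dom_exp"
proof -
  have "\<exists>e. j \<notin> V \<longrightarrow> ratexp_dom e \<noteq> {} \<and> ratexp_over V e \<and> ratfun_of e = r j" for j
  proof (cases "j \<in> V")
    case False
    from r[OF this] obtain e where "r j = ratfun_of e" "ratexp_dom e \<noteq> {}" "ratexp_over V e"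
      unfolding ratfuns_over_def by blast
    then show ?thesis by (intro exI[of _ e]) simp
  qed simp
  then obtain re where re: "\<And>j. j \<notin> V \<Longrightarrow> ratexp_dom (re j) \<noteq> {} \<and> ratexp_over V (re j) \<and> ratfun_of (re j) = r j"
    by metis
  have "\<exists>e. ratexp_over V e \<and> ratexp_dom e \<noteq> {} \<and> (\<forall>j\<in>F. ratexp_dom e \<subseteq> ratexp_dom (re j))"
    if "F \<subseteq> - V" for F
  proof -
    have "finite F" by simp
    then show ?thesis using that
    proof (induction F rule: finite_induct)
      case empty
      show ?case by (intro exI[of _ "Pol 0"]) (simp add: ratexp_dom_Pol ncpolys_over_def)
    next
      case (insert j F)
      then obtain e where "ratexp_over V e" "ratexp_dom e \<noteq> {}" "\<forall>j\<in>F. ratexp_dom e \<subseteq> ratexp_dom (re j)"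
        by auto
      then show ?case using insert.prems re[of j]
        by (intro exI[of _ "Add (re j) e"]) (simp add: ratexp_dom_Add_nonempty, auto simp: ratexp_dom_Add)
    qed
  qed
  from this[of "- V"] obtain e where "ratexp_over V e" "ratexp_dom e \<noteq> {}"
    "\<forall>j\<in>- V. ratexp_dom e \<subseteq> ratexp_dom (re j)" by auto
  then have "resolution V r re e" using re by unfold_locales auto
  then show thesis by (rule that)
qed

theorem theorem1p2:
  fixes I :: "('x::finite, 'k::field_char_0) ncpoly set"
  assumes "ideal I ncpoly_ring"
    and "formally_rationally_resolvable I"
    and "sylvester_domain (ncpoly_ring Quot I)"
  shows "nullstellensatz_property I"
proof -
  from assms(2) obtain V r where r: "\<And>j. j \<notin> V \<Longrightarrow> r j \<in> ratfuns_over V"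
    and gen: "genideal (resolution_ring V r) (ratfun_of_ncpoly ` I) = resolution_ideal V r"
    unfolding formally_rationally_resolvable_def formally_rationally_resolvable_wrt_def by auto
  obtain re dom_exp where "resolution V r re dom_exp" using resolution_exists[of V r, OF r] by blast
  then interpret resolution V r re dom_exp .
  interpret sylvester_ideal I by (rule sylvester_ideal_if_sylvester_domain_Quot[OF assms(1,3)])
  have IR: "ratfun_of_ncpoly ` I \<subseteq> carrier R" using R_carrier_ncpoly by blast
  have I_mem: "ratfun_of_ncpoly ` I \<subseteq> resolution_ideal V r"
    using ring.genideal_self[OF ring_R IR] unfolding gen .
  have "f \<in> I" if f: "\<forall>(n, A)\<in>vanishing_set I. ncpoly_eval n A f = 0\<^sub>m n n" for f
  proof -
    have mem: "ratfun_of_ncpoly f \<in> genideal R (ratfun_of_ncpoly ` I)"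
      unfolding gen
    proof (rule vanishing_imp_resolution_ideal)
      fix n A assume "(n, A) \<in> ratexp_dom dom_exp"
      from bspec[OF f graph_point_vanishing[OF I_mem this]]
      show "ncpoly_eval n (graph_point n A) f = 0\<^sub>m n n" by simp
    qed
    obtain e where e: "inv_over V e" "ratexp_dom e \<noteq> {}" "ratfun_of e = ratfun_of_ncpoly f"
        "null_represented I e"
    proof (rule genideal_represented[OF IR, of "null_represented I" "ratfun_of_ncpoly f"])
      fix s assume "s \<in> ratfun_of_ncpoly ` I"
      then obtain h where "h \<in> I" "s = ratfun_of (Pol h)" by (auto simp: ratfun_of_ncpoly_def)
      then show "\<exists>e. inv_over V e \<and> ratexp_dom e \<noteq> {} \<and> ratfun_of e = s \<and> null_represented I e"
        using null_represented_Pol[of h I] by (intro exI[of _ "Pol h"]) (simp add: ratexp_dom_Pol)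
    next
      show "null_represented I (Pol 0)" by (rule null_represented_Pol[OF zero_mem])
      show "null_represented I (Add a b)" if "null_represented I a" "null_represented I b" for a b
        by (rule null_represented_Add[OF two_sided_ideal_axioms that])
      show "null_represented I (Mul a b)" if "null_represented I b" for a b
        by (rule null_represented_Mul_right[OF two_sided_ideal_axioms that])
      show "null_represented I (Mul a b)" if "null_represented I a" for a b
        by (rule null_represented_Mul_left[OF two_sided_ideal_axioms that])
    qed (rule mem, rule that)
    have equiv: "ratexp_equiv e (Pol f)"
      using e(3) by (simp add: ratfun_of_ncpoly_def ratfun_of_eq_iff e(2) ratexp_dom_Pol)
    obtain n A where A: "(n, A) \<in> ratexp_dom e" "(n, A) \<in> ratexp_dom dom_exp"
      using ratexp_common_point[OF e(2) dom_exp_dom] by auto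
    show "f \<in> I"
    proof (rule null_represented_polynomial_mem[OF sylvester_ideal_axioms e(4)])
      have "(n, graph_point n A) \<in> ratexp_dom e \<inter> vanishing_set I"
        by (rule IntI[OF graph_point_dom[OF e(1) A] graph_point_vanishing[OF I_mem A(2)]])
      then show "ratexp_dom e \<inter> vanishing_set I \<noteq> {}" by (metis empty_iff)
      fix n A assume "(n, A) \<in> ratexp_dom e"
      moreover from this have "(n, A) \<in> ratexp_dom (Pol f)" by (simp add: ratexp_dom_def)
      ultimately show "ratexp_eval n A e = Some (ncpoly_eval n A f)"
        using equiv by (auto simp: ratexp_equiv_def)
    qed
  qed
  moreover have "\<forall>(n, A)\<in>vanishing_set I. ncpoly_eval n A f = 0\<^sub>m n n" if "f \<in> I" for f
    using that by (auto simp: vanishing_set_def)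
  ultimately show ?thesis unfolding nullstellensatz_property_def by (intro allI iffI)
qed

end
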